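(* Let $k$ be an algebraically closed field of characteristic $0$, let $n\ge 2$, $h=2^{n-1}$, $G=\langle x\rangle\times\langle y\rangle\cong\mathbb{Z}_{2^n}\times\mathbb{Z}_{2^n}$, and $L=\langle t\rangle\cong\mathbb{Z}_2$. Let $H$ be a nontrivial semisimple Hopf algebra of dimension $2^{2n+1}$ with $\mathbf{G}(H)\cong\mathbb{Z}_{2^n}\times\mathbb{Z}_{2^n}$, written (up to equivalence) as a bicrossed product $k^G\#_\sigma^\tau kL$ with trivial coaction and with $L$ acting on $G$ by $t\rightharpoonup x=x^ay^b$, $t\rightharpoonup y=x^cy^d$, where $A=\begin{bmatrix} a & c \\ b & d \end{bmatrix}\neq I$ is one of the following matrices over $\mathbb{Z}_{2^n}$: $$\begin{bmatrix} 0 & 1 \\ 1 & 0 \end{bmatrix};\ \begin{bmatrix} -1 & 0 \\ 0 & -1 \end{bmatrix};\ \begin{bmatrix} 1+h & 0 \\ 0 & 1+h \end{bmatrix};\ \begin{bmatrix} -1+h & 0 \\ 0 & -1+h \end{bmatrix};\ \begin{bmatrix} \epsilon & 0 \\ h & \epsilon \end{bmatrix}\ (\epsilon\in\{1,-1,1+h,-1+h\});$$ $$\begin{bmatrix} 1 & 0 \\ 0 & 1+h \end{bmatrix};\ \begin{bmatrix} -1 & 0 \\ 0 & -1+h \end{bmatrix};\ \begin{bmatrix} 1 & h \\ h & 1+h \end{bmatrix};\ \begin{bmatrix} -1 & h \\ h & -1+h \end{bmatrix};$$ $$\begin{bmatrix} 1 & 0 \\ 0 & -1 \end{bmatrix};\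 \begin{bmatrix} 1+h & 0 \\ 0 & -1+h \end{bmatrix};\ \begin{bmatrix} 1 & 0 \\ 0 & -1+h \end{bmatrix};\ \begin{bmatrix} 1+h & 0 \\ 0 & -1 \end{bmatrix}.$$ Then, for this action of $L$ on $G$, $$\mathrm{H}^2(kL,k^G)\cong \mathrm{H}^2_c(kL,k^G)\cong \mathrm{Ker}\,\Psi\times\mathrm{Im}\,\Psi\cong \hat G^L/N_t(\hat G)\times M(G)^-\cong \mathrm{H}^2(L,\hat G)\times M(G)^-.$$
   Context: Nontrivial means noncommutative and noncocommutative. $\mathbf{G}(H)$ is the group of group-like elements. Let $L=\langle t\rangle$ of order $2$ act on a finite group $G$ by group automorphisms. Let $\{p_g\}$ be the basis of $k^G=(kG)^*$ dual to $G$. $\mathrm{Z}^2(kL,k^G)$ is the group (pointwise multiplication) of pairs $(\sigma,\tau)$, $\sigma:G\to k^\times$, $\tau:G\times G\to k^\times$, such that for all $g,u,v\in G$: $\sigma(1)=1$; $\tau(1,u)=\tau(g,1)=1$; $\sigma(t\rightharpoonup g)=\sigma(g)$; $\tau(g,u)\tau(gu,v)=\tau(g,uv)\tau(u,v)$; $\sigma(gu)=\tau(g,u)\,\tau(t\rightharpoonup g,t\rightharpoonup u)\,\sigma(g)\sigma(u)$. $\mathrm{B}^2(kL,k^G)$ is the subgroup of pairs of the form $\sigma(g)=\gamma(g)\gamma(t\rightharpoonup g)$, $\tau(g,u)=\gamma(g)^{-1}\gamma(u)^{-1}\gamma(gu)$ with $\gamma:G\to k^\times$, $\gamma(1)=1$.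 $\mathrm{H}^2(kL,k^G)=\mathrm{Z}^2/\mathrm{B}^2$; it classifies, up to equivalence (Hopf isomorphism inducing the identity on $k^G$ and $kL$), the abelian extensions of $kL$ by $k^G$ with the given action and trivial coaction. $\mathrm{H}^2_c(kL,k^G)=\mathrm{Z}^2_c/\mathrm{B}^2_c$, where $\mathrm{Z}^2_c=\{\tau : (1,\tau)\in\mathrm{Z}^2(kL,k^G)\}$ and $\mathrm{B}^2_c$ consists of the $\tau$ with $(1,\tau)\in \mathrm{B}^2(kL,k^G)$; since $L$ is cyclic and $k$ is algebraically closed, every class in $\mathrm{H}^2(kL,k^G)$ has a representative $(1,\tau)$ and $\mathrm{H}^2_c=\mathrm{H}^2$. The bicrossed product $k^G\#_\sigma^\tau kL$ for $(\sigma,\tau)\in \mathrm{Z}^2(kL,k^G)$ has basis $p_g\#t^j$ ($g\in G$, $j=0,1$), multiplication $(p_g\#t^i)(p_u\#t^j)=\delta_{g,\,t^i\rightharpoonup u}\,s_{ij}(g)\,p_g\#t^{i+j}$ with $s_{11}=\sigma$ and $s_{ij}=1$ otherwise, and comultiplication $\Delta(p_g\#t^j)=\sum_{uv=g}\tau(u,v)^j\,(p_u\#t^j)\otimes(p_v\#t^j)$. $M(G)=\mathrm{H}^2(G,k^\times)$ is the Schur multiplier, with $L$-action $t\rightharpoonup[\alpha]=[t\rightharpoonup\alpha]$, $(t\rightharpoonup\alpha)(g,u)=\alpha(t\rightharpoonup g,t\rightharpoonup u)$, and $M(G)^-=\{[\alpha]\in M(G): t\rightharpoonup[\alpha]=[\alpha]^{-1}\}$.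 $\Psi:\mathrm{H}^2(kL,k^G)=\mathrm{H}^2_c(kL,k^G)\to M(G)$ is the homomorphism $\Psi([(1,\tau)])=[\tau]$. $\hat G=\mathrm{Hom}(G,k^\times)$ with $(t\rightharpoonup\beta)(g)=\beta(t\rightharpoonup g)$, $\hat G^L$ is its subgroup of $L$-fixed elements, and $N_t(\hat G)=\{\gamma\,(t\rightharpoonup\gamma):\gamma\in\hat G\}$. *)

theory Defs
  imports
    Complex_Main
    "HOL-Computational_Algebra.Polynomial"
    "HOL-Number_Theory.Cong"
    "HOL-Algebra.Algebra"
begin

text \<open>
  Elements of a tensor product over a field are given by lists of pure tensors, as in Sweedler's
  notation. Two such lists denote the same tensor iff all bilinear (trilinear) forms take the same
  value on them; over a field, multilinear forms separate the points of a tensor product.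
\<close>

definition bilinear_form :: "('k::field \<Rightarrow> 'h::ab_group_add \<Rightarrow> 'h) \<Rightarrow> ('h \<Rightarrow> 'h \<Rightarrow> 'k) \<Rightarrow> bool" where
  "bilinear_form s f \<longleftrightarrow>
     (\<forall>y. Vector_Spaces.linear s (*) (\<lambda>x. f x y)) \<and> (\<forall>x. Vector_Spaces.linear s (*) (\<lambda>y. f x y))"

definition trilinear_form ::
  "('k::field \<Rightarrow> 'h::ab_group_add \<Rightarrow> 'h) \<Rightarrow> ('h \<Rightarrow> 'h \<Rightarrow> 'h \<Rightarrow> 'k) \<Rightarrow> bool" where
  "trilinear_form s f \<longleftrightarrow>
     (\<forall>y z. Vector_Spaces.linear s (*) (\<lambda>x. f x y z)) \<and>
     (\<forall>x z. Vector_Spaces.linear s (*) (\<lambda>y. f x y z)) \<and>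
     (\<forall>x y. Vector_Spaces.linear s (*) (\<lambda>z. f x y z))"

definition pairing2 :: "('h \<Rightarrow> 'h \<Rightarrow> 'k::comm_monoid_add) \<Rightarrow> ('h \<times> 'h) list \<Rightarrow> 'k" where
  "pairing2 f zs = (\<Sum>(a, b)\<leftarrow>zs. f a b)"

definition pairing3 ::
  "('h \<Rightarrow> 'h \<Rightarrow> 'h \<Rightarrow> 'k::comm_monoid_add) \<Rightarrow> ('h \<times> 'h \<times> 'h) list \<Rightarrow> 'k" where
  "pairing3 f zs = (\<Sum>(a, b, c)\<leftarrow>zs. f a b c)"

definition tensor_eq2 ::
  "('k::field \<Rightarrow> 'h::ab_group_add \<Rightarrow> 'h) \<Rightarrow> ('h \<times> 'h) list \<Rightarrow> ('h \<times> 'h) list \<Rightarrow> bool" where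
  "tensor_eq2 s zs ws \<longleftrightarrow> (\<forall>f. bilinear_form s f \<longrightarrow> pairing2 f zs = pairing2 f ws)"

definition tensor_eq3 ::
  "('k::field \<Rightarrow> 'h::ab_group_add \<Rightarrow> 'h) \<Rightarrow> ('h \<times> 'h \<times> 'h) list \<Rightarrow> ('h \<times> 'h \<times> 'h) list \<Rightarrow> bool" where
  "tensor_eq3 s zs ws \<longleftrightarrow> (\<forall>f. trilinear_form s f \<longrightarrow> pairing3 f zs = pairing3 f ws)"

text \<open>The ring structure of the algebra is that of the type \<open>'h\<close>; \<open>\<Delta>\<close> picks a Sweedler
  representative of the comultiplication.\<close>

locale hopf_algebra = vector_space scale
  for scale :: "'k::field \<Rightarrow> 'h::ring_1 \<Rightarrow> 'h" +
  fixes \<Delta> :: "'h \<Rightarrow> ('h \<times> 'h) list"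
    and \<epsilon> :: "'h \<Rightarrow> 'k"
    and S :: "'h \<Rightarrow> 'h"
  assumes scale_mult_left: "scale c x * y = scale c (x * y)"
    and scale_mult_right: "x * scale c y = scale c (x * y)"
    and comult_add: "tensor_eq2 scale (\<Delta> (x + y)) (\<Delta> x @ \<Delta> y)"
    and comult_scale: "tensor_eq2 scale (\<Delta> (scale c x)) [(scale c a, b). (a, b) \<leftarrow> \<Delta> x]"
    and counit_linear: "Vector_Spaces.linear scale (*) \<epsilon>"
    and coassoc: "tensor_eq3 scale [(p, q, b). (a, b) \<leftarrow> \<Delta> x, (p, q) \<leftarrow> \<Delta> a]
                                   [(a, p, q). (a, b) \<leftarrow> \<Delta> x, (p, q) \<leftarrow> \<Delta> b]"
    and counit_left: "(\<Sum>(a, b)\<leftarrow>\<Delta> x. scale (\<epsilon> a) b) = x"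
    and counit_right: "(\<Sum>(a, b)\<leftarrow>\<Delta> x. scale (\<epsilon> b) a) = x"
    and comult_one: "tensor_eq2 scale (\<Delta> 1) [(1, 1)]"
    and comult_mult:
      "tensor_eq2 scale (\<Delta> (x * y)) [(a * p, b * q). (a, b) \<leftarrow> \<Delta> x, (p, q) \<leftarrow> \<Delta> y]"
    and counit_one: "\<epsilon> 1 = 1"
    and counit_mult: "\<epsilon> (x * y) = \<epsilon> x * \<epsilon> y"
    and antipode_linear: "Vector_Spaces.linear scale scale S"
    and antipode_left: "(\<Sum>(a, b)\<leftarrow>\<Delta> x. S a * b) = scale (\<epsilon> x) 1"
    and antipode_right: "(\<Sum>(a, b)\<leftarrow>\<Delta> x. a * S b) = scale (\<epsilon> x) 1"
begin

definition noncommutative :: bool where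
  "noncommutative \<longleftrightarrow> (\<exists>x y :: 'h. x * y \<noteq> y * x)"

definition noncocommutative :: bool where
  "noncocommutative \<longleftrightarrow> (\<exists>x. \<not> tensor_eq2 scale (\<Delta> x) [(b, a). (a, b) \<leftarrow> \<Delta> x])"

definition nontrivial :: bool where
  "nontrivial \<longleftrightarrow> noncommutative \<and> noncocommutative"

definition left_ideal :: "'h set \<Rightarrow> bool" where
  "left_ideal I \<longleftrightarrow> subspace I \<and> (\<forall>a. \<forall>x\<in>I. a * x \<in> I)"

text \<open>Semisimplicity of the left regular module.\<close>

definition semisimple :: bool where
  "semisimple \<longleftrightarrow>
     (\<forall>I. left_ideal I \<longrightarrow>
        (\<exists>J. left_ideal J \<and> I \<inter> J = {0} \<and> {a + b | a b. a \<in> I \<and> b \<in> J} = UNIV))"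

definition grouplikes :: "'h monoid" where
  "grouplikes = \<lparr>carrier = {g. g \<noteq> 0 \<and> tensor_eq2 scale (\<Delta> g) [(g, g)]}, mult = (*), one = 1\<rparr>"

text \<open>
  The bicrossed product of \<open>k\<^sup>G\<close> and \<open>kL\<close> with trivial coaction, for \<open>L = {1, t}\<close> acting on
  \<open>G\<close> by \<open>\<phi>\<close>: the algebra has a basis \<open>w g l = p\<^sub>g # l\<close> with the prescribed multiplication and
  comultiplication. Unit, counit and antipode are determined by these. The comultiplication
  formula is an identity in the tensor square, tested against all bilinear forms.
\<close>

definition is_bicrossed_product ::
  "'g monoid \<Rightarrow> 'l monoid \<Rightarrow> 'l \<Rightarrow> ('l \<Rightarrow> 'g \<Rightarrow> 'g) \<Rightarrow> ('g \<Rightarrow> 'k) \<Rightarrow> ('g \<times> 'g \<Rightarrow> 'k) \<Rightarrow> bool" where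
  "is_bicrossed_product G L t \<phi> \<sigma> \<tau> \<longleftrightarrow>
     (\<exists>w :: 'g \<Rightarrow> 'l \<Rightarrow> 'h.
        inj_on (\<lambda>(g, l). w g l) (carrier G \<times> carrier L) \<and>
        independent ((\<lambda>(g, l). w g l) ` (carrier G \<times> carrier L)) \<and>
        span ((\<lambda>(g, l). w g l) ` (carrier G \<times> carrier L)) = UNIV \<and>
        (\<forall>g\<in>carrier G. \<forall>u\<in>carrier G. \<forall>i\<in>carrier L. \<forall>j\<in>carrier L.
           w g i * w u j =
             (if g = \<phi> i u
              then scale (if i = t \<and> j = t then \<sigma> g else 1) (w g (i \<otimes>\<^bsub>L\<^esub> j)) else 0)) \<and>
        (\<forall>g\<in>carrier G. \<forall>j\<in>carrier L. \<forall>f. bilinear_form scale f \<longrightarrow>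
           pairing2 f (\<Delta> (w g j)) =
             (\<Sum>(u, v) \<in> {(u, v) \<in> carrier G \<times> carrier G. u \<otimes>\<^bsub>G\<^esub> v = g}.
                (if j = t then \<tau> (u, v) else 1) * f (w u j) (w v j))))"

end

text \<open>
  All cochains are functions in the sense of \<open>PiE\<close> (undefined off their domain), so that
  \<open>product_group\<close> is the group of cochains under pointwise multiplication.
\<close>

abbreviation fun_group :: "'s set \<Rightarrow> 'm monoid \<Rightarrow> ('s \<Rightarrow> 'm) monoid" where
  "fun_group D M \<equiv> product_group D (\<lambda>_. M)"

definition unit_group :: "'k::field monoid" where
  "unit_group = \<lparr>carrier = UNIV - {0}, mult = (*), one = 1\<rparr>"

text \<open>Below \<open>K\<close> is the group \<open>k\<^sup>\<times>\<close> and \<open>T\<close> is the action of the generator \<open>t\<close> of \<open>L\<close> on \<open>G\<close>.\<close>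

definition ext_cochains ::
  "'k monoid \<Rightarrow> 'g monoid \<Rightarrow> (('g \<Rightarrow> 'k) \<times> ('g \<times> 'g \<Rightarrow> 'k)) monoid" where
  "ext_cochains K G = fun_group (carrier G) K \<times>\<times> fun_group (carrier G \<times> carrier G) K"

definition Z2_ext ::
  "'k monoid \<Rightarrow> 'g monoid \<Rightarrow> ('g \<Rightarrow> 'g) \<Rightarrow> (('g \<Rightarrow> 'k) \<times> ('g \<times> 'g \<Rightarrow> 'k)) set" where
  "Z2_ext K G T = {(\<sigma>, \<tau>) \<in> carrier (ext_cochains K G).
     \<sigma> \<one>\<^bsub>G\<^esub> = \<one>\<^bsub>K\<^esub> \<and>
     (\<forall>g\<in>carrier G. \<tau> (\<one>\<^bsub>G\<^esub>, g) = \<one>\<^bsub>K\<^esub> \<and> \<tau> (g, \<one>\<^bsub>G\<^esub>) = \<one>\<^bsub>K\<^esub>) \<and>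
     (\<forall>g\<in>carrier G. \<sigma> (T g) = \<sigma> g) \<and>
     (\<forall>g\<in>carrier G. \<forall>u\<in>carrier G. \<forall>v\<in>carrier G.
        \<tau> (g, u) \<otimes>\<^bsub>K\<^esub> \<tau> (g \<otimes>\<^bsub>G\<^esub> u, v) = \<tau> (g, u \<otimes>\<^bsub>G\<^esub> v) \<otimes>\<^bsub>K\<^esub> \<tau> (u, v)) \<and>
     (\<forall>g\<in>carrier G. \<forall>u\<in>carrier G.
        \<sigma> (g \<otimes>\<^bsub>G\<^esub> u) = \<tau> (g, u) \<otimes>\<^bsub>K\<^esub> \<tau> (T g, T u) \<otimes>\<^bsub>K\<^esub> \<sigma> g \<otimes>\<^bsub>K\<^esub> \<sigma> u)}"

definition B2_ext ::
  "'k monoid \<Rightarrow> 'g monoid \<Rightarrow> ('g \<Rightarrow> 'g) \<Rightarrow> (('g \<Rightarrow> 'k) \<times> ('g \<times> 'g \<Rightarrow> 'k)) set" where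
  "B2_ext K G T =
     {(\<lambda>g\<in>carrier G. \<gamma> g \<otimes>\<^bsub>K\<^esub> \<gamma> (T g),
       restrict (\<lambda>(g, u). inv\<^bsub>K\<^esub> \<gamma> g \<otimes>\<^bsub>K\<^esub> inv\<^bsub>K\<^esub> \<gamma> u \<otimes>\<^bsub>K\<^esub> \<gamma> (g \<otimes>\<^bsub>G\<^esub> u)) (carrier G \<times> carrier G))
      | \<gamma>. \<gamma> \<in> carrier (fun_group (carrier G) K) \<and> \<gamma> \<one>\<^bsub>G\<^esub> = \<one>\<^bsub>K\<^esub>}"

definition H2_ext where
  "H2_ext K G T = (ext_cochains K G)\<lparr>carrier := Z2_ext K G T\<rparr> Mod B2_ext K G T"

definition Z2c_ext :: "'k monoid \<Rightarrow> 'g monoid \<Rightarrow> ('g \<Rightarrow> 'g) \<Rightarrow> ('g \<times> 'g \<Rightarrow> 'k) set" where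
  "Z2c_ext K G T = {\<tau>. (\<one>\<^bsub>fun_group (carrier G) K\<^esub>, \<tau>) \<in> Z2_ext K G T}"

definition B2c_ext :: "'k monoid \<Rightarrow> 'g monoid \<Rightarrow> ('g \<Rightarrow> 'g) \<Rightarrow> ('g \<times> 'g \<Rightarrow> 'k) set" where
  "B2c_ext K G T = {\<tau>. (\<one>\<^bsub>fun_group (carrier G) K\<^esub>, \<tau>) \<in> B2_ext K G T}"

definition H2c_ext :: "'k monoid \<Rightarrow> 'g monoid \<Rightarrow> ('g \<Rightarrow> 'g) \<Rightarrow> ('g \<times> 'g \<Rightarrow> 'k) set monoid" where
  "H2c_ext K G T =
     (fun_group (carrier G \<times> carrier G) K)\<lparr>carrier := Z2c_ext K G T\<rparr> Mod B2c_ext K G T"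

text \<open>\<open>Q\<close> acts on the abelian group \<open>M\<close> by \<open>\<psi>\<close>; cochains are normalized.\<close>

definition Z2_grp :: "'q monoid \<Rightarrow> 'm monoid \<Rightarrow> ('q \<Rightarrow> 'm \<Rightarrow> 'm) \<Rightarrow> ('q \<times> 'q \<Rightarrow> 'm) set" where
  "Z2_grp Q M \<psi> = {f \<in> carrier (fun_group (carrier Q \<times> carrier Q) M).
     (\<forall>a\<in>carrier Q. f (\<one>\<^bsub>Q\<^esub>, a) = \<one>\<^bsub>M\<^esub> \<and> f (a, \<one>\<^bsub>Q\<^esub>) = \<one>\<^bsub>M\<^esub>) \<and>
     (\<forall>a\<in>carrier Q. \<forall>b\<in>carrier Q. \<forall>c\<in>carrier Q.
        f (a, b) \<otimes>\<^bsub>M\<^esub> f (a \<otimes>\<^bsub>Q\<^esub> b, c) = f (a, b \<otimes>\<^bsub>Q\<^esub> c) \<otimes>\<^bsub>M\<^esub> \<psi> a (f (b, c)))}"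

definition B2_grp :: "'q monoid \<Rightarrow> 'm monoid \<Rightarrow> ('q \<Rightarrow> 'm \<Rightarrow> 'm) \<Rightarrow> ('q \<times> 'q \<Rightarrow> 'm) set" where
  "B2_grp Q M \<psi> =
     {restrict (\<lambda>(a, b). \<gamma> a \<otimes>\<^bsub>M\<^esub> \<psi> a (\<gamma> b) \<otimes>\<^bsub>M\<^esub> inv\<^bsub>M\<^esub> \<gamma> (a \<otimes>\<^bsub>Q\<^esub> b)) (carrier Q \<times> carrier Q)
      | \<gamma>. \<gamma> \<in> carrier (fun_group (carrier Q) M) \<and> \<gamma> \<one>\<^bsub>Q\<^esub> = \<one>\<^bsub>M\<^esub>}"

definition Z2_grp_group ::
  "'q monoid \<Rightarrow> 'm monoid \<Rightarrow> ('q \<Rightarrow> 'm \<Rightarrow> 'm) \<Rightarrow> ('q \<times> 'q \<Rightarrow> 'm) monoid" where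
  "Z2_grp_group Q M \<psi> = (fun_group (carrier Q \<times> carrier Q) M)\<lparr>carrier := Z2_grp Q M \<psi>\<rparr>"

definition H2_grp :: "'q monoid \<Rightarrow> 'm monoid \<Rightarrow> ('q \<Rightarrow> 'm \<Rightarrow> 'm) \<Rightarrow> ('q \<times> 'q \<Rightarrow> 'm) set monoid" where
  "H2_grp Q M \<psi> = Z2_grp_group Q M \<psi> Mod B2_grp Q M \<psi>"

definition schur :: "'k monoid \<Rightarrow> 'g monoid \<Rightarrow> ('g \<times> 'g \<Rightarrow> 'k) set monoid" where
  "schur K G = H2_grp G K (\<lambda>_ z. z)"

definition pullback2 :: "'g monoid \<Rightarrow> ('g \<Rightarrow> 'g) \<Rightarrow> ('g \<times> 'g \<Rightarrow> 'k) \<Rightarrow> ('g \<times> 'g \<Rightarrow> 'k)" where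
  "pullback2 G T \<alpha> = restrict (\<lambda>(g, u). \<alpha> (T g, T u)) (carrier G \<times> carrier G)"

text \<open>A class is a coset, and \<open>t\<close> sends the class of \<open>\<alpha>\<close> to its image under \<open>pullback2\<close>.\<close>

definition schur_minus_group ::
  "'k monoid \<Rightarrow> 'g monoid \<Rightarrow> ('g \<Rightarrow> 'g) \<Rightarrow> ('g \<times> 'g \<Rightarrow> 'k) set monoid" where
  "schur_minus_group K G T = (schur K G)\<lparr>carrier :=
     {c \<in> carrier (schur K G). pullback2 G T ` c = inv\<^bsub>schur K G\<^esub> c}\<rparr>"

text \<open>The coset in \<open>M(G)\<close> generated by any representative: all members of the union coincide.\<close>

definition Psi :: "'k monoid \<Rightarrow> 'g monoid \<Rightarrow> ('g \<times> 'g \<Rightarrow> 'k) set \<Rightarrow> ('g \<times> 'g \<Rightarrow> 'k) set" where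
  "Psi K G c = (\<Union>\<tau>\<in>c. B2_grp G K (\<lambda>_ z. z) #>\<^bsub>Z2_grp_group G K (\<lambda>_ z. z)\<^esub> \<tau>)"

definition Ker_Psi_group ::
  "'k monoid \<Rightarrow> 'g monoid \<Rightarrow> ('g \<Rightarrow> 'g) \<Rightarrow> ('g \<times> 'g \<Rightarrow> 'k) set monoid" where
  "Ker_Psi_group K G T =
     (H2c_ext K G T)\<lparr>carrier := kernel (H2c_ext K G T) (schur K G) (Psi K G)\<rparr>"

definition Im_Psi_group ::
  "'k monoid \<Rightarrow> 'g monoid \<Rightarrow> ('g \<Rightarrow> 'g) \<Rightarrow> ('g \<times> 'g \<Rightarrow> 'k) set monoid" where
  "Im_Psi_group K G T = (schur K G)\<lparr>carrier := Psi K G ` carrier (H2c_ext K G T)\<rparr>"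

definition char_group :: "'k monoid \<Rightarrow> 'g monoid \<Rightarrow> ('g \<Rightarrow> 'k) monoid" where
  "char_group K G = (fun_group (carrier G) K)\<lparr>carrier := hom G K \<inter> extensional (carrier G)\<rparr>"

text \<open>\<open>(l \<rightharpoonup> \<beta>)(g) = \<beta>(l \<rightharpoonup> g)\<close>; this is a left action because \<open>L\<close> is abelian.\<close>

definition char_act :: "'g monoid \<Rightarrow> ('l \<Rightarrow> 'g \<Rightarrow> 'g) \<Rightarrow> 'l \<Rightarrow> ('g \<Rightarrow> 'k) \<Rightarrow> ('g \<Rightarrow> 'k)" where
  "char_act G \<phi> l \<beta> = (\<lambda>g\<in>carrier G. \<beta> (\<phi> l g))"

definition char_fixed_group ::
  "'k monoid \<Rightarrow> 'g monoid \<Rightarrow> 'l monoid \<Rightarrow> ('l \<Rightarrow> 'g \<Rightarrow> 'g) \<Rightarrow> ('g \<Rightarrow> 'k) monoid" where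
  "char_fixed_group K G L \<phi> = (char_group K G)\<lparr>carrier :=
     {\<beta> \<in> carrier (char_group K G). \<forall>l\<in>carrier L. char_act G \<phi> l \<beta> = \<beta>}\<rparr>"

definition char_norms ::
  "'k monoid \<Rightarrow> 'g monoid \<Rightarrow> ('l \<Rightarrow> 'g \<Rightarrow> 'g) \<Rightarrow> 'l \<Rightarrow> ('g \<Rightarrow> 'k) set" where
  "char_norms K G \<phi> t =
     {\<gamma> \<otimes>\<^bsub>char_group K G\<^esub> char_act G \<phi> t \<gamma> | \<gamma>. \<gamma> \<in> carrier (char_group K G)}"

text \<open>Matrices over \<open>\<int>/2\<^sup>n\<close> are lists of rows of integer representatives.\<close>

definition mat_cong :: "int \<Rightarrow> int list list \<Rightarrow> int list list \<Rightarrow> bool" where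
  "mat_cong m A B \<longleftrightarrow> list_all2 (list_all2 (\<lambda>p q. [p = q] (mod m))) A B"

definition action_matrices :: "nat \<Rightarrow> int list list set" where
  "action_matrices n = (let h = 2 ^ (n - 1) in
     {[[0, 1], [1, 0]],
      [[-1, 0], [0, -1]],
      [[1 + h, 0], [0, 1 + h]],
      [[-1 + h, 0], [0, -1 + h]]} \<union>
     {[[e, 0], [h, e]] | e. e \<in> {1, -1, 1 + h, -1 + h}} \<union>
     {[[1, 0], [0, 1 + h]],
      [[-1, 0], [0, -1 + h]],
      [[1, h], [h, 1 + h]],
      [[-1, h], [h, -1 + h]]} \<union>
     {[[1, 0], [0, -1]],
      [[1 + h, 0], [0, -1 + h]],
      [[1, 0], [0, -1 + h]],
      [[1 + h, 0], [0, -1]]})"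

end

theory Submission
  imports Defs
begin

text \<open>
  A pair \<open>(\<sigma>, \<tau>)\<close> can be normalized to \<open>(1, \<tau>')\<close> because every \<open>t\<close>-invariant \<open>\<sigma>\<close> has the form
  \<open>\<gamma>(g) \<gamma>(t \<rightharpoonup> g)\<close>. A class in the kernel of \<open>\<Psi>\<close> is represented by the coboundary of
  some \<open>\<gamma>\<close> for which \<open>\<gamma> (t \<rightharpoonup> \<gamma>)\<close> is a character; this character, modulo norms of characters,
  identifies the kernel with \<open>X\<^sup>L / N\<^sub>t(X)\<close> for \<open>X = Hom(G, k\<^sup>\<times>)\<close>, which is \<open>H\<^sup>2(L, X)\<close> through
  \<open>f \<mapsto> f(t, t)\<close>.

  The Schur multiplier of \<open>G\<close> is cyclic: every cocycle is cohomologous to exactly one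
  \<open>\<tau>\<^sub>r(x\<^sup>i y\<^sup>j, x\<^sup>k y\<^sup>l) = \<zeta>\<^sup>r\<^sup>i\<^sup>l\<close> with \<open>r\<close> modulo \<open>2\<^sup>n\<close>, where \<open>\<zeta>\<close> is a primitive root of unity
  of order \<open>2\<^sup>n\<close>, and \<open>M(G)\<^sup>-\<close> is cut out by \<open>r (det A + 1) = 0\<close>. For each of the listed matrices there is a
  quadratic function \<open>q\<close> such that \<open>(\<zeta>\<^sup>r\<^sup>q, \<tau>\<^sub>r)\<close> is a cocycle for all those \<open>r\<close>: zero in most cases, \<open>i j\<close> for
  the exchange of \<open>x\<close> and \<open>y\<close>, and \<open>i\<^sup>2 + j\<^sup>2\<close> for two matrices with \<open>n = 2\<close>. This family is
  multiplicative in \<open>r\<close> and depends on \<open>r\<close> only modulo \<open>2\<^sup>n\<close>, so it is a homomorphic section of \<open>\<Psi>\<close> over all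
  of \<open>M(G)\<^sup>-\<close>.
\<close>

section \<open>Quotients \<open>Z/B\<close> inside an abelian group, and split epimorphisms\<close>

text \<open>Every group of cohomology classes below is such a quotient, with \<open>C\<close> a
  group of cochains. Restricting only the carrier makes \<open>quot\<close> agree literally with the
  definitions of \<open>H2_ext\<close>, \<open>H2c_ext\<close> and \<open>H2_grp\<close>.\<close>

locale subquotient = comm_group C for C :: "('a, 'b) monoid_scheme" (structure) +
  fixes Z B :: "'a set"
  assumes subgroup_Z: "subgroup Z C" and subgroup_B: "subgroup B C" and B_subset: "B \<subseteq> Z"
begin

abbreviation quot :: "'a set monoid" where
  "quot \<equiv> C\<lparr>carrier := Z\<rparr> Mod B"

text \<open>Cosets depend only on the multiplication, so they can be written over the full group
  \<open>C\<close> without mentioning \<open>Z\<close>.\<close>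

lemma rcoset_carrier_update: "r_coset (C\<lparr>carrier := Z\<rparr>) = r_coset C"
  by (simp add: r_coset_def fun_eq_iff)

lemma Z_carrier: "z \<in> Z \<Longrightarrow> z \<in> carrier C"
  using subgroup.mem_carrier[OF subgroup_Z] .

lemma comm_group_Z: "comm_group (C\<lparr>carrier := Z\<rparr>)"
  by (rule group.group_comm_groupI)
    (use subgroup.subgroup_is_group[OF subgroup_Z is_group] Z_carrier m_comm in auto)

lemma subgroup_B_Z: "subgroup B (C\<lparr>carrier := Z\<rparr>)"
  by (rule subgroup_incl[OF subgroup_B subgroup_Z B_subset])

lemma normal_B: "B \<lhd> C\<lparr>carrier := Z\<rparr>"
  using comm_group.normal_iff_subgroup[OF comm_group_Z] subgroup_B_Z by blast

lemma comm_group_quot: "comm_group quot"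
  using comm_group.abelian_FactGroup[OF comm_group_Z subgroup_B_Z] .

lemma carrier_quot: "carrier quot = (\<lambda>z. B #> z) ` Z"
  by (auto simp: carrier_FactGroup rcoset_carrier_update)

lemma rcoset_hom: "(\<lambda>z. B #> z) \<in> hom (C\<lparr>carrier := Z\<rparr>) quot"
  using normal.r_coset_hom_Mod[OF normal_B] by (simp add: rcoset_carrier_update)

lemma mult_quot: "z \<in> Z \<Longrightarrow> w \<in> Z \<Longrightarrow> (B #> z) \<otimes>\<^bsub>quot\<^esub> (B #> w) = B #> (z \<otimes> w)"
  using hom_mult[OF rcoset_hom, of z w] by simp

lemma rcoset_eq_iff:
  assumes "z \<in> Z" "w \<in> Z"
  shows "B #> z = B #> w \<longleftrightarrow> (\<exists>b\<in>B. z = b \<otimes> w)"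
proof
  assume "B #> z = B #> w"
  moreover have "z \<in> B #> z"
    by (rule rcos_self[OF Z_carrier subgroup_B]) fact
  ultimately show "\<exists>b\<in>B. z = b \<otimes> w"
    by (auto simp: r_coset_def)
next
  assume "\<exists>b\<in>B. z = b \<otimes> w"
  then have "z \<in> B #> w"
    by (auto simp: r_coset_def)
  then show "B #> z = B #> w"
    using repr_independence[OF _ Z_carrier subgroup_B] assms by metis
qed

lemma rcoset_eq_B_iff: "z \<in> Z \<Longrightarrow> B #> z = B \<longleftrightarrow> z \<in> B"
  by (metis Z_carrier coset_join1 coset_join2 subgroup_B)

text \<open>Meant for a function given directly on cosets, such as \<open>Psi\<close>: its
  well-definedness is contained in the assumption that it agrees with a homomorphism
  \<open>h\<close> on representatives.\<close>

lemma hom_quotI: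
  assumes "h \<in> hom (C\<lparr>carrier := Z\<rparr>) H" and "\<And>z. z \<in> Z \<Longrightarrow> f (B #> z) = h z"
  shows "f \<in> hom quot H"
proof (rule homI)
  fix c assume "c \<in> carrier quot"
  then show "f c \<in> carrier H"
    using assms hom_in_carrier[OF assms(1)] by (auto simp: carrier_quot)
next
  fix c d assume "c \<in> carrier quot" "d \<in> carrier quot"
  then obtain z w where zw: "z \<in> Z" "w \<in> Z" "c = B #> z" "d = B #> w"
    by (auto simp: carrier_quot)
  moreover have "z \<otimes> w \<in> Z"
    using zw subgroup.m_closed[OF subgroup_Z] by blast
  ultimately show "f (c \<otimes>\<^bsub>quot\<^esub> d) = f c \<otimes>\<^bsub>H\<^esub> f d"
    using assms(2) hom_mult[OF assms(1), of z w] mult_quot by simp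
qed

text \<open>The first isomorphism theorem with the kernel tested on representatives. It is applied
  to maps out of cocycles or cochains, so that no map has to be defined on cosets.\<close>

lemma quot_iso:
  assumes "group H" "h \<in> hom (C\<lparr>carrier := Z\<rparr>) H" "h ` Z = carrier H"
    and "\<And>z. z \<in> Z \<Longrightarrow> h z = \<one>\<^bsub>H\<^esub> \<longleftrightarrow> z \<in> B"
  shows "quot \<cong> H"
proof -
  interpret h: group_hom "C\<lparr>carrier := Z\<rparr>" H h
    using assms comm_group_Z by (simp add: group_hom_def group_hom_axioms_def comm_group.axioms)
  have "kernel (C\<lparr>carrier := Z\<rparr>) H h = B"
    using assms(4) B_subset by (auto simp: kernel_def)
  then show ?thesis
    using h.FactGroup_iso assms(3) by simp
qed

end

text \<open>The map sending (k, d) to k s(d) is a homomorphism because \<open>A\<close> is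
  commutative, and it is inverted by sending a to (a s(f a)^-1, f a). The section is required on the
  image only, because \<open>Psi\<close> need not be onto the whole Schur multiplier.\<close>

lemma split_epi_iso:
  assumes "group_hom A B f" "comm_group A"
    and s: "s \<in> hom (B\<lparr>carrier := f ` carrier A\<rparr>) A"
    and fs: "\<And>d. d \<in> f ` carrier A \<Longrightarrow> f (s d) = d"
  shows "A \<cong> (A\<lparr>carrier := kernel A B f\<rparr>) \<times>\<times> (B\<lparr>carrier := f ` carrier A\<rparr>)"
proof -
  interpret A: comm_group A by fact
  interpret f: group_hom A B f by fact
  let ?D = "B\<lparr>carrier := f ` carrier A\<rparr>" and ?N = "A\<lparr>carrier := kernel A B f\<rparr>"
  have D: "group ?D"
    using f.img_is_subgroup f.H.is_group by (simp add: subgroup.subgroup_is_group)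
  have N: "group ?N"
    using f.subgroup_kernel A.is_group by (simp add: subgroup.subgroup_is_group)
  have s_closed [simp]: "s d \<in> carrier A" if "d \<in> f ` carrier A" for d
    using hom_in_carrier[OF s, of d] that by simp
  have ND: "group (?N \<times>\<times> ?D)"
    by (rule DirProd_group[OF N D])
  let ?\<theta> = "\<lambda>(k, d). k \<otimes>\<^bsub>A\<^esub> s d"
  have "?\<theta> \<in> iso (?N \<times>\<times> ?D) A"
  proof (rule isoI)
    show "?\<theta> \<in> hom (?N \<times>\<times> ?D) A"
    proof (rule homI)
      fix p q assume "p \<in> carrier (?N \<times>\<times> ?D)" "q \<in> carrier (?N \<times>\<times> ?D)"
      then show "?\<theta> (p \<otimes>\<^bsub>?N \<times>\<times> ?D\<^esub> q) = ?\<theta> p \<otimes>\<^bsub>A\<^esub> ?\<theta> q"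
        using hom_mult[OF s, of "snd p" "snd q"] s_closed
        by (auto simp: kernel_def A.m_ac split: prod.splits)
    qed (auto simp: kernel_def)
    show "bij_betw ?\<theta> (carrier (?N \<times>\<times> ?D)) (carrier A)"
    proof (rule bij_betw_byWitness[where f' = "\<lambda>a. (a \<otimes>\<^bsub>A\<^esub> inv\<^bsub>A\<^esub> s (f a), f a)"])
      show "\<forall>p\<in>carrier (?N \<times>\<times> ?D). (\<lambda>a. (a \<otimes>\<^bsub>A\<^esub> inv\<^bsub>A\<^esub> s (f a), f a)) (?\<theta> p) = p"
        using fs by (auto simp: kernel_def A.m_assoc)
      show "\<forall>a\<in>carrier A. ?\<theta> (a \<otimes>\<^bsub>A\<^esub> inv\<^bsub>A\<^esub> s (f a), f a) = a"
        by (auto simp: A.m_assoc)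
      show "?\<theta> ` carrier (?N \<times>\<times> ?D) \<subseteq> carrier A"
        by (auto simp: kernel_def)
      show "(\<lambda>a. (a \<otimes>\<^bsub>A\<^esub> inv\<^bsub>A\<^esub> s (f a), f a)) ` carrier A \<subseteq> carrier (?N \<times>\<times> ?D)"
        using fs by (auto simp: kernel_def)
    qed
  qed
  then show ?thesis
    using group.iso_sym[OF ND] unfolding is_iso_def by blast
qed

lemma subgroup_vimage:
  assumes "group_hom A B f" "subgroup S B"
  shows "subgroup {a \<in> carrier A. f a \<in> S} A"
proof -
  interpret group_hom A B f by fact
  interpret S: subgroup S B by fact
  show ?thesis
    by unfold_locales auto
qed

lemma comm_group_product_group:
  assumes "\<And>i. i \<in> I \<Longrightarrow> comm_group (M i)"
  shows "comm_group (product_group I M)"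
proof (rule group.group_comm_groupI)
  show "group (product_group I M)"
    using assms by (simp add: comm_group.axioms)
qed (use assms in \<open>auto simp: PiE_iff fun_eq_iff restrict_def comm_group_def comm_monoid.m_comm\<close>)

lemma comm_group_DirProd:
  assumes "comm_group A" "comm_group B"
  shows "comm_group (A \<times>\<times> B)"
proof (rule group.group_comm_groupI)
  show "group (A \<times>\<times> B)"
    using assms by (simp add: DirProd_group comm_group.axioms)
qed (use assms in \<open>auto simp: comm_group_def comm_monoid.m_comm\<close>)

lemma DirProd_cong_iso:
  assumes "group A" "group B" "A \<cong> A'" "B \<cong> B'"
  shows "A \<times>\<times> B \<cong> A' \<times>\<times> B'"
proof -
  obtain f g where "f \<in> iso A A'" "g \<in> iso B B'"
    using assms by (auto simp: is_iso_def)
  then have "(\<lambda>(a, b). (f a, g b)) \<in> iso (A \<times>\<times> B) (A' \<times>\<times> B')"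
    using iso_paired2[OF assms(1,2)] by blast
  then show ?thesis
    by (auto simp: is_iso_def)
qed

section \<open>Cochains, cocycles and coboundaries with values in the units of the field\<close>

lemma unit_group_simps [simp]:
  "carrier unit_group = UNIV - {0}" "x \<otimes>\<^bsub>unit_group\<^esub> y = x * y" "\<one>\<^bsub>unit_group\<^esub> = 1"
  by (simp_all add: unit_group_def)

lemma comm_group_unit_group: "comm_group (unit_group :: 'k::field monoid)"
proof (rule comm_groupI)
  fix x :: "'k::field" assume "x \<in> carrier unit_group"
  then show "\<exists>y\<in>carrier unit_group. y \<otimes>\<^bsub>unit_group\<^esub> x = \<one>\<^bsub>unit_group\<^esub>"
    by (intro bexI[of _ "inverse x"]) auto
qed (auto simp: mult_ac)

lemma group_unit_group [simp]: "group unit_group"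
  using comm_group_unit_group comm_group.axioms by blast

lemma inv_unit_group [simp]: "x \<noteq> 0 \<Longrightarrow> inv\<^bsub>unit_group\<^esub> x = inverse x"
  by (rule group.inv_equality) auto

abbreviation unit_fun :: "'s set \<Rightarrow> ('s \<Rightarrow> 'k::field) monoid" where
  "unit_fun D \<equiv> fun_group D unit_group"

lemma comm_group_unit_fun: "comm_group (unit_fun D)"
  by (rule comm_group_product_group[OF comm_group_unit_group])

lemma group_unit_fun: "group (unit_fun D)"
  by simp

lemma mem_unit_fun_iff: "f \<in> carrier (unit_fun D) \<longleftrightarrow> f \<in> extensional D \<and> (\<forall>x\<in>D. f x \<noteq> 0)"
  by (auto simp: PiE_iff)

lemma mult_unit_fun: "f \<otimes>\<^bsub>unit_fun D\<^esub> g = (\<lambda>x\<in>D. f x * g x)"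
  by simp

lemma inv_unit_fun: "f \<in> carrier (unit_fun D) \<Longrightarrow> inv\<^bsub>unit_fun D\<^esub> f = (\<lambda>x\<in>D. inverse (f x))"
  by (subst inv_product_group) (auto simp: PiE_iff fun_eq_iff)

text \<open>Follows the convention of \<open>B2_ext\<close>; the coboundaries in
  \<open>B2_grp\<close> are written with the inverse of this expression.\<close>

definition coboundary :: "'g monoid \<Rightarrow> ('g \<Rightarrow> 'k::field) \<Rightarrow> 'g \<times> 'g \<Rightarrow> 'k" where
  "coboundary G \<gamma> = (\<lambda>(g, u)\<in>carrier G \<times> carrier G. inverse (\<gamma> g) * inverse (\<gamma> u) * \<gamma> (g \<otimes>\<^bsub>G\<^esub> u))"

definition normalized_cochains :: "'g monoid \<Rightarrow> ('g \<Rightarrow> 'k::field) set" where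
  "normalized_cochains G = {\<gamma> \<in> carrier (unit_fun (carrier G)). \<gamma> \<one>\<^bsub>G\<^esub> = 1}"

definition norm_cochain :: "'g monoid \<Rightarrow> ('g \<Rightarrow> 'g) \<Rightarrow> ('g \<Rightarrow> 'k::field) \<Rightarrow> 'g \<Rightarrow> 'k" where
  "norm_cochain G T \<gamma> = (\<lambda>g\<in>carrier G. \<gamma> g * \<gamma> (T g))"

text \<open>The parameter \<open>k_type\<close> only fixes the type of the field in which cochains take values.\<close>

locale involution_action = group G for G :: "'g monoid" (structure) +
  fixes T :: "'g \<Rightarrow> 'g" and k_type :: "'k::alg_closed_field itself"
  assumes T_hom: "T \<in> hom G G" and T_T: "g \<in> carrier G \<Longrightarrow> T (T g) = g"
begin

abbreviation K :: "'k monoid" where "K \<equiv> unit_group"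
abbreviation C1 :: "('g \<Rightarrow> 'k) monoid" where "C1 \<equiv> unit_fun (carrier G)"
abbreviation C2 :: "('g \<times> 'g \<Rightarrow> 'k) monoid" where "C2 \<equiv> unit_fun (carrier G \<times> carrier G)"
abbreviation N1 :: "('g \<Rightarrow> 'k) set" where "N1 \<equiv> normalized_cochains G"
abbreviation B2 :: "('g \<times> 'g \<Rightarrow> 'k) set" where "B2 \<equiv> B2_grp G K (\<lambda>_ z. z)"
abbreviation Z2 :: "('g \<times> 'g \<Rightarrow> 'k) set" where "Z2 \<equiv> Z2_grp G K (\<lambda>_ z. z)"

lemma T_closed [simp]: "g \<in> carrier G \<Longrightarrow> T g \<in> carrier G"
  using T_hom by (auto simp: hom_def)

lemma T_mult [simp]: "g \<in> carrier G \<Longrightarrow> u \<in> carrier G \<Longrightarrow> T (g \<otimes> u) = T g \<otimes> T u"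
  using T_hom by (auto simp: hom_def)

lemma T_one [simp]: "T \<one> = \<one>"
  by (rule hom_one[OF T_hom is_group is_group])

declare T_T [simp]

lemma mem_C1: "f \<in> carrier C1 \<longleftrightarrow> f \<in> extensional (carrier G) \<and> (\<forall>g\<in>carrier G. f g \<noteq> 0)"
  by (rule mem_unit_fun_iff)

lemma mem_C2: "f \<in> carrier C2 \<longleftrightarrow>
    f \<in> extensional (carrier G \<times> carrier G) \<and> (\<forall>g\<in>carrier G. \<forall>u\<in>carrier G. f (g, u) \<noteq> 0)"
  by (subst mem_unit_fun_iff) auto

lemma mem_N1: "f \<in> N1 \<longleftrightarrow> f \<in> carrier C1 \<and> f \<one> = 1"
  by (simp add: normalized_cochains_def)

lemma C2_eqI:
  assumes "f \<in> extensional (carrier G \<times> carrier G)" "f' \<in> extensional (carrier G \<times> carrier G)"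
    and "\<And>g u. g \<in> carrier G \<Longrightarrow> u \<in> carrier G \<Longrightarrow> f (g, u) = f' (g, u)"
  shows "f = f'"
  by (rule extensionalityI[OF assms(1,2)]) (use assms(3) in auto)

lemma C2_mult_apply [simp]:
  "g \<in> carrier G \<Longrightarrow> u \<in> carrier G \<Longrightarrow> (\<tau> \<otimes>\<^bsub>C2\<^esub> \<tau>') (g, u) = \<tau> (g, u) * \<tau>' (g, u)"
  by simp

lemma C1_mult_apply [simp]: "g \<in> carrier G \<Longrightarrow> (\<sigma> \<otimes>\<^bsub>C1\<^esub> \<sigma>') g = \<sigma> g * \<sigma>' g"
  by simp

lemma subgroup_N1: "subgroup N1 C1"
proof (rule group.subgroupI[OF group_unit_fun])
  have "(\<lambda>g\<in>carrier G. 1) \<in> N1"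
    by (auto simp: mem_N1)
  then show "N1 \<noteq> {}"
    by blast
qed (auto simp: mem_N1 mem_C1 mult_unit_fun inv_unit_fun
    simp del: mult_product_group inv_product_group carrier_product_group)

lemma coboundary_apply [simp]: "g \<in> carrier G \<Longrightarrow> u \<in> carrier G \<Longrightarrow>
    coboundary G \<gamma> (g, u) = inverse (\<gamma> g) * inverse (\<gamma> u) * \<gamma> (g \<otimes> u)"
  by (simp add: coboundary_def)

lemma coboundary_extensional [simp]: "coboundary G \<gamma> \<in> extensional (carrier G \<times> carrier G)"
  by (simp add: coboundary_def)

lemma coboundary_hom: "coboundary G \<in> hom C1 C2"
proof (rule homI)
  fix \<gamma> assume "\<gamma> \<in> carrier C1"
  then show "coboundary G \<gamma> \<in> carrier C2"
    by (auto simp: mem_C1 mem_C2 simp del: carrier_product_group)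
next
  fix \<gamma> \<gamma>' assume "\<gamma> \<in> carrier C1" "\<gamma>' \<in> carrier C1"
  then show "coboundary G (\<gamma> \<otimes>\<^bsub>C1\<^esub> \<gamma>') = coboundary G \<gamma> \<otimes>\<^bsub>C2\<^esub> coboundary G \<gamma>'"
    by (intro C2_eqI) (auto simp: mem_C1)
qed

lemma norm_cochain_apply [simp]: "g \<in> carrier G \<Longrightarrow> norm_cochain G T \<gamma> g = \<gamma> g * \<gamma> (T g)"
  by (simp add: norm_cochain_def)

lemma norm_cochain_hom: "norm_cochain G T \<in> hom C1 C1"
proof (rule homI)
  fix \<gamma> assume "\<gamma> \<in> carrier C1"
  then show "norm_cochain G T \<gamma> \<in> carrier C1"
    by (auto simp: mem_C1 norm_cochain_def simp del: carrier_product_group)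
next
  fix \<gamma> \<gamma>' assume "\<gamma> \<in> carrier C1" "\<gamma>' \<in> carrier C1"
  then show "norm_cochain G T (\<gamma> \<otimes>\<^bsub>C1\<^esub> \<gamma>') = norm_cochain G T \<gamma> \<otimes>\<^bsub>C1\<^esub> norm_cochain G T \<gamma>'"
    by (auto simp: norm_cochain_def fun_eq_iff)
qed

text \<open>Being the image of \<open>N1\<close> under a homomorphism, the set is then seen to be a
  subgroup.\<close>

lemma B2_ext_eq: "B2_ext K G T = (\<lambda>\<gamma>. (norm_cochain G T \<gamma>, coboundary G \<gamma>)) ` N1"
proof -
  have eq: "((\<lambda>g\<in>carrier G. \<gamma> g \<otimes>\<^bsub>K\<^esub> \<gamma> (T g)),
      restrict (\<lambda>(g, u). inv\<^bsub>K\<^esub> \<gamma> g \<otimes>\<^bsub>K\<^esub> inv\<^bsub>K\<^esub> \<gamma> u \<otimes>\<^bsub>K\<^esub> \<gamma> (g \<otimes> u)) (carrier G \<times> carrier G))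
      = (norm_cochain G T \<gamma>, coboundary G \<gamma>)" if "\<gamma> \<in> N1" for \<gamma>
    using that by (auto simp: norm_cochain_def coboundary_def fun_eq_iff mem_C1 mem_N1
        simp del: carrier_product_group)
  have "B2_ext K G T = (\<lambda>\<gamma>. ((\<lambda>g\<in>carrier G. \<gamma> g \<otimes>\<^bsub>K\<^esub> \<gamma> (T g)),
      restrict (\<lambda>(g, u). inv\<^bsub>K\<^esub> \<gamma> g \<otimes>\<^bsub>K\<^esub> inv\<^bsub>K\<^esub> \<gamma> u \<otimes>\<^bsub>K\<^esub> \<gamma> (g \<otimes> u)) (carrier G \<times> carrier G))) ` N1"
    unfolding B2_ext_def normalized_cochains_def unit_group_simps(3) by blast
  then show ?thesis
    using image_cong[OF refl eq] by simp
qed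

text \<open>The two conventions for coboundaries are exchanged by replacing \<gamma> with its
  inverse, which preserves \<open>N1\<close>.\<close>

lemma B2_eq: "B2 = coboundary G ` N1"
proof -
  have eq: "restrict (\<lambda>(a, b). \<gamma> a \<otimes>\<^bsub>K\<^esub> \<gamma> b \<otimes>\<^bsub>K\<^esub> inv\<^bsub>K\<^esub> \<gamma> (a \<otimes> b)) (carrier G \<times> carrier G)
      = coboundary G (inv\<^bsub>C1\<^esub> \<gamma>)" if "\<gamma> \<in> carrier C1" for \<gamma>
    using that inv_unit_fun[OF that]
    by (auto simp: coboundary_def fun_eq_iff mem_C1 simp del: carrier_product_group inv_product_group)
  have inv: "inv\<^bsub>C1\<^esub> \<gamma> \<in> N1" if "\<gamma> \<in> N1" for \<gamma>
    using subgroup.m_inv_closed[OF subgroup_N1 that] .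
  show ?thesis
  proof (intro equalityI subsetI)
    fix \<tau> assume "\<tau> \<in> B2"
    then obtain \<gamma> where "\<gamma> \<in> N1" "\<tau> = coboundary G (inv\<^bsub>C1\<^esub> \<gamma>)"
      unfolding B2_grp_def using eq by (auto simp: mem_N1 simp del: carrier_product_group inv_product_group)
    then show "\<tau> \<in> coboundary G ` N1"
      using inv by blast
  next
    fix \<tau> assume "\<tau> \<in> coboundary G ` N1"
    then obtain \<gamma> where \<gamma>: "\<gamma> \<in> N1" "\<tau> = coboundary G \<gamma>"
      by blast
    then have "\<tau> = coboundary G (inv\<^bsub>C1\<^esub> (inv\<^bsub>C1\<^esub> \<gamma>))"
      by (metis group.inv_inv group_unit_fun mem_N1)
    then show "\<tau> \<in> B2"
      unfolding B2_grp_def using eq inv[OF \<gamma>(1)]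
      by (auto simp: mem_N1 simp del: carrier_product_group inv_product_group intro!: exI[of _ "inv\<^bsub>C1\<^esub> \<gamma>"])
  qed
qed

lemma mem_Z2: "\<tau> \<in> Z2 \<longleftrightarrow> \<tau> \<in> carrier C2 \<and> (\<forall>g\<in>carrier G. \<tau> (\<one>, g) = 1 \<and> \<tau> (g, \<one>) = 1) \<and>
   (\<forall>g\<in>carrier G. \<forall>u\<in>carrier G. \<forall>v\<in>carrier G.
        \<tau> (g, u) * \<tau> (g \<otimes> u, v) = \<tau> (g, u \<otimes> v) * \<tau> (u, v))"
  by (simp add: Z2_grp_def)

text \<open>The conditions on \<tau> alone are those of a 2-cocycle of \<open>G\<close> with trivial
  action, which is why \<tau> has a class in the Schur multiplier.\<close>

lemma mem_Z2_ext: "(\<sigma>, \<tau>) \<in> Z2_ext K G T \<longleftrightarrow> \<sigma> \<in> carrier C1 \<and> \<tau> \<in> Z2 \<and> \<sigma> \<one> = 1 \<and>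
    (\<forall>g\<in>carrier G. \<sigma> (T g) = \<sigma> g) \<and>
    (\<forall>g\<in>carrier G. \<forall>u\<in>carrier G. \<sigma> (g \<otimes> u) = \<tau> (g, u) * \<tau> (T g, T u) * \<sigma> g * \<sigma> u)"
  by (auto simp: mem_Z2 Z2_ext_def ext_cochains_def)

lemma subgroup_Z2: "subgroup Z2 C2"
proof (rule group.subgroupI[OF group_unit_fun])
  have "(\<lambda>p\<in>carrier G \<times> carrier G. 1) \<in> Z2"
    by (auto simp: mem_Z2)
  then show "Z2 \<noteq> {}"
    by blast
qed (auto simp: mem_Z2 mem_C2 mult_unit_fun inv_unit_fun field_simps
    simp del: mult_product_group inv_product_group carrier_product_group)

lemma group_ext: "group (ext_cochains K G)" and comm_group_ext: "comm_group (ext_cochains K G)"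
  unfolding ext_cochains_def
  by (intro DirProd_group comm_group_DirProd group_unit_fun comm_group_unit_fun)+

lemma subgroup_Z2_ext: "subgroup (Z2_ext K G T) (ext_cochains K G)"
proof (rule group.subgroupI[OF group_ext])
  have "(\<lambda>g\<in>carrier G. 1, \<lambda>p\<in>carrier G \<times> carrier G. 1) \<in> Z2_ext K G T"
    by (auto simp: mem_Z2_ext mem_Z2)
  then show "Z2_ext K G T \<noteq> {}"
    by blast
next
  fix a assume a: "a \<in> Z2_ext K G T"
  obtain \<sigma> \<tau> where a_eq: "a = (\<sigma>, \<tau>)"
    by (cases a)
  have "inv\<^bsub>ext_cochains K G\<^esub> a = (inv\<^bsub>C1\<^esub> \<sigma>, inv\<^bsub>C2\<^esub> \<tau>)"
    unfolding ext_cochains_def a_eq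
    by (rule inv_DirProd) (use a in \<open>auto simp: a_eq mem_Z2_ext mem_Z2 simp del: carrier_product_group\<close>)
  moreover have "inv\<^bsub>C2\<^esub> \<tau> \<in> Z2"
    using a subgroup.m_inv_closed[OF subgroup_Z2] by (auto simp: a_eq mem_Z2_ext)
  moreover have "\<sigma> \<in> carrier C1" "\<tau> \<in> carrier C2"
    using a by (auto simp: a_eq mem_Z2_ext mem_Z2)
  ultimately show "inv\<^bsub>ext_cochains K G\<^esub> a \<in> Z2_ext K G T"
    using a by (auto simp: a_eq mem_Z2_ext inv_unit_fun mem_C1
        simp del: inv_product_group carrier_product_group)
next
  fix a b assume ab: "a \<in> Z2_ext K G T" "b \<in> Z2_ext K G T"
  obtain \<sigma> \<tau> \<sigma>' \<tau>' where eq: "a = (\<sigma>, \<tau>)" "b = (\<sigma>', \<tau>')"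
    by (cases a; cases b)
  have "\<tau> \<otimes>\<^bsub>C2\<^esub> \<tau>' \<in> Z2"
    using ab subgroup.m_closed[OF subgroup_Z2] by (auto simp: eq mem_Z2_ext)
  moreover have "\<sigma> \<otimes>\<^bsub>C1\<^esub> \<sigma>' \<in> carrier C1"
    using ab by (auto simp: eq mem_Z2_ext mem_C1 simp del: carrier_product_group)
  ultimately show "a \<otimes>\<^bsub>ext_cochains K G\<^esub> b \<in> Z2_ext K G T"
    using ab by (auto simp: eq mem_Z2_ext ext_cochains_def simp del: carrier_product_group)
qed (auto simp: mem_Z2_ext mem_Z2 ext_cochains_def simp del: carrier_product_group)

lemma coboundary_in_Z2:
  assumes "\<gamma> \<in> N1"
  shows "coboundary G \<gamma> \<in> Z2"
  using assms hom_in_carrier[OF coboundary_hom, of \<gamma>]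
  by (auto simp: mem_Z2 mem_N1 mem_C1 m_assoc field_simps simp del: carrier_product_group)

lemma B2_subset: "B2 \<subseteq> Z2"
  using coboundary_in_Z2 by (auto simp: B2_eq)

lemma B2_ext_subset: "B2_ext K G T \<subseteq> Z2_ext K G T"
proof -
  have "(norm_cochain G T \<gamma>, coboundary G \<gamma>) \<in> Z2_ext K G T" if "\<gamma> \<in> N1" for \<gamma>
    using that coboundary_in_Z2[OF that] hom_in_carrier[OF norm_cochain_hom, of \<gamma>]
    by (auto simp: mem_Z2_ext mem_N1 mem_C1 field_simps simp del: carrier_product_group)
  then show ?thesis
    by (auto simp: B2_ext_eq)
qed

lemma subgroup_B2: "subgroup B2 C2"
  unfolding B2_eq
  by (rule group_hom.subgroup_img_is_subgroup[OF _ subgroup_N1])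
    (use coboundary_hom group_unit_fun in \<open>auto simp: group_hom_def group_hom_axioms_def simp del: carrier_product_group\<close>)

lemma subgroup_B2_ext: "subgroup (B2_ext K G T) (ext_cochains K G)"
  unfolding B2_ext_eq
proof (rule group_hom.subgroup_img_is_subgroup[OF _ subgroup_N1])
  have "(\<lambda>\<gamma>. (norm_cochain G T \<gamma>, coboundary G \<gamma>)) \<in> hom C1 (ext_cochains K G)"
    unfolding ext_cochains_def
    using norm_cochain_hom coboundary_hom by (simp add: hom_paired del: carrier_product_group)
  then show "group_hom C1 (ext_cochains K G) (\<lambda>\<gamma>. (norm_cochain G T \<gamma>, coboundary G \<gamma>))"
    using group_ext by (simp add: group_hom_def group_hom_axioms_def)
qed

text \<open>\<open>Z2c_ext\<close> and \<open>B2c_ext\<close> are preimages under this map, hence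
  subgroups.\<close>

lemma group_hom_one_pair: "group_hom C2 (ext_cochains K G) (\<lambda>\<tau>. (\<one>\<^bsub>C1\<^esub>, \<tau>))"
  using group_ext by (auto simp: group_hom_def group_hom_axioms_def ext_cochains_def hom_def)

lemma Z2c_vimage: "Z2c_ext K G T = {\<tau> \<in> carrier C2. (\<one>\<^bsub>C1\<^esub>, \<tau>) \<in> Z2_ext K G T}"
  by (auto simp: Z2c_ext_def mem_Z2_ext mem_Z2 simp del: carrier_product_group one_product_group)

lemma B2c_vimage: "B2c_ext K G T = {\<tau> \<in> carrier C2. (\<one>\<^bsub>C1\<^esub>, \<tau>) \<in> B2_ext K G T}"
  using B2_ext_subset
  by (fastforce simp: B2c_ext_def mem_Z2_ext mem_Z2 simp del: carrier_product_group one_product_group)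

lemma subgroup_Z2c: "subgroup (Z2c_ext K G T) C2"
  unfolding Z2c_vimage by (rule subgroup_vimage[OF group_hom_one_pair subgroup_Z2_ext])

lemma subgroup_B2c: "subgroup (B2c_ext K G T) C2"
  unfolding B2c_vimage by (rule subgroup_vimage[OF group_hom_one_pair subgroup_B2_ext])

lemma mem_Z2c: "\<tau> \<in> Z2c_ext K G T \<longleftrightarrow>
    \<tau> \<in> Z2 \<and> (\<forall>g\<in>carrier G. \<forall>u\<in>carrier G. \<tau> (g, u) * \<tau> (T g, T u) = 1)"
  by (auto simp: Z2c_ext_def mem_Z2_ext)

lemma mem_B2c: "\<tau> \<in> B2c_ext K G T \<longleftrightarrow>
    (\<exists>\<gamma>\<in>N1. \<tau> = coboundary G \<gamma> \<and> (\<forall>g\<in>carrier G. \<gamma> g * \<gamma> (T g) = 1))"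
  unfolding B2c_ext_def B2_ext_eq
  by (auto simp: norm_cochain_def fun_eq_iff restrict_def image_iff split: if_splits)

sublocale ext: subquotient "ext_cochains K G" "Z2_ext K G T" "B2_ext K G T"
  using comm_group_ext subgroup_Z2_ext subgroup_B2_ext B2_ext_subset
  by (simp add: subquotient_def subquotient_axioms_def)

sublocale extc: subquotient C2 "Z2c_ext K G T" "B2c_ext K G T"
  using comm_group_unit_fun subgroup_Z2c subgroup_B2c B2_ext_subset
  by (auto simp: subquotient_def subquotient_axioms_def Z2c_ext_def B2c_ext_def)

sublocale sch: subquotient C2 Z2 B2
  using comm_group_unit_fun subgroup_Z2 subgroup_B2 B2_subset
  by (simp add: subquotient_def subquotient_axioms_def)

lemma H2_ext_eq: "H2_ext K G T = ext.quot"
  by (simp add: H2_ext_def)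

lemma H2c_ext_eq: "H2c_ext K G T = extc.quot"
  by (simp add: H2c_ext_def)

lemma schur_eq: "schur K G = sch.quot"
  by (simp add: schur_def H2_grp_def Z2_grp_group_def)

end

section \<open>Normalization to \<sigma> = 1, and the map \<open>Psi\<close>\<close>

context involution_action
begin

text \<open>Off the fixed points, \<open>\<sigma>\<close> is put on one point of each orbit; on a fixed point a square root is needed.\<close>

lemma norm_cochain_surj:
  assumes "\<sigma> \<in> carrier C1" "\<sigma> \<one> = 1" "\<And>g. g \<in> carrier G \<Longrightarrow> \<sigma> (T g) = \<sigma> g"
  obtains \<gamma> where "\<gamma> \<in> N1" "norm_cochain G T \<gamma> = \<sigma>"
proof -
  \<comment> \<open>The choice is made from the unordered pair, so \<open>g\<close> and
    \<open>T g\<close> receive the same representative.\<close>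
  define rep where "rep g = (SOME u. u \<in> {g, T g})" for g
  \<comment> \<open>The prescribed root of 1 gives \<gamma> the value 1 at the identity, which is a
    fixed point of \<open>T\<close>.\<close>
  define rt where "rt z = (if z = 1 then 1 else SOME w. w ^ 2 = z)" for z :: 'k
  define \<gamma> where "\<gamma> = (\<lambda>g\<in>carrier G. if T g = g then rt (\<sigma> g) else if rep g = g then \<sigma> g else 1)"
  have rt: "rt z * rt z = z" for z
  proof -
    have "\<exists>w :: 'k. w ^ 2 = z"
      using nth_root_exists[of 2 z] by auto
    then have "(SOME w. w ^ 2 = z) ^ 2 = z"
      by (rule someI_ex)
    then show ?thesis
      by (simp add: rt_def power2_eq_square)
  qed
  have rt_nz: "rt z \<noteq> 0" if "z \<noteq> 0" for z
    using rt[of z] that by auto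
  have rep_T: "rep (T g) = rep g" if "g \<in> carrier G" for g
    using that by (simp add: rep_def insert_commute)
  have rep: "rep g = g \<or> rep g = T g" for g
    unfolding rep_def by (metis (mono_tags, lifting) insertE insertI1 singletonD someI_ex)
  have "\<gamma> \<in> N1"
    using assms(1,2) rt_nz by (auto simp: \<gamma>_def mem_N1 mem_C1 rt_def simp del: carrier_product_group)
  moreover have "norm_cochain G T \<gamma> = \<sigma>"
  proof (rule extensionalityI[where A = "carrier G"])
    fix g assume g: "g \<in> carrier G"
    show "norm_cochain G T \<gamma> g = \<sigma> g"
    proof (cases "T g = g")
      case True
      then show ?thesis
        using g rt by (simp add: \<gamma>_def)
    next
      case False
      then show ?thesis
        using g rep[of g] rep_T[of g] assms(3)[of g] by (auto simp: \<gamma>_def)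
    qed
  qed (use assms(1) in \<open>auto simp: norm_cochain_def mem_C1 simp del: carrier_product_group\<close>)
  ultimately show thesis
    using that by blast
qed

text \<open>Multiplying by the coboundary of a \<gamma> with norm \<sigma>^-1 removes \<sigma>. It
  changes \<tau> by an ordinary coboundary of \<open>G\<close>, so the class in
  \<open>H2_ext\<close> and the class in the Schur multiplier both survive.\<close>

lemma ext_cocycle_reduce:
  assumes "(\<sigma>, \<tau>) \<in> Z2_ext K G T"
  obtains \<tau>' where "\<tau>' \<in> Z2c_ext K G T"
    "B2_ext K G T #>\<^bsub>ext_cochains K G\<^esub> (\<one>\<^bsub>C1\<^esub>, \<tau>') = B2_ext K G T #>\<^bsub>ext_cochains K G\<^esub> (\<sigma>, \<tau>)"
    "B2 #>\<^bsub>C2\<^esub> \<tau>' = B2 #>\<^bsub>C2\<^esub> \<tau>"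
proof -
  let ?E = "ext_cochains K G"
  obtain \<gamma> where \<gamma>: "\<gamma> \<in> N1" "norm_cochain G T \<gamma> = inv\<^bsub>C1\<^esub> \<sigma>"
    using norm_cochain_surj[of "inv\<^bsub>C1\<^esub> \<sigma>"] assms
    by (auto simp: mem_Z2_ext inv_unit_fun mem_C1 simp del: carrier_product_group inv_product_group)
  let ?b = "(inv\<^bsub>C1\<^esub> \<sigma>, coboundary G \<gamma>)"
  have b: "?b \<in> B2_ext K G T"
    using \<gamma> by (auto simp: B2_ext_eq intro!: image_eqI[of _ _ \<gamma>])
  have cob: "coboundary G \<gamma> \<in> B2"
    using \<gamma> by (auto simp: B2_eq)
  define \<tau>' where "\<tau>' = coboundary G \<gamma> \<otimes>\<^bsub>C2\<^esub> \<tau>"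
  have \<sigma>: "\<sigma> \<in> carrier C1" and \<tau>: "\<tau> \<in> Z2"
    using assms by (auto simp: mem_Z2_ext)
  have eq: "(\<one>\<^bsub>C1\<^esub>, \<tau>') = ?b \<otimes>\<^bsub>?E\<^esub> (\<sigma>, \<tau>)"
    using group.l_inv[OF group_unit_fun \<sigma>] by (simp add: \<tau>'_def ext_cochains_def)
  have in_Z: "(\<one>\<^bsub>C1\<^esub>, \<tau>') \<in> Z2_ext K G T"
    unfolding eq using b B2_ext_subset assms subgroup.m_closed[OF subgroup_Z2_ext] by blast
  show thesis
  proof (rule that)
    show "\<tau>' \<in> Z2c_ext K G T"
      using in_Z by (simp add: Z2c_ext_def)
    show "B2_ext K G T #>\<^bsub>?E\<^esub> (\<one>\<^bsub>C1\<^esub>, \<tau>') = B2_ext K G T #>\<^bsub>?E\<^esub> (\<sigma>, \<tau>)"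
      using ext.rcoset_eq_iff[OF in_Z assms] eq b by blast
    have "\<tau>' \<in> Z2"
      using in_Z by (auto simp: mem_Z2_ext)
    then show "B2 #>\<^bsub>C2\<^esub> \<tau>' = B2 #>\<^bsub>C2\<^esub> \<tau>"
      using sch.rcoset_eq_iff[OF _ \<tau>] cob \<tau>'_def by blast
  qed
qed

text \<open>Sending \<tau> to the class of (1, \<tau>) is onto by the reduction to \<sigma> = 1, and
  its kernel is \<open>B2c_ext\<close> by definition.\<close>

lemma H2_ext_iso_H2c_ext: "H2_ext K G T \<cong> H2c_ext K G T"
proof -
  let ?E = "ext_cochains K G"
  let ?h = "\<lambda>\<tau>. B2_ext K G T #>\<^bsub>?E\<^esub> (\<one>\<^bsub>C1\<^esub>, \<tau>)"
  have Z2c: "(\<one>\<^bsub>C1\<^esub>, \<tau>) \<in> Z2_ext K G T" if "\<tau> \<in> Z2c_ext K G T" for \<tau>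
    using that by (simp add: Z2c_ext_def)
  have "extc.quot \<cong> ext.quot"
  proof (rule extc.quot_iso)
    show "group ext.quot"
      using ext.comm_group_quot comm_group.axioms by blast
    show "?h \<in> hom (C2\<lparr>carrier := Z2c_ext K G T\<rparr>) ext.quot"
    proof (rule homI)
      fix \<tau> \<tau>' assume "\<tau> \<in> carrier (C2\<lparr>carrier := Z2c_ext K G T\<rparr>)" "\<tau>' \<in> carrier (C2\<lparr>carrier := Z2c_ext K G T\<rparr>)"
      then have "(?h \<tau>) \<otimes>\<^bsub>ext.quot\<^esub> (?h \<tau>') = B2_ext K G T #>\<^bsub>?E\<^esub> ((\<one>\<^bsub>C1\<^esub>, \<tau>) \<otimes>\<^bsub>?E\<^esub> (\<one>\<^bsub>C1\<^esub>, \<tau>'))"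
        by (intro ext.mult_quot) (auto intro: Z2c simp del: one_product_group)
      also have "(\<one>\<^bsub>C1\<^esub>, \<tau>) \<otimes>\<^bsub>?E\<^esub> (\<one>\<^bsub>C1\<^esub>, \<tau>') = (\<one>\<^bsub>C1\<^esub>, \<tau> \<otimes>\<^bsub>C2\<^esub> \<tau>')"
        by (auto simp: ext_cochains_def)
      finally show "?h (\<tau> \<otimes>\<^bsub>C2\<lparr>carrier := Z2c_ext K G T\<rparr>\<^esub> \<tau>') = ?h \<tau> \<otimes>\<^bsub>ext.quot\<^esub> ?h \<tau>'"
        by (simp del: mult_FactGroup one_product_group mult_product_group)
    qed (use Z2c in \<open>auto simp: ext.carrier_quot simp del: one_product_group\<close>)
    show "?h ` Z2c_ext K G T = carrier ext.quot"
    proof (intro equalityI subsetI)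
      fix c assume "c \<in> carrier ext.quot"
      then obtain \<sigma> \<tau> where \<tau>: "(\<sigma>, \<tau>) \<in> Z2_ext K G T" "c = B2_ext K G T #>\<^bsub>?E\<^esub> (\<sigma>, \<tau>)"
        by (auto simp: ext.carrier_quot)
      obtain \<tau>' where "\<tau>' \<in> Z2c_ext K G T" "?h \<tau>' = c"
        using ext_cocycle_reduce[OF \<tau>(1)] \<tau>(2) by metis
      then show "c \<in> ?h ` Z2c_ext K G T"
        by blast
    qed (use Z2c in \<open>auto simp: ext.carrier_quot simp del: one_product_group\<close>)
    show "?h \<tau> = \<one>\<^bsub>ext.quot\<^esub> \<longleftrightarrow> \<tau> \<in> B2c_ext K G T" if "\<tau> \<in> Z2c_ext K G T" for \<tau>
      using ext.rcoset_eq_B_iff[OF Z2c[OF that]] by (simp add: B2c_ext_def)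
  qed
  then show ?thesis
    using group.iso_sym[OF comm_group.axioms(2)[OF extc.comm_group_quot]]
    by (simp add: H2_ext_eq H2c_ext_eq)
qed

lemma Z2c_subset: "Z2c_ext K G T \<subseteq> Z2"
  by (auto simp: mem_Z2c)

lemma B2c_subset: "B2c_ext K G T \<subseteq> B2"
  by (auto simp: mem_B2c B2_eq)

text \<open>The union in the definition of \<open>Psi\<close> is nonempty, and its members coincide
  because \<open>B2c_ext\<close> is contained in \<open>B2\<close>.\<close>

lemma Psi_rcoset:
  assumes "\<tau> \<in> Z2c_ext K G T"
  shows "Psi K G (B2c_ext K G T #>\<^bsub>C2\<^esub> \<tau>) = B2 #>\<^bsub>C2\<^esub> \<tau>"
proof -
  have "B2 #>\<^bsub>C2\<^esub> \<tau>' = B2 #>\<^bsub>C2\<^esub> \<tau>" if "\<tau>' \<in> B2c_ext K G T #>\<^bsub>C2\<^esub> \<tau>" for \<tau>'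
  proof -
    obtain b where b: "b \<in> B2c_ext K G T" "\<tau>' = b \<otimes>\<^bsub>C2\<^esub> \<tau>"
      using \<open>\<tau>' \<in> _\<close> by (auto simp: r_coset_def)
    moreover have "\<tau>' \<in> Z2c_ext K G T"
      unfolding b(2) using b(1) assms extc.B_subset subgroup.m_closed[OF subgroup_Z2c] by blast
    ultimately show ?thesis
      using assms Z2c_subset B2c_subset by (subst sch.rcoset_eq_iff) auto
  qed
  moreover have "\<tau> \<in> B2c_ext K G T #>\<^bsub>C2\<^esub> \<tau>"
    using extc.rcos_self[OF extc.Z_carrier subgroup_B2c] assms by blast
  ultimately show ?thesis
    unfolding Psi_def Z2_grp_group_def sch.rcoset_carrier_update by blast
qed

lemma group_hom_Psi: "group_hom (H2c_ext K G T) (schur K G) (Psi K G)"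
proof -
  have "Psi K G \<in> hom extc.quot sch.quot"
  proof (rule extc.hom_quotI)
    have "(\<lambda>\<tau>. B2 #>\<^bsub>C2\<^esub> \<tau>) \<in> hom (C2\<lparr>carrier := Z2\<rparr>) sch.quot"
      by (rule sch.rcoset_hom)
    then show "(\<lambda>\<tau>. B2 #>\<^bsub>C2\<^esub> \<tau>) \<in> hom (C2\<lparr>carrier := Z2c_ext K G T\<rparr>) sch.quot"
      using Z2c_subset unfolding hom_def by (simp add: subset_iff Pi_iff del: mult_FactGroup mult_product_group)
  qed (rule Psi_rcoset)
  then show ?thesis
    using extc.comm_group_quot sch.comm_group_quot
    by (simp add: group_hom_def group_hom_axioms_def schur_eq H2c_ext_eq comm_group.axioms)
qed

lemma Psi_image: "Psi K G ` carrier (H2c_ext K G T) = (\<lambda>\<tau>. B2 #>\<^bsub>C2\<^esub> \<tau>) ` Z2c_ext K G T"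
  unfolding H2c_ext_eq extc.carrier_quot image_image by (intro image_cong refl Psi_rcoset)

lemma pullback2_apply [simp]:
  "g \<in> carrier G \<Longrightarrow> u \<in> carrier G \<Longrightarrow> pullback2 G T \<tau> (g, u) = \<tau> (T g, T u)"
  by (simp add: pullback2_def)

lemma pullback2_extensional [simp]: "pullback2 G T \<tau> \<in> extensional (carrier G \<times> carrier G)"
  by (simp add: pullback2_def)

lemma pullback2_coboundary:
  "pullback2 G T (coboundary G \<gamma>) = coboundary G (\<lambda>g\<in>carrier G. \<gamma> (T g))"
  by (rule C2_eqI) auto

text \<open>One inclusion is enough, since pulling back twice is the identity on
  \<open>B2\<close>.\<close>

lemma pullback2_B2: "pullback2 G T ` B2 = B2"
proof -
  have sub: "pullback2 G T b \<in> B2" if b: "b \<in> B2" for b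
  proof -
    obtain \<gamma> where \<gamma>: "\<gamma> \<in> N1" "b = coboundary G \<gamma>"
      using b by (auto simp: B2_eq)
    then have "(\<lambda>g\<in>carrier G. \<gamma> (T g)) \<in> N1"
      by (auto simp: mem_N1 mem_C1 simp del: carrier_product_group)
    then show ?thesis
      using \<gamma> by (auto simp: B2_eq pullback2_coboundary)
  qed
  moreover have "pullback2 G T (pullback2 G T b) = b" if "b \<in> B2" for b
    by (rule C2_eqI) (use that in \<open>auto simp: B2_eq\<close>)
  ultimately show ?thesis
    by (metis (no_types, lifting) image_eqI image_subsetI subsetI subset_antisym)
qed

lemma pullback2_rcoset:
  assumes "\<alpha> \<in> Z2"
  shows "pullback2 G T ` (B2 #>\<^bsub>C2\<^esub> \<alpha>) = B2 #>\<^bsub>C2\<^esub> pullback2 G T \<alpha>"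
proof -
  have image: "B2 #>\<^bsub>C2\<^esub> \<alpha> = (\<lambda>b. b \<otimes>\<^bsub>C2\<^esub> \<alpha>) ` B2" for \<alpha>
    by (auto simp: r_coset_def)
  have "pullback2 G T (b \<otimes>\<^bsub>C2\<^esub> \<alpha>) = pullback2 G T b \<otimes>\<^bsub>C2\<^esub> pullback2 G T \<alpha>" for b
    by (rule C2_eqI) auto
  then have "pullback2 G T ` (B2 #>\<^bsub>C2\<^esub> \<alpha>) = (\<lambda>b. b \<otimes>\<^bsub>C2\<^esub> pullback2 G T \<alpha>) ` pullback2 G T ` B2"
    unfolding image image_image by (intro image_cong refl)
  then show ?thesis
    unfolding pullback2_B2 by (simp only: image)
qed

lemma pullback2_Z2: "\<alpha> \<in> Z2 \<Longrightarrow> pullback2 G T \<alpha> \<in> Z2"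
  by (simp add: mem_Z2 mem_C2 del: carrier_product_group T_mult flip: T_mult) simp

lemma schur_minus_iff:
  assumes "\<alpha> \<in> Z2"
  shows "pullback2 G T ` (B2 #>\<^bsub>C2\<^esub> \<alpha>) = inv\<^bsub>schur K G\<^esub> (B2 #>\<^bsub>C2\<^esub> \<alpha>) \<longleftrightarrow>
    pullback2 G T \<alpha> \<otimes>\<^bsub>C2\<^esub> \<alpha> \<in> B2"
proof -
  interpret Q: comm_group sch.quot
    by (rule sch.comm_group_quot)
  have cl: "B2 #>\<^bsub>C2\<^esub> \<alpha> \<in> carrier sch.quot" "B2 #>\<^bsub>C2\<^esub> pullback2 G T \<alpha> \<in> carrier sch.quot"
    using assms pullback2_Z2 by (auto simp: sch.carrier_quot)
  have "pullback2 G T ` (B2 #>\<^bsub>C2\<^esub> \<alpha>) = inv\<^bsub>schur K G\<^esub> (B2 #>\<^bsub>C2\<^esub> \<alpha>) \<longleftrightarrow>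
      (B2 #>\<^bsub>C2\<^esub> pullback2 G T \<alpha>) \<otimes>\<^bsub>sch.quot\<^esub> (B2 #>\<^bsub>C2\<^esub> \<alpha>) = \<one>\<^bsub>sch.quot\<^esub>"
    unfolding pullback2_rcoset[OF assms] schur_eq using cl
    by (metis Q.inv_equality Q.l_inv)
  also have "\<dots> \<longleftrightarrow> B2 #>\<^bsub>C2\<^esub> (pullback2 G T \<alpha> \<otimes>\<^bsub>C2\<^esub> \<alpha>) = B2"
    by (simp only: sch.mult_quot[OF pullback2_Z2[OF assms] assms] one_FactGroup)
  also have "\<dots> \<longleftrightarrow> pullback2 G T \<alpha> \<otimes>\<^bsub>C2\<^esub> \<alpha> \<in> B2"
    by (intro sch.rcoset_eq_B_iff subgroup.m_closed[OF subgroup_Z2] pullback2_Z2 assms)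
  finally show ?thesis .
qed

text \<open>For \<sigma> = 1 the relation between \<sigma> and \<tau> says that \<tau> times its
  pullback is identically 1, so the class of the pullback is the inverse class.\<close>

lemma Psi_image_subset_minus:
  "Psi K G ` carrier (H2c_ext K G T) \<subseteq> carrier (schur_minus_group K G T)"
proof -
  have "B2 #>\<^bsub>C2\<^esub> \<tau> \<in> carrier (schur_minus_group K G T)" if "\<tau> \<in> Z2c_ext K G T" for \<tau>
  proof -
    have \<tau>: "\<tau> \<in> Z2"
      using that Z2c_subset by blast
    have "pullback2 G T \<tau> \<otimes>\<^bsub>C2\<^esub> \<tau> = \<one>\<^bsub>C2\<^esub>"
      by (rule C2_eqI) (use that in \<open>auto simp: mem_Z2c mult.commute\<close>)
    then have "pullback2 G T \<tau> \<otimes>\<^bsub>C2\<^esub> \<tau> \<in> B2"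
      using subgroup.one_closed[OF subgroup_B2] by simp
    then show ?thesis
      using \<tau> schur_minus_iff[OF \<tau>] by (auto simp: schur_minus_group_def schur_eq sch.carrier_quot)
  qed
  then show ?thesis
    unfolding Psi_image by blast
qed

end

section \<open>Second cohomology of a group of order two\<close>

lemma eval_hom: "d \<in> D \<Longrightarrow> (\<lambda>f. f d) \<in> hom (fun_group D M) M"
  by (auto simp: hom_def PiE_iff)

locale order2_group = L: group L for L :: "'l monoid" and t :: 'l +
  assumes carrier_L: "carrier L = {\<one>\<^bsub>L\<^esub>, t}" and t_neq_one: "t \<noteq> \<one>\<^bsub>L\<^esub>"
begin

lemma t_closed [simp]: "t \<in> carrier L"
  by (simp add: carrier_L)

lemma t_t [simp]: "t \<otimes>\<^bsub>L\<^esub> t = \<one>\<^bsub>L\<^esub>"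
proof -
  have "t \<otimes>\<^bsub>L\<^esub> t \<in> {\<one>\<^bsub>L\<^esub>, t}"
    using L.m_closed[OF t_closed t_closed] carrier_L by simp
  then show ?thesis
    using t_neq_one L.l_cancel_one'[OF t_closed t_closed] by auto
qed

end

locale order2_module = order2_group L t + M: comm_group M
  for L :: "'l monoid" and t :: 'l and M :: "'m monoid" +
  fixes \<psi> :: "'l \<Rightarrow> 'm \<Rightarrow> 'm"
  assumes \<psi>_one [simp]: "m \<in> carrier M \<Longrightarrow> \<psi> \<one>\<^bsub>L\<^esub> m = m"
    and \<psi>_hom: "\<psi> t \<in> hom M M"
    and \<psi>_\<psi> [simp]: "m \<in> carrier M \<Longrightarrow> \<psi> t (\<psi> t m) = m"
begin

abbreviation LM :: "('l \<times> 'l \<Rightarrow> 'm) monoid" where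
  "LM \<equiv> fun_group (carrier L \<times> carrier L) M"

definition fixed_points :: "'m set" where
  "fixed_points = {m \<in> carrier M. \<psi> t m = m}"

definition norms :: "'m set" where
  "norms = (\<lambda>m. m \<otimes>\<^bsub>M\<^esub> \<psi> t m) ` carrier M"

sublocale \<psi>: group_hom M M "\<psi> t"
  using \<psi>_hom by unfold_locales

lemma subgroup_fixed_points: "subgroup fixed_points M"
  by unfold_locales (auto simp: fixed_points_def)

lemma norm_hom: "group_hom M M (\<lambda>m. m \<otimes>\<^bsub>M\<^esub> \<psi> t m)"
  by unfold_locales (auto simp: hom_def M.m_ac)

lemma subgroup_norms: "subgroup norms M"
  unfolding norms_def by (rule group_hom.img_is_subgroup[OF norm_hom])

lemma norms_subset: "norms \<subseteq> fixed_points"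
  by (auto simp: norms_def fixed_points_def M.m_comm)

text \<open>Normalization leaves f(t, t) as the only free value. The cocycle identity is automatic
  except at (t, t, t), where it says that this value is fixed by t.\<close>

lemma mem_Z2_grp:
  "f \<in> Z2_grp L M \<psi> \<longleftrightarrow> f \<in> carrier LM \<and> f (\<one>\<^bsub>L\<^esub>, \<one>\<^bsub>L\<^esub>) = \<one>\<^bsub>M\<^esub> \<and> f (\<one>\<^bsub>L\<^esub>, t) = \<one>\<^bsub>M\<^esub> \<and>
    f (t, \<one>\<^bsub>L\<^esub>) = \<one>\<^bsub>M\<^esub> \<and> f (t, t) \<in> fixed_points"
proof -
  have cl: "f \<in> carrier LM \<Longrightarrow> f (t, t) \<in> carrier M"
    by (auto simp: PiE_iff)
  show ?thesis
    unfolding Z2_grp_def mem_Collect_eq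
    by (rule conj_cong[OF refl], drule cl)
      (auto simp: carrier_L fixed_points_def t_neq_one)
qed

text \<open>A normalized 1-cochain is determined by m = \<gamma>(t), and since t t = 1 its
  coboundary takes the value m (t m) at (t, t).\<close>

lemma B2_grp_eq: "B2_grp L M \<psi> = {f \<in> Z2_grp L M \<psi>. f (t, t) \<in> norms}" (is "_ = ?R")
proof -
  let ?d = "\<lambda>\<gamma>. \<lambda>(a, b)\<in>carrier L \<times> carrier L. \<gamma> a \<otimes>\<^bsub>M\<^esub> \<psi> a (\<gamma> b) \<otimes>\<^bsub>M\<^esub> inv\<^bsub>M\<^esub> \<gamma> (a \<otimes>\<^bsub>L\<^esub> b)"
  show ?thesis
  proof (intro equalityI subsetI)
    fix f assume "f \<in> B2_grp L M \<psi>"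
    then obtain \<gamma> where \<gamma>: "\<gamma> \<in> carrier (fun_group (carrier L) M)" "\<gamma> \<one>\<^bsub>L\<^esub> = \<one>\<^bsub>M\<^esub>" and f: "f = ?d \<gamma>"
      by (auto simp: B2_grp_def)
    have cl: "\<gamma> t \<in> carrier M"
      using \<gamma>(1) by (auto simp: PiE_iff)
    have "?d \<gamma> \<in> carrier LM"
      using cl \<gamma>(2) by (auto simp: carrier_L)
    then show "f \<in> ?R"
      using cl \<gamma>(2) norms_subset by (auto simp: f mem_Z2_grp norms_def simp del: carrier_product_group)
  next
    fix f assume f: "f \<in> ?R"
    then obtain m where m: "m \<in> carrier M" "f (t, t) = m \<otimes>\<^bsub>M\<^esub> \<psi> t m"
      by (auto simp: norms_def)
    define \<gamma> where "\<gamma> = (\<lambda>a\<in>carrier L. if a = t then m else \<one>\<^bsub>M\<^esub>)"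
    have \<gamma>: "\<gamma> \<in> carrier (fun_group (carrier L) M)" "\<gamma> \<one>\<^bsub>L\<^esub> = \<one>\<^bsub>M\<^esub>" "\<gamma> t = m"
      using m t_neq_one by (auto simp: \<gamma>_def)
    have "f = ?d \<gamma>"
      by (rule extensionalityI[where A = "carrier L \<times> carrier L"])
        (use f m \<gamma> in \<open>auto simp: mem_Z2_grp carrier_L PiE_iff\<close>)
    then show "f \<in> B2_grp L M \<psi>"
      using \<gamma> by (auto simp: B2_grp_def simp del: carrier_product_group)
  qed
qed

lemma group_LM: "group LM" and comm_group_LM: "comm_group LM"
  by (auto intro: comm_group_product_group M.comm_group_axioms)

lemma subgroup_Z2_grp: "subgroup (Z2_grp L M \<psi>) LM"
proof (rule group.subgroupI[OF group_LM])
  have "\<one>\<^bsub>LM\<^esub> \<in> Z2_grp L M \<psi>"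
    using subgroup.one_closed[OF subgroup_fixed_points] group.is_monoid[OF group_LM]
    by (auto simp: mem_Z2_grp)
  then show "Z2_grp L M \<psi> \<noteq> {}"
    by blast
next
  fix f assume f: "f \<in> Z2_grp L M \<psi>"
  then have "inv\<^bsub>LM\<^esub> f \<in> carrier LM"
    using group.inv_closed[OF group_LM] by (auto simp: mem_Z2_grp simp del: carrier_product_group inv_product_group)
  moreover have "inv\<^bsub>LM\<^esub> f = (\<lambda>p\<in>carrier L \<times> carrier L. inv\<^bsub>M\<^esub> f p)"
    using f by (subst inv_product_group) (auto simp: mem_Z2_grp)
  ultimately show "inv\<^bsub>LM\<^esub> f \<in> Z2_grp L M \<psi>"
    using f subgroup.m_inv_closed[OF subgroup_fixed_points]
    by (auto simp: mem_Z2_grp simp del: carrier_product_group inv_product_group)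
next
  fix f f' assume ff: "f \<in> Z2_grp L M \<psi>" "f' \<in> Z2_grp L M \<psi>"
  then have "f \<otimes>\<^bsub>LM\<^esub> f' \<in> carrier LM"
    using monoid.m_closed[OF group.is_monoid[OF group_LM]] by (auto simp: mem_Z2_grp simp del: carrier_product_group mult_product_group)
  then show "f \<otimes>\<^bsub>LM\<^esub> f' \<in> Z2_grp L M \<psi>"
    using ff subgroup.m_closed[OF subgroup_fixed_points]
    by (auto simp: mem_Z2_grp simp del: carrier_product_group)
qed (auto simp: mem_Z2_grp simp del: carrier_product_group)

lemma eval_group_hom: "group_hom LM M (\<lambda>f. f (t, t))"
  using eval_hom[of "(t, t)" "carrier L \<times> carrier L" M] group_LM M.is_group
  by (simp add: group_hom_def group_hom_axioms_def)

lemma subgroup_B2_grp: "subgroup (B2_grp L M \<psi>) LM"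
proof -
  have "B2_grp L M \<psi> = Z2_grp L M \<psi> \<inter> {f \<in> carrier LM. f (t, t) \<in> norms}"
    by (auto simp: B2_grp_eq mem_Z2_grp simp del: carrier_product_group)
  then show ?thesis
    using subgroup_vimage[OF eval_group_hom subgroup_norms] subgroup_Z2_grp group_LM
    by (simp only: group.subgroups_Inter_pair)
qed

sublocale tate: subquotient M fixed_points norms
  using M.comm_group_axioms subgroup_fixed_points subgroup_norms norms_subset
  by (simp add: subquotient_def subquotient_axioms_def)

sublocale coh: subquotient LM "Z2_grp L M \<psi>" "B2_grp L M \<psi>"
  using comm_group_LM subgroup_Z2_grp subgroup_B2_grp
  by (auto simp: subquotient_def subquotient_axioms_def B2_grp_eq)

text \<open>Periodicity of the cohomology of a cyclic group, which identifies the second cohomology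
  with the Tate group of fixed points modulo norms. Evaluation at (t, t) is onto because a fixed
  point extends to the cocycle with value 1 at the other pairs.\<close>

lemma H2_grp_iso_tate: "H2_grp L M \<psi> \<cong> tate.quot"
  unfolding H2_grp_def Z2_grp_group_def
proof (rule coh.quot_iso)
  show "group tate.quot"
    using tate.comm_group_quot comm_group.axioms by blast
  let ?h = "\<lambda>f. norms #>\<^bsub>M\<^esub> f (t, t)"
  have "(\<lambda>f. f (t, t)) \<in> hom (LM\<lparr>carrier := Z2_grp L M \<psi>\<rparr>) (M\<lparr>carrier := fixed_points\<rparr>)"
    by (auto simp: hom_def mem_Z2_grp)
  then show "?h \<in> hom (LM\<lparr>carrier := Z2_grp L M \<psi>\<rparr>) tate.quot"
    using hom_compose[OF _ tate.rcoset_hom] by (simp add: o_def)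
  show "?h ` Z2_grp L M \<psi> = carrier tate.quot"
  proof (intro equalityI subsetI)
    fix c assume "c \<in> carrier tate.quot"
    then obtain m where m: "m \<in> fixed_points" "c = norms #>\<^bsub>M\<^esub> m"
      by (auto simp: tate.carrier_quot)
    let ?f = "\<lambda>p\<in>carrier L \<times> carrier L. if p = (t, t) then m else \<one>\<^bsub>M\<^esub>"
    have "?f \<in> Z2_grp L M \<psi>"
      using m t_neq_one by (auto simp: mem_Z2_grp fixed_points_def)
    moreover have "c = ?h ?f"
      using m by simp
    ultimately show "c \<in> ?h ` Z2_grp L M \<psi>"
      by blast
  qed (auto simp: tate.carrier_quot mem_Z2_grp simp del: carrier_product_group)
  show "?h f = \<one>\<^bsub>tate.quot\<^esub> \<longleftrightarrow> f \<in> B2_grp L M \<psi>" if "f \<in> Z2_grp L M \<psi>" for f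
    using that tate.rcoset_eq_B_iff[of "f (t, t)"] by (simp add: B2_grp_eq mem_Z2_grp)
qed

end

section \<open>The kernel of \<open>Psi\<close> and invariant characters modulo norms\<close>

locale order2_action = order2_group L t + G: group G
  for L :: "'l monoid" and t :: 'l and G :: "'g monoid" (structure) +
  fixes \<phi> :: "'l \<Rightarrow> 'g \<Rightarrow> 'g" and k_type :: "'k::alg_closed_field itself"
  assumes \<phi>_hom: "\<phi> \<in> hom L (AutoGroup G)"
begin

lemma \<phi>_one: "g \<in> carrier G \<Longrightarrow> \<phi> \<one>\<^bsub>L\<^esub> g = g"
  using hom_one[OF \<phi>_hom L.is_group G.AutoGroup] by (simp add: AutoGroup_def BijGroup_def)

lemma \<phi>_t_hom: "\<phi> t \<in> hom G G"
  using hom_in_carrier[OF \<phi>_hom t_closed] by (auto simp: AutoGroup_def auto_def)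

lemma \<phi>_t_t: "g \<in> carrier G \<Longrightarrow> \<phi> t (\<phi> t g) = g"
proof -
  assume g: "g \<in> carrier G"
  have "\<phi> t \<in> Bij (carrier G)"
    using hom_in_carrier[OF \<phi>_hom t_closed] by (auto simp: AutoGroup_def auto_def)
  then have "\<phi> (t \<otimes>\<^bsub>L\<^esub> t) = compose (carrier G) (\<phi> t) (\<phi> t)"
    using hom_mult[OF \<phi>_hom t_closed t_closed] by (simp add: AutoGroup_def BijGroup_def)
  then show ?thesis
    using \<phi>_one[OF g] g by (simp add: compose_def)
qed

sublocale involution_action G "\<phi> t" k_type
  using \<phi>_t_hom \<phi>_t_t by unfold_locales

lemma mem_char_group: "\<beta> \<in> carrier (char_group K G) \<longleftrightarrow>
    \<beta> \<in> carrier C1 \<and> (\<forall>g\<in>carrier G. \<forall>u\<in>carrier G. \<beta> (g \<otimes> u) = \<beta> g * \<beta> u)"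
  by (auto simp: char_group_def hom_def PiE_iff)

lemma char_group_simps [simp]: "\<beta> \<otimes>\<^bsub>char_group K G\<^esub> \<beta>' = \<beta> \<otimes>\<^bsub>C1\<^esub> \<beta>'" "\<one>\<^bsub>char_group K G\<^esub> = \<one>\<^bsub>C1\<^esub>"
  by (simp_all add: char_group_def)

lemma subgroup_chars: "subgroup (carrier (char_group K G)) C1"
proof (rule group.subgroupI[OF group_unit_fun])
  have "(\<lambda>g\<in>carrier G. 1) \<in> carrier (char_group K G)"
    by (auto simp: mem_char_group)
  then show "carrier (char_group K G) \<noteq> {}"
    by blast
qed (auto simp: mem_char_group mem_C1 inv_unit_fun simp del: carrier_product_group inv_product_group)

lemma char_group_eq: "char_group K G = C1\<lparr>carrier := carrier (char_group K G)\<rparr>"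
  by (simp add: char_group_def)

lemma comm_group_char_group: "comm_group (char_group K G)"
proof -
  \<comment> \<open>The trivial denominator is a device: this instance makes
    \<open>comm_group_Z\<close> available for the subgroup of characters.\<close>
  have "subquotient C1 (carrier (char_group K G)) {\<one>\<^bsub>C1\<^esub>}"
    using comm_group_unit_fun subgroup_chars subgroup.one_closed[OF subgroup_chars]
    by (simp add: subquotient_def subquotient_axioms_def group.triv_subgroup del: one_product_group)
  from subquotient.comm_group_Z[OF this] show ?thesis
    using char_group_eq by simp
qed

lemma char_one [simp]: "\<beta> \<in> carrier (char_group K G) \<Longrightarrow> \<beta> \<one> = 1"
proof -
  assume \<beta>: "\<beta> \<in> carrier (char_group K G)"
  then have "\<beta> (\<one> \<otimes> \<one>) = \<beta> \<one> * \<beta> \<one>" "\<beta> \<one> \<noteq> 0"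
    unfolding mem_char_group mem_C1 by blast+
  then show ?thesis
    by simp
qed

sublocale char: order2_module L t "char_group K G" "char_act G \<phi>"
proof -
  interpret X: comm_group "char_group K G"
    by (rule comm_group_char_group)
  have act: "char_act G \<phi> t \<beta> \<in> carrier (char_group K G)" if "\<beta> \<in> carrier (char_group K G)" for \<beta>
    using that by (auto simp: mem_char_group mem_C1 char_act_def simp del: carrier_product_group)
  show "order2_module L t (char_group K G) (char_act G \<phi>)"
  proof unfold_locales
    fix \<beta> assume \<beta>: "\<beta> \<in> carrier (char_group K G)"
    then have ext: "\<beta> \<in> extensional (carrier G)"
      by (simp add: mem_char_group mem_C1 del: carrier_product_group)
    show "char_act G \<phi> \<one>\<^bsub>L\<^esub> \<beta> = \<beta>"
      by (rule extensionalityI[OF _ ext]) (simp_all add: char_act_def \<phi>_one)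
    show "char_act G \<phi> t (char_act G \<phi> t \<beta>) = \<beta>"
      by (rule extensionalityI[OF _ ext]) (simp_all add: char_act_def)
  next
    show "char_act G \<phi> t \<in> hom (char_group K G) (char_group K G)"
      using act by (auto simp: hom_def char_act_def fun_eq_iff)
  qed
qed

lemma fixed_points_eq: "char.fixed_points = carrier (char_fixed_group K G L \<phi>)"
  by (auto simp: char.fixed_points_def char_fixed_group_def carrier_L)

lemma norms_eq: "char.norms = char_norms K G \<phi> t"
  by (auto simp: char.norms_def char_norms_def)

lemma tate_eq: "char_fixed_group K G L \<phi> Mod char_norms K G \<phi> t = char.tate.quot"
  unfolding norms_eq[symmetric] fixed_points_eq by (simp add: char_fixed_group_def)

lemma norm_char: "\<beta> \<in> carrier (char_group K G) \<Longrightarrow>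
    \<beta> \<otimes>\<^bsub>char_group K G\<^esub> char_act G \<phi> t \<beta> = norm_cochain G (\<phi> t) \<beta>"
  by (auto simp: norm_cochain_def char_act_def fun_eq_iff)

text \<open>The quotient of \<open>char_lifts\<close> by \<open>norm_lifts\<close> links two groups:
  the coboundary maps it isomorphically to the kernel of \<open>Psi\<close>, and the norm maps it
  isomorphically to invariant characters modulo norms.\<close>

definition char_lifts :: "('g \<Rightarrow> 'k) set" where
  "char_lifts = N1 \<inter> {\<gamma> \<in> carrier C1. norm_cochain G (\<phi> t) \<gamma> \<in> carrier (char_group K G)}"

definition norm_lifts :: "('g \<Rightarrow> 'k) set" where
  "norm_lifts = char_lifts \<inter> {\<gamma> \<in> carrier C1. norm_cochain G (\<phi> t) \<gamma> \<in> char.norms}"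

lemma group_hom_norm_cochain: "group_hom C1 C1 (norm_cochain G (\<phi> t))"
  using norm_cochain_hom group_unit_fun by (simp add: group_hom_def group_hom_axioms_def)

lemma norms_subgroup_C1: "subgroup char.norms C1"
  using group.incl_subgroup[OF group_unit_fun subgroup_chars] char.subgroup_norms char_group_eq by metis

sublocale lifts: subquotient C1 char_lifts norm_lifts
proof -
  have 1: "subgroup char_lifts C1"
    unfolding char_lifts_def
    by (intro group.subgroups_Inter_pair group_unit_fun subgroup_N1
        subgroup_vimage[OF group_hom_norm_cochain subgroup_chars])
  have 2: "subgroup norm_lifts C1"
    unfolding norm_lifts_def
    by (intro group.subgroups_Inter_pair group_unit_fun 1
        subgroup_vimage[OF group_hom_norm_cochain norms_subgroup_C1])
  show "subquotient C1 char_lifts norm_lifts"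
    using 1 2 comm_group_unit_fun
    by (auto simp: subquotient_def subquotient_axioms_def norm_lifts_def simp del: carrier_product_group)
qed

lemma norm_lift_fixed: "\<gamma> \<in> char_lifts \<Longrightarrow> norm_cochain G (\<phi> t) \<gamma> \<in> char.fixed_points"
  by (auto simp: char_lifts_def char.fixed_points_def char_act_def norm_cochain_def fun_eq_iff mult.commute
      simp del: carrier_product_group)

text \<open>The isomorphism is induced by the norm. It is onto because an invariant character is in
  particular an invariant cochain, hence the norm of some cochain, which need not be a
  character.\<close>

lemma lifts_iso_tate: "lifts.quot \<cong> char.tate.quot"
proof (rule lifts.quot_iso)
  let ?n = "norm_cochain G (\<phi> t)"
  show "group char.tate.quot"
    using char.tate.comm_group_quot comm_group.axioms by blast
  have "?n \<in> hom (C1\<lparr>carrier := char_lifts\<rparr>) ((char_group K G)\<lparr>carrier := char.fixed_points\<rparr>)"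
    using norm_lift_fixed hom_mult[OF norm_cochain_hom]
    by (auto simp: hom_def char_lifts_def simp del: carrier_product_group mult_product_group)
  then show "(\<lambda>\<gamma>. char.norms #>\<^bsub>char_group K G\<^esub> ?n \<gamma>) \<in> hom (C1\<lparr>carrier := char_lifts\<rparr>) char.tate.quot"
    using hom_compose[OF _ char.tate.rcoset_hom] by (simp add: o_def)
  show "(\<lambda>\<gamma>. char.norms #>\<^bsub>char_group K G\<^esub> ?n \<gamma>) ` char_lifts = carrier char.tate.quot"
  proof (intro equalityI subsetI)
    fix c assume "c \<in> carrier char.tate.quot"
    then obtain \<beta> where \<beta>: "\<beta> \<in> char.fixed_points" "c = char.norms #>\<^bsub>char_group K G\<^esub> \<beta>"
      by (auto simp: char.tate.carrier_quot)
    have \<beta>': "\<beta> \<in> carrier (char_group K G)" "char_act G \<phi> t \<beta> = \<beta>"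
      using \<beta> by (auto simp: char.fixed_points_def)
    have "\<beta> (\<phi> t g) = \<beta> g" if "g \<in> carrier G" for g
      using fun_cong[OF \<beta>'(2), of g] that by (simp add: char_act_def)
    then obtain \<gamma> where "\<gamma> \<in> N1" "?n \<gamma> = \<beta>"
      using norm_cochain_surj[of \<beta>] \<beta>' by (auto simp: mem_char_group simp del: carrier_product_group)
    then show "c \<in> (\<lambda>\<gamma>. char.norms #>\<^bsub>char_group K G\<^esub> ?n \<gamma>) ` char_lifts"
      using \<beta> \<beta>' by (intro image_eqI[of _ _ \<gamma>]) (auto simp: char_lifts_def mem_N1 simp del: carrier_product_group)
  qed (use norm_lift_fixed in \<open>auto simp: char.tate.carrier_quot\<close>)
  show "char.norms #>\<^bsub>char_group K G\<^esub> ?n \<gamma> = \<one>\<^bsub>char.tate.quot\<^esub> \<longleftrightarrow> \<gamma> \<in> norm_lifts" if "\<gamma> \<in> char_lifts" for \<gamma>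
    using char.tate.rcoset_eq_B_iff[OF norm_lift_fixed[OF that]] that
    by (auto simp: norm_lifts_def char_lifts_def simp del: carrier_product_group)
qed

text \<open>The coboundary of \<gamma> times its pullback is the coboundary of the norm of \<gamma>,
  and this is trivial exactly when the norm is multiplicative.\<close>

lemma coboundary_in_Z2c_iff:
  assumes "\<gamma> \<in> N1"
  shows "coboundary G \<gamma> \<in> Z2c_ext K G (\<phi> t) \<longleftrightarrow> \<gamma> \<in> char_lifts"
proof -
  have nz: "\<gamma> g \<noteq> 0" if "g \<in> carrier G" for g
    using assms that by (simp add: mem_N1 mem_C1 del: carrier_product_group)
  have "coboundary G \<gamma> (g, u) * coboundary G \<gamma> (\<phi> t g, \<phi> t u) = 1 \<longleftrightarrow>
      norm_cochain G (\<phi> t) \<gamma> (g \<otimes> u) = norm_cochain G (\<phi> t) \<gamma> g * norm_cochain G (\<phi> t) \<gamma> u"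
    if "g \<in> carrier G" "u \<in> carrier G" for g u
    using that nz[of g] nz[of u] nz[of "\<phi> t g"] nz[of "\<phi> t u"] by (auto simp: field_simps)
  then show ?thesis
    using assms coboundary_in_Z2[OF assms] hom_in_carrier[OF norm_cochain_hom, of \<gamma>]
    by (auto simp: mem_Z2c char_lifts_def mem_char_group mem_N1 simp del: carrier_product_group coboundary_apply norm_cochain_apply)
qed

text \<open>Cochains with the same coboundary differ by a character \<beta>, and dividing \<gamma>
  by \<beta> divides its norm by the norm of \<beta>. So the norm can be made 1 without changing the
  coboundary exactly when it is the norm of a character.\<close>

lemma coboundary_in_B2c_iff:
  assumes "\<gamma> \<in> char_lifts"
  shows "coboundary G \<gamma> \<in> B2c_ext K G (\<phi> t) \<longleftrightarrow> \<gamma> \<in> norm_lifts"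
proof
  let ?n = "norm_cochain G (\<phi> t)"
  have \<gamma>: "\<gamma> \<in> N1" "\<gamma> \<in> carrier C1"
    using assms by (auto simp: char_lifts_def)
  have nz: "\<gamma> g \<noteq> 0" if "g \<in> carrier G" for g
    using \<gamma> that by (simp add: mem_C1 del: carrier_product_group)
  assume "coboundary G \<gamma> \<in> B2c_ext K G (\<phi> t)"
  then obtain \<gamma>' where \<gamma>': "\<gamma>' \<in> N1" "coboundary G \<gamma> = coboundary G \<gamma>'"
    and n': "\<And>g. g \<in> carrier G \<Longrightarrow> \<gamma>' g * \<gamma>' (\<phi> t g) = 1"
    by (auto simp: mem_B2c)
  have nz': "\<gamma>' g \<noteq> 0" if "g \<in> carrier G" for g
    using \<gamma>' that by (simp add: mem_N1 mem_C1 del: carrier_product_group)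
  define \<beta> where "\<beta> = (\<lambda>g\<in>carrier G. \<gamma> g / \<gamma>' g)"
  have "\<beta> (g \<otimes> u) = \<beta> g * \<beta> u" if "g \<in> carrier G" "u \<in> carrier G" for g u
    using fun_cong[OF \<gamma>'(2), of "(g, u)"] that nz[of g] nz[of u] nz'[of g] nz'[of u] nz'[of "g \<otimes> u"]
    by (simp add: \<beta>_def field_simps)
  then have \<beta>: "\<beta> \<in> carrier (char_group K G)"
    using nz nz' by (auto simp: mem_char_group mem_C1 \<beta>_def simp del: carrier_product_group)
  have "?n \<gamma> = ?n \<beta>"
  proof (rule extensionalityI[where A = "carrier G"])
    fix g assume g: "g \<in> carrier G"
    have "?n \<beta> g = ?n \<gamma> g / (\<gamma>' g * \<gamma>' (\<phi> t g))"
      using g by (simp add: \<beta>_def)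
    then show "?n \<gamma> g = ?n \<beta> g"
      using n'[OF g] by simp
  qed (simp_all add: norm_cochain_def)
  then have "?n \<gamma> \<in> char.norms"
    unfolding char.norms_def using norm_char[OF \<beta>] \<beta> by (intro image_eqI[of _ _ \<beta>]) simp_all
  then show "\<gamma> \<in> norm_lifts"
    using assms \<gamma> by (simp add: norm_lifts_def del: carrier_product_group)
next
  let ?n = "norm_cochain G (\<phi> t)"
  assume "\<gamma> \<in> norm_lifts"
  then have \<gamma>: "\<gamma> \<in> N1" "\<gamma> \<in> carrier C1" "?n \<gamma> \<in> char.norms"
    by (auto simp: norm_lifts_def char_lifts_def)
  obtain \<beta> where \<beta>: "\<beta> \<in> carrier (char_group K G)" "?n \<gamma> = ?n \<beta>"
    using \<gamma>(3) norm_char by (auto simp: char.norms_def)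
  have nz: "\<gamma> g \<noteq> 0" "\<beta> g \<noteq> 0" if "g \<in> carrier G" for g
    using \<gamma> \<beta> that by (simp_all add: mem_char_group mem_C1 del: carrier_product_group)
  define \<gamma>' where "\<gamma>' = (\<lambda>g\<in>carrier G. \<gamma> g / \<beta> g)"
  have "\<gamma>' \<in> N1"
    using \<gamma> \<beta> nz by (auto simp: mem_N1 mem_C1 \<gamma>'_def simp del: carrier_product_group)
  moreover have "coboundary G \<gamma> = coboundary G \<gamma>'"
    by (rule C2_eqI) (use \<beta>(1) nz in \<open>auto simp: \<gamma>'_def mem_char_group field_simps simp del: carrier_product_group\<close>)
  moreover have "\<gamma>' g * \<gamma>' (\<phi> t g) = 1" if "g \<in> carrier G" for g
    using fun_cong[OF \<beta>(2), of g] that nz[of g] nz[of "\<phi> t g"] by (simp add: \<gamma>'_def)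
  ultimately show "coboundary G \<gamma> \<in> B2c_ext K G (\<phi> t)"
    by (auto simp: mem_B2c)
qed

text \<open>A class in the kernel is represented by a coboundary lying in \<open>Z2c_ext\<close>,
  that is, by the coboundary of an element of \<open>char_lifts\<close>; it is trivial exactly for
  elements of \<open>norm_lifts\<close>.\<close>

lemma Ker_Psi_iso_tate: "Ker_Psi_group K G (\<phi> t) \<cong> char_fixed_group K G L \<phi> Mod char_norms K G \<phi> t"
proof -
  let ?Z = "Z2c_ext K G (\<phi> t)" and ?B = "B2c_ext K G (\<phi> t)"
  let ?h = "\<lambda>\<gamma>. ?B #>\<^bsub>C2\<^esub> coboundary G \<gamma>"
  interpret Psi: group_hom "H2c_ext K G (\<phi> t)" "schur K G" "Psi K G"
    by (rule group_hom_Psi)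
  have ker: "kernel (H2c_ext K G (\<phi> t)) (schur K G) (Psi K G) = ?h ` char_lifts"
  proof (intro equalityI subsetI)
    fix c assume "c \<in> kernel (H2c_ext K G (\<phi> t)) (schur K G) (Psi K G)"
    then obtain \<tau> where \<tau>: "\<tau> \<in> ?Z" "c = ?B #>\<^bsub>C2\<^esub> \<tau>" "B2 #>\<^bsub>C2\<^esub> \<tau> = B2"
      by (auto simp: kernel_def H2c_ext_eq extc.carrier_quot Psi_rcoset schur_eq)
    then have "\<tau> \<in> B2"
      using sch.rcoset_eq_B_iff Z2c_subset by blast
    then show "c \<in> ?h ` char_lifts"
      using \<tau> coboundary_in_Z2c_iff by (auto simp: B2_eq)
  next
    fix c assume "c \<in> ?h ` char_lifts"
    then obtain \<gamma> where \<gamma>: "\<gamma> \<in> char_lifts" "c = ?h \<gamma>"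
      by blast
    then have "\<gamma> \<in> N1"
      by (simp add: char_lifts_def)
    then have "coboundary G \<gamma> \<in> ?Z" "coboundary G \<gamma> \<in> B2" "coboundary G \<gamma> \<in> Z2"
      using \<gamma> coboundary_in_Z2c_iff B2_subset by (auto simp: B2_eq)
    then show "c \<in> kernel (H2c_ext K G (\<phi> t)) (schur K G) (Psi K G)"
      using \<gamma> sch.rcoset_eq_B_iff
      by (auto simp: kernel_def H2c_ext_eq extc.carrier_quot Psi_rcoset schur_eq)
  qed
  have lift: "coboundary G \<gamma> \<in> ?Z" if "\<gamma> \<in> char_lifts" for \<gamma>
    using coboundary_in_Z2c_iff that by (auto simp: char_lifts_def)
  have "lifts.quot \<cong> Ker_Psi_group K G (\<phi> t)"
  proof (rule lifts.quot_iso)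
    show "group (Ker_Psi_group K G (\<phi> t))"
      unfolding Ker_Psi_group_def
      using Psi.subgroup_kernel Psi.G.is_group by (rule subgroup.subgroup_is_group)
    have "coboundary G \<in> hom (C1\<lparr>carrier := char_lifts\<rparr>) (C2\<lparr>carrier := ?Z\<rparr>)"
      using lift hom_mult[OF coboundary_hom]
      by (auto simp: hom_def char_lifts_def simp del: carrier_product_group mult_product_group)
    from hom_compose[OF this extc.rcoset_hom]
    have "?h \<in> hom (C1\<lparr>carrier := char_lifts\<rparr>) (H2c_ext K G (\<phi> t))"
      by (simp add: o_def H2c_ext_eq)
    then show "?h \<in> hom (C1\<lparr>carrier := char_lifts\<rparr>) (Ker_Psi_group K G (\<phi> t))"
      unfolding Ker_Psi_group_def ker by (auto simp: hom_def)
    show "?h ` char_lifts = carrier (Ker_Psi_group K G (\<phi> t))"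
      by (simp add: Ker_Psi_group_def ker)
    show "?h \<gamma> = \<one>\<^bsub>Ker_Psi_group K G (\<phi> t)\<^esub> \<longleftrightarrow> \<gamma> \<in> norm_lifts" if "\<gamma> \<in> char_lifts" for \<gamma>
      using extc.rcoset_eq_B_iff[OF lift[OF that]] coboundary_in_B2c_iff[OF that]
      by (simp add: Ker_Psi_group_def H2c_ext_eq)
  qed
  then have "Ker_Psi_group K G (\<phi> t) \<cong> lifts.quot"
    using group.iso_sym lifts.comm_group_quot comm_group.axioms by blast
  then show ?thesis
    unfolding tate_eq using lifts_iso_tate iso_trans by blast
qed

end

section \<open>Roots of unity of 2-power order\<close>

lemma nat_pow_unit_group [simp]: "w [^]\<^bsub>unit_group\<^esub> (m :: nat) = w ^ m"
  by (induction m) (simp_all add: nat_pow_def mult.commute)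

lemma (in group) int_pow_cong:
  assumes "xx \<in> carrier G" "xx [^] (N :: nat) = \<one>" "[i = j] (mod int N)"
  shows "xx [^] i = xx [^] j"
proof -
  obtain k where "i = j + int N * k"
    using cong_sym[OF assms(3)] by (auto simp: cong_iff_lin mult.commute)
  then have "xx [^] i = xx [^] j \<otimes> (xx [^] int N) [^] k"
    using assms(1) by (simp add: int_pow_mult int_pow_pow)
  then show ?thesis
    using assms(1,2) by (simp add: int_pow_int)
qed

text \<open>Induction by square roots: if \<zeta> has order 2^n and \<xi>^2 = \<zeta>, then
  \<xi>^(2^n) = -1, so \<xi> has order 2^(n+1). For a root of unity w of the next level, w^2 is a
  power of \<zeta>, so w is a power of \<xi> up to sign, and the sign is itself a power of
  \<xi>.\<close>

lemma primitive_root_two_power_exists: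
  "\<exists>\<zeta> :: 'k::{alg_closed_field, field_char_0}. \<zeta> \<noteq> 0 \<and> (\<forall>r. \<zeta> powi r = 1 \<longleftrightarrow> 2 ^ n dvd r) \<and>
     (\<forall>w. w ^ (2 ^ n) = 1 \<longrightarrow> (\<exists>r. w = \<zeta> powi r))"
proof (induction n)
  case 0
  show ?case
    by (intro exI[of _ 1]) auto
next
  case (Suc n)
  then obtain \<zeta> :: 'k where \<zeta>: "\<zeta> \<noteq> 0" "\<And>r. \<zeta> powi r = 1 \<longleftrightarrow> 2 ^ n dvd r"
    "\<And>w. w ^ (2 ^ n) = 1 \<Longrightarrow> \<exists>r. w = \<zeta> powi r"
    by blast
  obtain \<xi> where \<xi>: "\<xi> ^ 2 = \<zeta>" and \<xi>1: "\<xi> ^ (2 ^ n) = -1"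
  proof (cases "n = 0")
    \<comment> \<open>Here \<zeta> = 1, and of its two square roots only -1 is primitive.\<close>
    case True
    then have "\<zeta> = 1"
      using \<zeta>(2)[of 1] by simp
    then show ?thesis
      using True by (intro that[of "-1"]) auto
  next
    case False
    then obtain m where m: "n = Suc m"
      by (cases n) auto
    obtain \<xi> where \<xi>: "\<xi> ^ 2 = \<zeta>"
      using nth_root_exists[of 2 \<zeta>] by auto
    have "(\<xi> ^ (2 ^ n)) ^ 2 = \<zeta> ^ (2 ^ n)"
      by (simp add: \<xi>[symmetric] mult.commute flip: power_mult)
    also have "\<dots> = 1"
      using \<zeta>(2)[of "2 ^ n"] power_int_of_nat[of \<zeta> "2 ^ n"] by simp
    finally have "\<xi> ^ (2 ^ n) = 1 \<or> \<xi> ^ (2 ^ n) = -1"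
      by (simp add: power2_eq_1_iff)
    moreover have "\<xi> ^ (2 ^ n) = \<zeta> ^ (2 ^ m)"
      by (simp add: \<xi>[symmetric] m flip: power_mult)
    moreover have "\<zeta> ^ (2 ^ m) \<noteq> 1"
      using \<zeta>(2)[of "2 ^ m"] power_int_of_nat[of \<zeta> "2 ^ m"] m by (auto dest: zdvd_imp_le)
    ultimately have "\<xi> ^ (2 ^ n) = -1"
      by simp
    then show ?thesis
      by (intro that[of \<xi>] \<xi>)
  qed
  have \<xi>0: "\<xi> \<noteq> 0"
    using \<xi> \<zeta>(1) by auto
  have \<xi>2: "\<xi> powi (2 * r) = \<zeta> powi r" for r
    using \<xi> by (simp add: power_int_mult)
  have \<xi>m: "\<xi> powi (2 ^ n) = -1"
    using \<xi>1 power_int_of_nat[of \<xi> "2 ^ n"] by simp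
  have "\<xi> powi r = 1 \<longleftrightarrow> 2 ^ Suc n dvd r" for r
  proof
    assume r: "\<xi> powi r = 1"
    then have "\<zeta> powi r = 1"
      unfolding \<xi>2[symmetric] by (simp add: power_int_mult mult.commute[of 2])
    then obtain q where q: "r = 2 ^ n * q"
      using \<zeta>(2) by (auto elim: dvdE)
    \<comment> \<open>This forces \<open>q\<close> to be even because -1 and 1 differ in
      characteristic 0.\<close>
    have "(-1 :: 'k) powi q = 1"
      using r by (simp add: q power_int_mult \<xi>m)
    then have "even q"
      by (cases "even q") auto
    then show "2 ^ Suc n dvd r"
      by (auto simp: q elim: evenE)
  next
    assume "2 ^ Suc n dvd r"
    then obtain q where "r = 2 * (2 ^ n * q)"
      by (auto simp: mult.assoc elim: dvdE)
    then show "\<xi> powi r = 1"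
      using \<zeta>(2)[of "2 ^ n * q"] by (simp add: \<xi>2)
  qed
  moreover have "\<exists>r. w = \<xi> powi r" if w: "w ^ (2 ^ Suc n) = 1" for w
  proof -
    have "(w ^ 2) ^ (2 ^ n) = 1"
      using w by (simp flip: power_mult)
    then obtain r where r: "w ^ 2 = \<zeta> powi r"
      using \<zeta>(3) by blast
    have "\<zeta> powi r = (\<xi> powi r) ^ 2"
      using \<xi>0 by (simp add: \<xi>2[symmetric] power2_eq_square power_int_add[symmetric])
    then have "w = \<xi> powi r \<or> w = - (\<xi> powi r)"
      using r by (simp add: power2_eq_iff)
    moreover have "- (\<xi> powi r) = \<xi> powi (2 ^ n + r)"
      using \<xi>0 by (simp add: power_int_add \<xi>m)
    ultimately show ?thesis
      by blast
  qed
  ultimately show ?case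
    using \<xi>0 by blast
qed

section \<open>Coordinates on a product of two cyclic groups of order \<open>N\<close>\<close>

locale bicyclic_group = G: group G for G :: "'g monoid" (structure) +
  fixes x y :: 'g and N :: nat
  assumes x_closed [simp]: "x \<in> carrier G" and y_closed [simp]: "y \<in> carrier G" and N: "N \<ge> 2"
    and iso: "(\<lambda>(i, j). x [^] i \<otimes> y [^] j) \<in> iso (integer_mod_group N \<times>\<times> integer_mod_group N) G"
begin

abbreviation \<theta> :: "int \<times> int \<Rightarrow> 'g" where "\<theta> \<equiv> \<lambda>(i, j). x [^] i \<otimes> y [^] j"
abbreviation ZZ :: "(int \<times> int) monoid" where "ZZ \<equiv> integer_mod_group N \<times>\<times> integer_mod_group N"

text \<open>The coordinates are integers from 0 to N - 1, so the homomorphism property becomes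
  additivity modulo \<open>N\<close> and is stated with congruences below.\<close>

definition coord :: "'g \<Rightarrow> int \<times> int" where
  "coord = inv_into (carrier ZZ) \<theta>"

abbreviation cx :: "'g \<Rightarrow> int" where "cx g \<equiv> fst (coord g)"
abbreviation cy :: "'g \<Rightarrow> int" where "cy g \<equiv> snd (coord g)"

lemma group_ZZ: "group ZZ"
  by (simp add: DirProd_group)

lemma coord_iso: "coord \<in> iso G ZZ"
  unfolding coord_def by (rule group.iso_set_sym[OF group_ZZ iso])

lemma coord_decomp: "g \<in> carrier G \<Longrightarrow> g = x [^] cx g \<otimes> y [^] cy g"
proof -
  assume g: "g \<in> carrier G"
  have "bij_betw \<theta> (carrier ZZ) (carrier G)"
    using iso by (auto simp: iso_def)
  then have "\<theta> (coord g) = g"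
    using g unfolding coord_def by (intro bij_betw_inv_into_right)
  then show ?thesis
    by (simp add: case_prod_beta)
qed

lemma coord_\<theta>: "p \<in> carrier ZZ \<Longrightarrow> coord (\<theta> p) = p"
  using iso unfolding coord_def by (intro bij_betw_inv_into_left) (auto simp: iso_def)

lemma coord_x: "coord x = (1, 0)" and coord_y: "coord y = (0, 1)" and coord_one: "coord \<one> = (0, 0)"
  using coord_\<theta>[of "(1, 0)"] coord_\<theta>[of "(0, 1)"] coord_\<theta>[of "(0, 0)"] N
  by (auto simp: carrier_integer_mod_group)

lemma coord_mult:
  assumes "g \<in> carrier G" "u \<in> carrier G"
  shows "[cx (g \<otimes> u) = cx g + cx u] (mod int N)" "[cy (g \<otimes> u) = cy g + cy u] (mod int N)"
  using iso_imp_homomorphism[OF coord_iso] hom_mult[of coord G ZZ g u] assms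
  by (auto simp: DirProd_def case_prod_beta)

lemma comm: "g \<in> carrier G \<Longrightarrow> u \<in> carrier G \<Longrightarrow> g \<otimes> u = u \<otimes> g"
proof -
  assume g: "g \<in> carrier G" "u \<in> carrier G"
  have "coord (g \<otimes> u) = coord (u \<otimes> g)"
    using iso_imp_homomorphism[OF coord_iso] hom_mult[of coord G ZZ] g
    by (simp add: DirProd_def case_prod_beta add.commute)
  then show ?thesis
    using coord_decomp g by (metis G.m_closed)
qed

lemma coord_pow:
  fixes i :: int
  assumes "g \<in> carrier G"
  shows "[cx (g [^] i) = i * cx g] (mod int N)" "[cy (g [^] i) = i * cy g] (mod int N)"
proof -
  have hom: "coord \<in> hom G ZZ"
    by (rule iso_imp_homomorphism[OF coord_iso])
  have "cx \<in> hom G (integer_mod_group N)" "cy \<in> hom G (integer_mod_group N)"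
    using hom by (simp_all add: hom_pairwise o_def)
  then have "cx (g [^] i) = cx g [^]\<^bsub>integer_mod_group N\<^esub> i" "cy (g [^] i) = cy g [^]\<^bsub>integer_mod_group N\<^esub> i"
    using assms by (auto intro!: hom_int_pow)
  then show "[cx (g [^] i) = i * cx g] (mod int N)" "[cy (g [^] i) = i * cy g] (mod int N)"
    by (simp_all add: int_pow_integer_mod_group)
qed

lemma pow_N_eq_one: "g \<in> carrier G \<Longrightarrow> g [^] N = \<one>"
proof -
  assume g: "g \<in> carrier G"
  have "coord (g [^] int N) \<in> carrier ZZ"
    using iso_imp_homomorphism[OF coord_iso] g by (intro hom_in_carrier[of coord G ZZ]) auto
  \<comment> \<open>Applied to both coordinates of the \<open>N\<close>-th power, which are
    multiples of \<open>N\<close> in the range from 0 to N - 1.\<close>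
  moreover have "z = 0" if "int N dvd z" "0 \<le> z" "z < int N" for z
    using zdvd_imp_le[OF that(1)] that by (cases "0 < z") auto
  ultimately have "cx (g [^] int N) = 0" "cy (g [^] int N) = 0"
    using coord_pow[OF g, of "int N"] N
    by (auto simp: carrier_integer_mod_group DirProd_def cong_def mod_eq_0_iff_dvd)
  then show ?thesis
    using coord_decomp[of "g [^] int N"] g by (simp add: int_pow_int)
qed

end

section \<open>The Schur multiplier of \<open>G\<close> and explicit cocycles\<close>

text \<open>The assumptions on \<open>q\<close> are the cocycle conditions for
  (\<open>\<sigma>\<^sub>0 r\<close>, \<open>\<tau>\<^sub>0 r\<close>) read in exponents of \<zeta>:
  \<open>q_add\<close> relates the two functions and \<open>q_invariant\<close> is invariance under
  t. They are demanded only when r (det A + 1) vanishes modulo \<open>N\<close>, that is, for the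
  exponents occurring in the minus part.\<close>

locale bicyclic_action = order2_action L t G \<phi> k_type + bicyclic_group G x y N
  for L :: "'l monoid" and t :: 'l and G :: "'g monoid" (structure) and \<phi> :: "'l \<Rightarrow> 'g \<Rightarrow> 'g"
    and k_type :: "'k::alg_closed_field itself" and x y :: 'g and N :: nat +
  fixes \<zeta> :: 'k and a b c d :: int and q :: "int \<Rightarrow> int \<Rightarrow> int"
  assumes \<phi>_x: "\<phi> t x = x [^] a \<otimes> y [^] b" and \<phi>_y: "\<phi> t y = x [^] c \<otimes> y [^] d"
    and \<zeta>_nonzero: "\<zeta> \<noteq> 0" and \<zeta>_primitive: "\<zeta> powi r = 1 \<longleftrightarrow> int N dvd r"
    and roots_of_unity: "w ^ N = 1 \<Longrightarrow> \<exists>r. w = \<zeta> powi r"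
    and q_cong: "[i = i'] (mod int N) \<Longrightarrow> [j = j'] (mod int N) \<Longrightarrow> [q i j = q i' j'] (mod int N)"
    and q_zero: "q 0 0 = 0"
    and q_add: "int N dvd r * (a * d - b * c + 1) \<Longrightarrow>
      [r * q (i + k) (j + l) = r * (q i j + q k l + i * l + (a * i + c * j) * (b * k + d * l))] (mod int N)"
    and q_invariant: "int N dvd r * (a * d - b * c + 1) \<Longrightarrow>
      [r * q (a * i + c * j) (b * i + d * j) = r * q i j] (mod int N)"
begin

lemma coord_\<phi>:
  assumes g: "g \<in> carrier G"
  shows "[cx (\<phi> t g) = a * cx g + c * cy g] (mod int N)" "[cy (\<phi> t g) = b * cx g + d * cy g] (mod int N)"
proof -
  have eq: "\<phi> t g = (x [^] a \<otimes> y [^] b) [^] cx g \<otimes> (x [^] c \<otimes> y [^] d) [^] cy g"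
  proof -
    have "\<phi> t g = \<phi> t (x [^] cx g \<otimes> y [^] cy g)"
      using coord_decomp[OF g] by simp
    also have "\<dots> = \<phi> t x [^] cx g \<otimes> \<phi> t y [^] cy g"
      using hom_int_pow[OF \<phi>_t_hom _ G.is_group G.is_group] by simp
    finally show ?thesis
      by (simp only: \<phi>_x \<phi>_y)
  qed
  have x_pow: "[cx (x [^] i \<otimes> y [^] j) = i] (mod int N)" "[cy (x [^] i \<otimes> y [^] j) = j] (mod int N)" for i j :: int
  proof -
    have "[cx (x [^] i \<otimes> y [^] j) = i * cx x + j * cx y] (mod int N)"
      by (rule cong_trans[OF coord_mult(1) cong_add[OF coord_pow(1) coord_pow(1)]]) auto
    then show "[cx (x [^] i \<otimes> y [^] j) = i] (mod int N)"
      by (simp add: coord_x coord_y)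
    have "[cy (x [^] i \<otimes> y [^] j) = i * cy x + j * cy y] (mod int N)"
      by (rule cong_trans[OF coord_mult(2) cong_add[OF coord_pow(2) coord_pow(2)]]) auto
    then show "[cy (x [^] i \<otimes> y [^] j) = j] (mod int N)"
      by (simp add: coord_x coord_y)
  qed
  let ?xx = "x [^] a \<otimes> y [^] b" and ?yy = "x [^] c \<otimes> y [^] d"
  have "[cx (\<phi> t g) = cx g * cx ?xx + cy g * cx ?yy] (mod int N)"
    unfolding eq by (rule cong_trans[OF coord_mult(1) cong_add[OF coord_pow(1) coord_pow(1)]]) auto
  also have "[cx g * cx ?xx + cy g * cx ?yy = cx g * a + cy g * c] (mod int N)"
    by (intro cong_add cong_scalar_left x_pow)
  finally show "[cx (\<phi> t g) = a * cx g + c * cy g] (mod int N)"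
    by (simp add: mult.commute)
  have "[cy (\<phi> t g) = cx g * cy ?xx + cy g * cy ?yy] (mod int N)"
    unfolding eq by (rule cong_trans[OF coord_mult(2) cong_add[OF coord_pow(2) coord_pow(2)]]) auto
  also have "[cx g * cy ?xx + cy g * cy ?yy = cx g * b + cy g * d] (mod int N)"
    by (intro cong_add cong_scalar_left x_pow)
  finally show "[cy (\<phi> t g) = b * cx g + d * cy g] (mod int N)"
    by (simp add: mult.commute)
qed

lemma \<zeta>_add: "\<zeta> powi (r + s) = \<zeta> powi r * \<zeta> powi s"
  using \<zeta>_nonzero by (simp add: power_int_add)

lemma \<zeta>_eq_iff: "\<zeta> powi r = \<zeta> powi s \<longleftrightarrow> [r = s] (mod int N)"
proof -
  have "\<zeta> powi r = \<zeta> powi (r - s) * \<zeta> powi s"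
    using \<zeta>_add[of "r - s" s] by simp
  then show ?thesis
    using \<zeta>_nonzero \<zeta>_primitive[of "r - s"] by (simp add: cong_iff_dvd_diff)
qed

text \<open>Pairs \<open>(c, g)\<close> multiplied with the cocycle \<open>\<alpha>\<close> form an abelian group, in which \<open>x\<close> and \<open>y\<close>
  lift to elements of order \<open>N\<close> because \<open>k\<^sup>\<times>\<close> is divisible; the induced homomorphism splits the extension.\<close>

lemma symmetric_cocycle_coboundary:
  assumes \<alpha>: "\<alpha> \<in> Z2" and sym: "\<And>g u. g \<in> carrier G \<Longrightarrow> u \<in> carrier G \<Longrightarrow> \<alpha> (g, u) = \<alpha> (u, g)"
  shows "\<alpha> \<in> B2"
proof -
  define E where "E = \<lparr>carrier = {p :: 'k \<times> 'g. fst p \<noteq> 0 \<and> snd p \<in> carrier G},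
    mult = \<lambda>p p'. (fst p * fst p' * \<alpha> (snd p, snd p'), snd p \<otimes> snd p'), one = (1, \<one>)\<rparr>"
  have E: "carrier E = {p. fst p \<noteq> 0 \<and> snd p \<in> carrier G}" "\<one>\<^bsub>E\<^esub> = (1, \<one>)"
    "p \<otimes>\<^bsub>E\<^esub> p' = (fst p * fst p' * \<alpha> (snd p, snd p'), snd p \<otimes> snd p')" for p p'
    by (simp_all add: E_def)
  have nz: "\<alpha> (g, u) \<noteq> 0" if "g \<in> carrier G" "u \<in> carrier G" for g u
    using \<alpha> that by (simp add: mem_Z2 mem_C2 del: carrier_product_group)
  have norm: "\<alpha> (\<one>, g) = 1" "\<alpha> (g, \<one>) = 1" if "g \<in> carrier G" for g
    using \<alpha> that by (simp_all add: mem_Z2)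
  have coc: "\<alpha> (g, u) * \<alpha> (g \<otimes> u, v) = \<alpha> (g, u \<otimes> v) * \<alpha> (u, v)"
    if "g \<in> carrier G" "u \<in> carrier G" "v \<in> carrier G" for g u v
    using \<alpha> that by (simp add: mem_Z2)
  interpret E: comm_group E
  proof (rule comm_groupI)
    fix p p' p'' assume "p \<in> carrier E" "p' \<in> carrier E" "p'' \<in> carrier E"
    then show "p \<otimes>\<^bsub>E\<^esub> p' \<otimes>\<^bsub>E\<^esub> p'' = p \<otimes>\<^bsub>E\<^esub> (p' \<otimes>\<^bsub>E\<^esub> p'')"
      using coc[of "snd p" "snd p'" "snd p''"] by (simp add: E G.m_assoc mult_ac)
  next
    fix p assume p: "p \<in> carrier E"
    let ?p' = "(inverse (fst p * \<alpha> (inv (snd p), snd p)), inv (snd p))"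
    have "?p' \<in> carrier E" "?p' \<otimes>\<^bsub>E\<^esub> p = \<one>\<^bsub>E\<^esub>"
      using p nz by (auto simp: E field_simps)
    then show "\<exists>p'\<in>carrier E. p' \<otimes>\<^bsub>E\<^esub> p = \<one>\<^bsub>E\<^esub>"
      by blast
  qed (auto simp: E nz norm sym comm mult.commute)
  have snd_hom: "snd \<in> hom E G"
    by (auto simp: hom_def E)
  have "\<exists>xx\<in>carrier E. snd xx = g \<and> xx [^]\<^bsub>E\<^esub> N = \<one>\<^bsub>E\<^esub>" if g: "g \<in> carrier G" for g
  proof -
    have cl: "(1, g) \<in> carrier E" "(r, \<one>) \<in> carrier E" if "r \<noteq> 0" for r
      using g that by (auto simp: E)
    have "snd ((1, g) [^]\<^bsub>E\<^esub> N) = \<one>"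
      using hom_nat_pow[OF snd_hom cl(1) E.is_group G.is_group, of 1 N] pow_N_eq_one[OF g] by simp
    then obtain z where z: "(1, g) [^]\<^bsub>E\<^esub> N = (z, \<one>)"
      by (metis prod.collapse)
    have z0: "z \<noteq> 0"
      using E.nat_pow_closed[OF cl(1), of 1 N] by (simp add: z E)
    \<comment> \<open>The lift (1, g) has \<open>N\<close>-th power (z, 1); the central factor (r,
      1) with r^N = z^-1 corrects this power to the identity.\<close>
    obtain r where r: "r ^ N = inverse z"
      using nth_root_exists[of N "inverse z"] N by auto
    have r0: "r \<noteq> 0"
      using r z0 N by (auto simp: power_0_left split: if_splits)
    have pow: "(r, \<one>) [^]\<^bsub>E\<^esub> m = (r ^ m, \<one>)" for m :: nat
      by (induction m) (simp_all add: E norm mult.commute)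
    have "((r, \<one>) \<otimes>\<^bsub>E\<^esub> (1, g)) [^]\<^bsub>E\<^esub> N = \<one>\<^bsub>E\<^esub>"
      using cl r0 E.nat_pow_distrib[of "(r, \<one>)" "(1, g)" N] z0
      by (simp add: pow z r E norm)
    then show ?thesis
      using cl[OF r0] g by (intro bexI[of _ "(r, \<one>) \<otimes>\<^bsub>E\<^esub> (1, g)"]) (auto simp: E nz r0)
  qed
  then obtain xx yy where xx: "xx \<in> carrier E" "snd xx = x" "xx [^]\<^bsub>E\<^esub> N = \<one>\<^bsub>E\<^esub>"
    and yy: "yy \<in> carrier E" "snd yy = y" "yy [^]\<^bsub>E\<^esub> N = \<one>\<^bsub>E\<^esub>"
    using x_closed y_closed by metis
  \<comment> \<open>Since the \<open>N\<close>-th powers of \<open>xx\<close> and \<open>yy\<close>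
    are trivial, the carries modulo \<open>N\<close> in the coordinates do no harm and
    \<open>s\<close> is multiplicative.\<close>
  define s where "s g = xx [^]\<^bsub>E\<^esub> cx g \<otimes>\<^bsub>E\<^esub> yy [^]\<^bsub>E\<^esub> cy g" for g
  have s_closed: "s g \<in> carrier E" for g
    using xx yy by (simp add: s_def)
  have snd_s: "snd (s g) = g" if "g \<in> carrier G" for g
    using coord_decomp[OF that] xx yy hom_mult[OF snd_hom] hom_int_pow[OF snd_hom _ E.is_group G.is_group]
    by (simp add: s_def)
  have s_mult: "s (g \<otimes> u) = s g \<otimes>\<^bsub>E\<^esub> s u" if "g \<in> carrier G" "u \<in> carrier G" for g u
  proof -
    have "xx [^]\<^bsub>E\<^esub> cx (g \<otimes> u) = xx [^]\<^bsub>E\<^esub> cx g \<otimes>\<^bsub>E\<^esub> xx [^]\<^bsub>E\<^esub> cx u"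
      using E.int_pow_cong[OF xx(1,3) coord_mult(1)[OF that]] xx by (simp add: E.int_pow_mult)
    moreover have "yy [^]\<^bsub>E\<^esub> cy (g \<otimes> u) = yy [^]\<^bsub>E\<^esub> cy g \<otimes>\<^bsub>E\<^esub> yy [^]\<^bsub>E\<^esub> cy u"
      using E.int_pow_cong[OF yy(1,3) coord_mult(2)[OF that]] yy by (simp add: E.int_pow_mult)
    ultimately show ?thesis
      using xx yy by (simp add: s_def E.m_ac)
  qed
  \<comment> \<open>As s(g) = (\<gamma>(g), g), the first component of s(g u) = s(g) s(u) exhibits
    \<alpha> as the coboundary of \<gamma>.\<close>
  define \<gamma> where "\<gamma> = (\<lambda>g\<in>carrier G. fst (s g))"
  have \<gamma>0: "\<gamma> g \<noteq> 0" if "g \<in> carrier G" for g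
    using s_closed[of g] that by (simp add: \<gamma>_def E)
  have "\<gamma> \<one> = 1"
    by (simp add: \<gamma>_def s_def coord_one E norm)
  then have "\<gamma> \<in> N1"
    using \<gamma>0 by (auto simp: mem_N1 mem_C1 \<gamma>_def simp del: carrier_product_group)
  moreover have "\<alpha> = coboundary G \<gamma>"
  proof (rule C2_eqI)
    fix g u assume gu: "g \<in> carrier G" "u \<in> carrier G"
    have "\<gamma> (g \<otimes> u) = \<gamma> g * \<gamma> u * \<alpha> (g, u)"
      using s_mult[OF gu] gu by (simp add: \<gamma>_def E snd_s)
    then show "\<alpha> (g, u) = coboundary G \<gamma> (g, u)"
      using gu \<gamma>0 by (simp add: field_simps)
  qed (use \<alpha> in \<open>auto simp: mem_Z2 mem_C2 simp del: carrier_product_group\<close>)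
  ultimately show ?thesis
    by (auto simp: B2_eq)
qed

lemma coboundary_symmetric:
  assumes "\<beta> \<in> B2" "g \<in> carrier G" "u \<in> carrier G"
  shows "\<beta> (g, u) = \<beta> (u, g)"
  using assms by (auto simp: B2_eq comm)

text \<open>The commutator pairing of the central extension defined by \<alpha>. The parameter
  \<open>u\<close> comes first so that partial application yields a character in
  \<open>g\<close>.\<close>

definition commutator_form :: "('g \<times> 'g \<Rightarrow> 'k) \<Rightarrow> 'g \<Rightarrow> 'g \<Rightarrow> 'k" where
  "commutator_form \<alpha> u g = \<alpha> (g, u) / \<alpha> (u, g)"

text \<open>Combine the cocycle identities at (g, h, u), (u, g, h) and (g, u, h), using that
  \<open>G\<close> is abelian.\<close>

lemma commutator_form_hom:
  assumes \<alpha>: "\<alpha> \<in> Z2" and u: "u \<in> carrier G"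
  shows "commutator_form \<alpha> u \<in> hom G K"
proof (rule homI)
  have nz: "\<alpha> (g, v) \<noteq> 0" if "g \<in> carrier G" "v \<in> carrier G" for g v
    using \<alpha> that by (simp add: mem_Z2 mem_C2 del: carrier_product_group)
  have coc: "\<alpha> (g, u) * \<alpha> (g \<otimes> u, v) = \<alpha> (g, u \<otimes> v) * \<alpha> (u, v)"
    if "g \<in> carrier G" "u \<in> carrier G" "v \<in> carrier G" for g u v
    using \<alpha> that by (simp add: mem_Z2)
  show "commutator_form \<alpha> u g \<in> carrier K" if "g \<in> carrier G" for g
    using nz u that by (simp add: commutator_form_def)
  fix g h assume g: "g \<in> carrier G" and h: "h \<in> carrier G"
  have 1: "\<alpha> (g, h) * \<alpha> (g \<otimes> h, u) = \<alpha> (g, h \<otimes> u) * \<alpha> (h, u)"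
    using coc g h u by blast
  have 2: "\<alpha> (u, g) * \<alpha> (u \<otimes> g, h) = \<alpha> (u, g \<otimes> h) * \<alpha> (g, h)"
    using coc g h u by blast
  have 3: "\<alpha> (g, u) * \<alpha> (u \<otimes> g, h) = \<alpha> (g, h \<otimes> u) * \<alpha> (u, h)"
    using coc[OF g u h] comm g h u by simp
  have n: "\<alpha> (g, h) \<noteq> 0" "\<alpha> (g \<otimes> h, u) \<noteq> 0" "\<alpha> (u, g \<otimes> h) \<noteq> 0" "\<alpha> (u, g) \<noteq> 0" "\<alpha> (u, h) \<noteq> 0"
     "\<alpha> (g, h \<otimes> u) \<noteq> 0" "\<alpha> (u \<otimes> g, h) \<noteq> 0"
    using nz g h u by auto
  \<comment> \<open>Both sides of the desired identity carry the nonzero factor \<alpha>(g, h)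
    \<alpha>(u g, h), which is cancelled at the end.\<close>
  have "(\<alpha> (g \<otimes> h, u) * (\<alpha> (u, g) * \<alpha> (u, h))) * (\<alpha> (g, h) * \<alpha> (u \<otimes> g, h)) =
      (\<alpha> (g, h) * \<alpha> (g \<otimes> h, u)) * (\<alpha> (u, g) * \<alpha> (u \<otimes> g, h)) * \<alpha> (u, h)"
    by (simp add: mult_ac)
  also have "\<dots> = (\<alpha> (g, h \<otimes> u) * \<alpha> (h, u)) * (\<alpha> (u, g \<otimes> h) * \<alpha> (g, h)) * \<alpha> (u, h)"
    by (simp only: 1 2)
  also have "\<dots> = (\<alpha> (g, h \<otimes> u) * \<alpha> (u, h)) * (\<alpha> (h, u) * \<alpha> (u, g \<otimes> h) * \<alpha> (g, h))"
    by (simp add: mult_ac)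
  also have "\<dots> = (\<alpha> (u, g \<otimes> h) * (\<alpha> (g, u) * \<alpha> (h, u))) * (\<alpha> (g, h) * \<alpha> (u \<otimes> g, h))"
    by (subst 3[symmetric]) (simp add: mult_ac)
  finally have "\<alpha> (g \<otimes> h, u) * (\<alpha> (u, g) * \<alpha> (u, h)) = \<alpha> (u, g \<otimes> h) * (\<alpha> (g, u) * \<alpha> (h, u))"
    using n by simp
  then show "commutator_form \<alpha> u (g \<otimes> h) = commutator_form \<alpha> u g \<otimes>\<^bsub>K\<^esub> commutator_form \<alpha> u h"
    using n by (simp add: commutator_form_def frac_eq_eq mult_ac)
qed

lemma hom_trivial_on_generators:
  assumes f: "f \<in> hom G K" "f x = 1" "f y = 1" and g: "g \<in> carrier G"
  shows "f g = 1"
proof -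
  interpret f: group_hom G K f
    using f(1) by (simp add: group_hom_def group_hom_axioms_def)
  have "x \<in> kernel G K f" "y \<in> kernel G K f"
    using f by (auto simp: kernel_def)
  then have "x [^] cx g \<otimes> y [^] cy g \<in> kernel G K f"
    by (intro subgroup.m_closed[OF f.subgroup_kernel] G.subgroup_int_pow_closed[OF f.subgroup_kernel])
  then show ?thesis
    using coord_decomp[OF g] by (simp add: kernel_def)
qed

text \<open>The commutator pairing is multiplicative in each variable and trivial on the diagonal,
  so its value at the two generators decides whether \<alpha> is symmetric. Triviality is propagated
  from the generators in one variable, then in the other.\<close>

lemma coboundary_if_commutes_at_xy:
  assumes \<alpha>: "\<alpha> \<in> Z2" and xy: "\<alpha> (x, y) = \<alpha> (y, x)"
  shows "\<alpha> \<in> B2"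
proof (rule symmetric_cocycle_coboundary[OF \<alpha>])
  have nz: "\<alpha> (g, v) \<noteq> 0" if "g \<in> carrier G" "v \<in> carrier G" for g v
    using \<alpha> that by (simp add: mem_Z2 mem_C2 del: carrier_product_group)
  have xy1: "commutator_form \<alpha> v g = 1" if "v \<in> {x, y}" "g \<in> carrier G" for v g
    by (rule hom_trivial_on_generators[OF commutator_form_hom[OF \<alpha>]])
      (use that xy nz in \<open>auto simp: commutator_form_def\<close>)
  fix g u assume gu: "g \<in> carrier G" "u \<in> carrier G"
  have "commutator_form \<alpha> u v = 1" if "v \<in> {x, y}" for v
    using xy1[OF that gu(2)] that gu nz by (auto simp: commutator_form_def)
  then have "commutator_form \<alpha> u g = 1"
    using hom_trivial_on_generators[OF commutator_form_hom[OF \<alpha> gu(2)] _ _ gu(1)] by simp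
  then show "\<alpha> (g, u) = \<alpha> (u, g)"
    using nz gu by (simp add: commutator_form_def)
qed

definition \<tau>\<^sub>0 :: "int \<Rightarrow> 'g \<times> 'g \<Rightarrow> 'k" where
  "\<tau>\<^sub>0 r = (\<lambda>(g, u)\<in>carrier G \<times> carrier G. \<zeta> powi (r * (cx g * cy u)))"

definition \<sigma>\<^sub>0 :: "int \<Rightarrow> 'g \<Rightarrow> 'k" where
  "\<sigma>\<^sub>0 r = (\<lambda>g\<in>carrier G. \<zeta> powi (r * q (cx g) (cy g)))"

lemma \<tau>\<^sub>0_apply [simp]: "g \<in> carrier G \<Longrightarrow> u \<in> carrier G \<Longrightarrow> \<tau>\<^sub>0 r (g, u) = \<zeta> powi (r * (cx g * cy u))"
  by (simp add: \<tau>\<^sub>0_def)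

lemma \<sigma>\<^sub>0_apply [simp]: "g \<in> carrier G \<Longrightarrow> \<sigma>\<^sub>0 r g = \<zeta> powi (r * q (cx g) (cy g))"
  by (simp add: \<sigma>\<^sub>0_def)

lemma \<tau>\<^sub>0_extensional [simp]: "\<tau>\<^sub>0 r \<in> extensional (carrier G \<times> carrier G)"
  by (simp add: \<tau>\<^sub>0_def)

lemma \<sigma>\<^sub>0_extensional [simp]: "\<sigma>\<^sub>0 r \<in> extensional (carrier G)"
  by (simp add: \<sigma>\<^sub>0_def)

text \<open>A bicharacter is a cocycle. Additivity of the coordinates modulo \<open>N\<close>
  suffices, as \<zeta>^N = 1.\<close>

lemma \<tau>\<^sub>0_Z2: "\<tau>\<^sub>0 r \<in> Z2"
proof -
  have "\<tau>\<^sub>0 r (g, u) * \<tau>\<^sub>0 r (g \<otimes> u, v) = \<tau>\<^sub>0 r (g, u \<otimes> v) * \<tau>\<^sub>0 r (u, v)"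
    if g: "g \<in> carrier G" "u \<in> carrier G" "v \<in> carrier G" for g u v
  proof -
    have "[r * (cx g * cy u) + r * (cx (g \<otimes> u) * cy v) =
        r * (cx g * cy u) + r * ((cx g + cx u) * cy v)] (mod int N)"
      by (intro cong_add cong_mult cong_refl coord_mult g)
    also have "[r * (cx g * cy u) + r * ((cx g + cx u) * cy v) =
        r * (cx g * (cy u + cy v)) + r * (cx u * cy v)] (mod int N)"
      by (simp add: algebra_simps)
    also have "[r * (cx g * (cy u + cy v)) + r * (cx u * cy v) =
        r * (cx g * cy (u \<otimes> v)) + r * (cx u * cy v)] (mod int N)"
      by (intro cong_add cong_mult cong_refl cong_sym[OF coord_mult(2)] g)
    finally show ?thesis
      using g by (simp add: \<zeta>_eq_iff flip: \<zeta>_add)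
  qed
  then show ?thesis
    using \<zeta>_nonzero by (auto simp: mem_Z2 mem_C2 coord_one simp del: carrier_product_group)
qed

lemma \<tau>\<^sub>0_add: "\<tau>\<^sub>0 (r + r') = \<tau>\<^sub>0 r \<otimes>\<^bsub>C2\<^esub> \<tau>\<^sub>0 r'"
  by (rule C2_eqI) (auto simp: \<zeta>_add distrib_right)

lemma \<sigma>\<^sub>0_add: "\<sigma>\<^sub>0 (r + r') = \<sigma>\<^sub>0 r \<otimes>\<^bsub>C1\<^esub> \<sigma>\<^sub>0 r'"
  by (auto simp: \<sigma>\<^sub>0_def fun_eq_iff \<zeta>_add distrib_right)

lemma \<tau>\<^sub>0_cong: "[r = r'] (mod int N) \<Longrightarrow> \<tau>\<^sub>0 r = \<tau>\<^sub>0 r'"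
  by (rule C2_eqI) (auto simp: \<zeta>_eq_iff cong_scalar_right)

lemma \<sigma>\<^sub>0_cong: "[r = r'] (mod int N) \<Longrightarrow> \<sigma>\<^sub>0 r = \<sigma>\<^sub>0 r'"
  by (auto simp: \<sigma>\<^sub>0_def fun_eq_iff \<zeta>_eq_iff cong_scalar_right)

text \<open>The commutator pairing of the generators is an \<open>N\<close>-th root of unity, hence
  some \<zeta>^r. The cocycle \<open>\<tau>\<^sub>0 r\<close> has the same pairing, so its quotient
  with \<alpha> commutes at the generators and is a coboundary.\<close>

lemma cocycle_class:
  assumes \<alpha>: "\<alpha> \<in> Z2"
  obtains r where "B2 #>\<^bsub>C2\<^esub> \<alpha> = B2 #>\<^bsub>C2\<^esub> \<tau>\<^sub>0 r"
proof -
  let ?w = "commutator_form \<alpha> y x"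
  have nz: "\<alpha> (g, v) \<noteq> 0" if "g \<in> carrier G" "v \<in> carrier G" for g v
    using \<alpha> that by (simp add: mem_Z2 mem_C2 del: carrier_product_group)
  have "?w ^ N = commutator_form \<alpha> y (x [^] N)"
    using hom_nat_pow[OF commutator_form_hom[OF \<alpha> y_closed] x_closed G.is_group group_unit_group, of N] by simp
  also have "\<dots> = 1"
    using \<alpha> by (simp add: pow_N_eq_one commutator_form_def mem_Z2)
  finally obtain r where r: "?w = \<zeta> powi r"
    using roots_of_unity by blast
  let ?\<beta> = "\<alpha> \<otimes>\<^bsub>C2\<^esub> inv\<^bsub>C2\<^esub> \<tau>\<^sub>0 r"
  have \<tau>: "\<tau>\<^sub>0 r \<in> carrier C2"
    using \<tau>\<^sub>0_Z2[of r] by (simp add: mem_Z2 del: carrier_product_group)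
  have "?\<beta> \<in> Z2"
    by (intro subgroup.m_closed[OF subgroup_Z2] subgroup.m_inv_closed[OF subgroup_Z2] \<alpha> \<tau>\<^sub>0_Z2)
  moreover have "?\<beta> (x, y) = ?\<beta> (y, x)"
    using r nz[OF y_closed x_closed] \<zeta>_nonzero unfolding inv_unit_fun[OF \<tau>]
    by (simp add: coord_x coord_y commutator_form_def field_simps)
  ultimately have "?\<beta> \<in> B2"
    by (rule coboundary_if_commutes_at_xy)
  moreover have "\<alpha> = ?\<beta> \<otimes>\<^bsub>C2\<^esub> \<tau>\<^sub>0 r"
    using \<alpha> \<tau> by (simp add: extc.m_assoc mem_Z2 del: carrier_product_group inv_product_group mult_product_group one_product_group)
  ultimately show thesis
    using sch.rcoset_eq_iff[OF \<alpha> \<tau>\<^sub>0_Z2[of r]] that by blast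
qed

text \<open>Coboundaries are symmetric, while \<open>\<tau>\<^sub>0 r\<close> takes the values
  \<zeta>^r at (x, y) and 1 at (y, x), so the class determines \<zeta>^r.\<close>

lemma \<tau>\<^sub>0_class_inj:
  assumes "B2 #>\<^bsub>C2\<^esub> \<tau>\<^sub>0 r = B2 #>\<^bsub>C2\<^esub> \<tau>\<^sub>0 r'"
  shows "[r = r'] (mod int N)"
proof -
  obtain \<beta> where \<beta>: "\<beta> \<in> B2" "\<tau>\<^sub>0 r = \<beta> \<otimes>\<^bsub>C2\<^esub> \<tau>\<^sub>0 r'"
    using assms sch.rcoset_eq_iff[OF \<tau>\<^sub>0_Z2 \<tau>\<^sub>0_Z2] by blast
  have "\<zeta> powi r = \<beta> (x, y) * \<zeta> powi r'"
    using fun_cong[OF \<beta>(2), of "(x, y)"] by (simp add: coord_x coord_y)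
  moreover have "1 = \<beta> (y, x)"
    using fun_cong[OF \<beta>(2), of "(y, x)"] by (simp add: coord_x coord_y)
  ultimately show ?thesis
    using coboundary_symmetric[OF \<beta>(1) x_closed y_closed] by (simp add: \<zeta>_eq_iff)
qed

definition minus_exponents :: "int set" where
  "minus_exponents = {r. int N dvd r * (a * d - b * c + 1)}"

text \<open>Pulling back along t raises the commutator pairing of x and y to the power det A.
  Membership in the minus part makes the pullback of \<open>\<tau>\<^sub>0 r\<close> times
  \<open>\<tau>\<^sub>0 r\<close> symmetric, which at (x, y) reads r a d + r = r b c modulo
  \<open>N\<close>.\<close>

lemma schur_minus_class:
  assumes "C \<in> carrier (schur_minus_group K G (\<phi> t))"
  obtains r where "r \<in> minus_exponents" "C = B2 #>\<^bsub>C2\<^esub> \<tau>\<^sub>0 r"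
proof -
  obtain \<alpha> where \<alpha>: "\<alpha> \<in> Z2" "C = B2 #>\<^bsub>C2\<^esub> \<alpha>" and inv: "pullback2 G (\<phi> t) ` C = inv\<^bsub>schur K G\<^esub> C"
    using assms by (auto simp: schur_minus_group_def schur_eq sch.carrier_quot)
  obtain r where r: "C = B2 #>\<^bsub>C2\<^esub> \<tau>\<^sub>0 r"
    using cocycle_class[OF \<alpha>(1)] \<alpha>(2) by metis
  let ?\<beta> = "pullback2 G (\<phi> t) (\<tau>\<^sub>0 r) \<otimes>\<^bsub>C2\<^esub> \<tau>\<^sub>0 r"
  have "?\<beta> \<in> B2"
    using schur_minus_iff[OF \<tau>\<^sub>0_Z2] inv r by metis
  then have "?\<beta> (x, y) = ?\<beta> (y, x)"
    by (intro coboundary_symmetric x_closed y_closed)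
  then have "[r * (cx (\<phi> t x) * cy (\<phi> t y)) + r = r * (cx (\<phi> t y) * cy (\<phi> t x))] (mod int N)"
    by (simp add: coord_x coord_y \<zeta>_eq_iff flip: \<zeta>_add)
  moreover have "[cx (\<phi> t x) = a] (mod int N)" "[cy (\<phi> t x) = b] (mod int N)"
    "[cx (\<phi> t y) = c] (mod int N)" "[cy (\<phi> t y) = d] (mod int N)"
    using coord_\<phi>[OF x_closed] coord_\<phi>[OF y_closed] by (simp_all add: coord_x coord_y)
  then have "[r * (cx (\<phi> t x) * cy (\<phi> t y)) + r = r * (a * d) + r] (mod int N)"
    "[r * (cx (\<phi> t y) * cy (\<phi> t x)) = r * (c * b)] (mod int N)"
    by (auto intro!: cong_add cong_mult)
  ultimately have "[r * (a * d) + r = r * (c * b)] (mod int N)"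
    by (metis cong_sym cong_trans)
  then have "r \<in> minus_exponents"
    by (simp add: minus_exponents_def cong_iff_dvd_diff algebra_simps)
  then show thesis
    using that r by blast
qed

lemma explicit_cocycle:
  assumes "r \<in> minus_exponents"
  shows "(\<sigma>\<^sub>0 r, \<tau>\<^sub>0 r) \<in> Z2_ext K G (\<phi> t)"
proof -
  have r: "int N dvd r * (a * d - b * c + 1)"
    using assms by (simp add: minus_exponents_def)
  have "\<sigma>\<^sub>0 r (\<phi> t g) = \<sigma>\<^sub>0 r g" if g: "g \<in> carrier G" for g
  proof -
    have "[r * q (cx (\<phi> t g)) (cy (\<phi> t g)) = r * q (a * cx g + c * cy g) (b * cx g + d * cy g)] (mod int N)"
      by (intro cong_scalar_left q_cong coord_\<phi> g)
    also have "[r * q (a * cx g + c * cy g) (b * cx g + d * cy g) = r * q (cx g) (cy g)] (mod int N)"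
      by (rule q_invariant[OF r])
    finally show ?thesis
      using g by (simp add: \<zeta>_eq_iff)
  qed
  moreover have "\<sigma>\<^sub>0 r (g \<otimes> u) = \<tau>\<^sub>0 r (g, u) * \<tau>\<^sub>0 r (\<phi> t g, \<phi> t u) * \<sigma>\<^sub>0 r g * \<sigma>\<^sub>0 r u"
    if g: "g \<in> carrier G" "u \<in> carrier G" for g u
  proof -
    have "[r * q (cx (g \<otimes> u)) (cy (g \<otimes> u)) = r * q (cx g + cx u) (cy g + cy u)] (mod int N)"
      by (intro cong_scalar_left q_cong coord_mult g)
    also have "[r * q (cx g + cx u) (cy g + cy u) =
        r * (q (cx g) (cy g) + q (cx u) (cy u) + cx g * cy u + (a * cx g + c * cy g) * (b * cx u + d * cy u))] (mod int N)"
      by (rule q_add[OF r])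
    also have "[r * (q (cx g) (cy g) + q (cx u) (cy u) + cx g * cy u + (a * cx g + c * cy g) * (b * cx u + d * cy u)) =
        r * (q (cx g) (cy g) + q (cx u) (cy u) + cx g * cy u + cx (\<phi> t g) * cy (\<phi> t u))] (mod int N)"
      by (intro cong_scalar_left cong_add cong_mult cong_refl cong_sym[OF coord_\<phi>(1)] cong_sym[OF coord_\<phi>(2)] g)
    also have "r * (q (cx g) (cy g) + q (cx u) (cy u) + cx g * cy u + cx (\<phi> t g) * cy (\<phi> t u)) =
        r * (cx g * cy u) + r * (cx (\<phi> t g) * cy (\<phi> t u)) + r * q (cx g) (cy g) + r * q (cx u) (cy u)"
      by (simp add: algebra_simps)
    finally show ?thesis
      using g by (simp add: \<zeta>_eq_iff flip: \<zeta>_add)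
  qed
  ultimately show ?thesis
    using \<tau>\<^sub>0_Z2 \<zeta>_nonzero
    by (auto simp: mem_Z2_ext mem_C1 coord_one q_zero simp del: carrier_product_group)
qed

end

section \<open>The image of \<open>Psi\<close> and its homomorphic section\<close>

context bicyclic_action
begin

text \<open>Each class in the minus part contains an explicit \<open>\<tau>\<^sub>0 r\<close> that
  is accompanied by \<open>\<sigma>\<^sub>0 r\<close>; normalizing this pair to \<sigma> = 1 keeps
  the class in the Schur multiplier.\<close>

lemma Psi_image_eq_minus: "Psi K G ` carrier (H2c_ext K G (\<phi> t)) = carrier (schur_minus_group K G (\<phi> t))"
proof (rule equalityI[OF Psi_image_subset_minus], rule subsetI)
  fix C assume "C \<in> carrier (schur_minus_group K G (\<phi> t))"
  then obtain r where r: "r \<in> minus_exponents" "C = B2 #>\<^bsub>C2\<^esub> \<tau>\<^sub>0 r"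
    by (rule schur_minus_class)
  obtain \<tau> where "\<tau> \<in> Z2c_ext K G (\<phi> t)" "B2 #>\<^bsub>C2\<^esub> \<tau> = B2 #>\<^bsub>C2\<^esub> \<tau>\<^sub>0 r"
    using ext_cocycle_reduce[OF explicit_cocycle[OF r(1)]] by metis
  then show "C \<in> Psi K G ` carrier (H2c_ext K G (\<phi> t))"
    unfolding Psi_image r(2) by (metis imageI)
qed

lemma Im_Psi_eq_minus: "Im_Psi_group K G (\<phi> t) = schur_minus_group K G (\<phi> t)"
proof -
  have "Im_Psi_group K G (\<phi> t) = (schur K G)\<lparr>carrier := carrier (schur_minus_group K G (\<phi> t))\<rparr>"
    unfolding Im_Psi_group_def Psi_image_eq_minus ..
  then show ?thesis
    by (simp add: schur_minus_group_def)
qed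

text \<open>The normalization involves choices, so \<tau> is not claimed to be multiplicative in r.
  What is recorded instead is the class of the explicit pair in \<open>H2_ext\<close>, which does
  depend multiplicatively on r.\<close>

lemma reduced_cocycles:
  obtains \<tau> where "\<And>r. r \<in> minus_exponents \<Longrightarrow> \<tau> r \<in> Z2c_ext K G (\<phi> t)"
    and "\<And>r. r \<in> minus_exponents \<Longrightarrow> B2_ext K G (\<phi> t) #>\<^bsub>ext_cochains K G\<^esub> (\<one>\<^bsub>C1\<^esub>, \<tau> r) =
        B2_ext K G (\<phi> t) #>\<^bsub>ext_cochains K G\<^esub> (\<sigma>\<^sub>0 r, \<tau>\<^sub>0 r)"
    and "\<And>r. r \<in> minus_exponents \<Longrightarrow> B2 #>\<^bsub>C2\<^esub> \<tau> r = B2 #>\<^bsub>C2\<^esub> \<tau>\<^sub>0 r"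
proof -
  have "\<exists>\<tau>. \<tau> \<in> Z2c_ext K G (\<phi> t) \<and>
      B2_ext K G (\<phi> t) #>\<^bsub>ext_cochains K G\<^esub> (\<one>\<^bsub>C1\<^esub>, \<tau>) =
        B2_ext K G (\<phi> t) #>\<^bsub>ext_cochains K G\<^esub> (\<sigma>\<^sub>0 r, \<tau>\<^sub>0 r) \<and>
      B2 #>\<^bsub>C2\<^esub> \<tau> = B2 #>\<^bsub>C2\<^esub> \<tau>\<^sub>0 r" if r: "r \<in> minus_exponents" for r
    by (rule ext_cocycle_reduce[OF explicit_cocycle[OF r]]) blast
  then show thesis
    using that by metis
qed

text \<open>A coboundary carrying (1, \<tau>') to (1, \<tau>) has first component 1, so its second
  component lies in \<open>B2c_ext\<close>. This brings equalities proved in \<open>H2_ext\<close>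
  back to \<open>H2c_ext\<close>.\<close>

lemma H2c_ext_eqI:
  assumes \<tau>: "\<tau> \<in> Z2c_ext K G (\<phi> t)" "\<tau>' \<in> Z2c_ext K G (\<phi> t)"
    and eq: "B2_ext K G (\<phi> t) #>\<^bsub>ext_cochains K G\<^esub> (\<one>\<^bsub>C1\<^esub>, \<tau>) =
        B2_ext K G (\<phi> t) #>\<^bsub>ext_cochains K G\<^esub> (\<one>\<^bsub>C1\<^esub>, \<tau>')"
  shows "B2c_ext K G (\<phi> t) #>\<^bsub>C2\<^esub> \<tau> = B2c_ext K G (\<phi> t) #>\<^bsub>C2\<^esub> \<tau>'"
proof -
  have Z: "(\<one>\<^bsub>C1\<^esub>, \<tau>) \<in> Z2_ext K G (\<phi> t)" "(\<one>\<^bsub>C1\<^esub>, \<tau>') \<in> Z2_ext K G (\<phi> t)"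
    using \<tau> by (simp_all add: Z2c_ext_def)
  obtain \<beta>1 \<beta>2 where \<beta>: "(\<beta>1, \<beta>2) \<in> B2_ext K G (\<phi> t)"
    "(\<one>\<^bsub>C1\<^esub>, \<tau>) = (\<beta>1, \<beta>2) \<otimes>\<^bsub>ext_cochains K G\<^esub> (\<one>\<^bsub>C1\<^esub>, \<tau>')"
    using eq ext.rcoset_eq_iff[OF Z] by (metis surj_pair)
  then have "\<beta>1 \<in> carrier C1" "\<one>\<^bsub>C1\<^esub> = \<beta>1 \<otimes>\<^bsub>C1\<^esub> \<one>\<^bsub>C1\<^esub>" "\<tau> = \<beta>2 \<otimes>\<^bsub>C2\<^esub> \<tau>'"
    using B2_ext_subset mem_Z2_ext
    by (auto simp: ext_cochains_def simp del: carrier_product_group mult_product_group one_product_group)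
  then have "\<beta>1 = \<one>\<^bsub>C1\<^esub>" "\<tau> = \<beta>2 \<otimes>\<^bsub>C2\<^esub> \<tau>'"
    using monoid.r_one[OF group.is_monoid[OF group_unit_fun]] by metis+
  then show ?thesis
    using \<beta>(1) extc.rcoset_eq_iff[OF \<tau>] unfolding B2c_ext_def by blast
qed

text \<open>The section sends the class of \<open>\<tau>\<^sub>0 r\<close> to the class of the
  normalized cocycle with exponent r. Multiplicativity is checked in \<open>H2_ext\<close> on the
  explicit pairs and transferred back.\<close>

lemma Psi_split:
  "H2c_ext K G (\<phi> t) \<cong> Ker_Psi_group K G (\<phi> t) \<times>\<times> Im_Psi_group K G (\<phi> t)"
proof -
  let ?E = "ext_cochains K G" and ?M = "schur_minus_group K G (\<phi> t)"
  obtain \<tau> where \<tau>: "\<And>r. r \<in> minus_exponents \<Longrightarrow> \<tau> r \<in> Z2c_ext K G (\<phi> t)"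
    and \<tau>_ext: "\<And>r. r \<in> minus_exponents \<Longrightarrow> B2_ext K G (\<phi> t) #>\<^bsub>?E\<^esub> (\<one>\<^bsub>C1\<^esub>, \<tau> r) =
        B2_ext K G (\<phi> t) #>\<^bsub>?E\<^esub> (\<sigma>\<^sub>0 r, \<tau>\<^sub>0 r)"
    and \<tau>_class: "\<And>r. r \<in> minus_exponents \<Longrightarrow> B2 #>\<^bsub>C2\<^esub> \<tau> r = B2 #>\<^bsub>C2\<^esub> \<tau>\<^sub>0 r"
    using reduced_cocycles by blast
  \<comment> \<open>The exponent is determined by the class only modulo \<open>N\<close>; any choice
    will do.\<close>
  define e where "e C = (SOME r. r \<in> minus_exponents \<and> C = B2 #>\<^bsub>C2\<^esub> \<tau>\<^sub>0 r)" for C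
  have e: "e C \<in> minus_exponents" "C = B2 #>\<^bsub>C2\<^esub> \<tau>\<^sub>0 (e C)" if "C \<in> carrier ?M" for C
  proof -
    have "\<exists>r. r \<in> minus_exponents \<and> C = B2 #>\<^bsub>C2\<^esub> \<tau>\<^sub>0 r"
      using schur_minus_class[OF that] by metis
    then have "e C \<in> minus_exponents \<and> C = B2 #>\<^bsub>C2\<^esub> \<tau>\<^sub>0 (e C)"
      unfolding e_def by (rule someI_ex)
    then show "e C \<in> minus_exponents" "C = B2 #>\<^bsub>C2\<^esub> \<tau>\<^sub>0 (e C)"
      by blast+
  qed
  define s where "s C = B2c_ext K G (\<phi> t) #>\<^bsub>C2\<^esub> \<tau> (e C)" for C
  have M_eq: "(schur K G)\<lparr>carrier := carrier ?M\<rparr> = ?M"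
    by (simp add: schur_minus_group_def)
  have "s \<in> hom ?M extc.quot"
  proof (rule homI)
    fix C assume "C \<in> carrier ?M"
    then show "s C \<in> carrier extc.quot"
      using e \<tau> by (auto simp: s_def extc.carrier_quot)
  next
    fix C D assume CD: "C \<in> carrier ?M" "D \<in> carrier ?M"
    \<comment> \<open>The minus part is closed under multiplication because it is the image of
      \<open>Psi\<close>.\<close>
    have CD_M: "C \<otimes>\<^bsub>?M\<^esub> D \<in> carrier ?M"
    proof -
      interpret Psi: group_hom "H2c_ext K G (\<phi> t)" "schur K G" "Psi K G"
        by (rule group_hom_Psi)
      have "subgroup (carrier ?M) (schur K G)"
        using Psi.img_is_subgroup unfolding Psi_image_eq_minus .
      moreover have "C \<otimes>\<^bsub>?M\<^esub> D = C \<otimes>\<^bsub>schur K G\<^esub> D"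
        by (simp add: schur_minus_group_def)
      ultimately show ?thesis
        using CD subgroup.m_closed by metis
    qed
    let ?r = "e C" and ?r' = "e D" and ?r'' = "e (C \<otimes>\<^bsub>?M\<^esub> D)"
    have r: "?r \<in> minus_exponents" "?r' \<in> minus_exponents" "?r'' \<in> minus_exponents"
      using e CD CD_M by blast+
    have "C \<otimes>\<^bsub>?M\<^esub> D = (B2 #>\<^bsub>C2\<^esub> \<tau>\<^sub>0 ?r) \<otimes>\<^bsub>sch.quot\<^esub> (B2 #>\<^bsub>C2\<^esub> \<tau>\<^sub>0 ?r')"
      using e(2)[OF CD(1)] e(2)[OF CD(2)] by (simp add: schur_minus_group_def schur_eq del: mult_FactGroup)
    also have "\<dots> = B2 #>\<^bsub>C2\<^esub> \<tau>\<^sub>0 (?r + ?r')"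
      unfolding \<tau>\<^sub>0_add by (rule sch.mult_quot[OF \<tau>\<^sub>0_Z2 \<tau>\<^sub>0_Z2])
    \<comment> \<open>A congruence is enough, since \<open>\<sigma>\<^sub>0\<close> and
      \<open>\<tau>\<^sub>0\<close> depend on the exponent only modulo \<open>N\<close>.\<close>
    finally have cong: "[?r'' = ?r + ?r'] (mod int N)"
      using e(2)[OF CD_M] \<tau>\<^sub>0_class_inj by metis
    have prod: "\<tau> ?r \<otimes>\<^bsub>C2\<^esub> \<tau> ?r' \<in> Z2c_ext K G (\<phi> t)"
      by (intro subgroup.m_closed[OF subgroup_Z2c] \<tau> r)
    have Z: "(\<one>\<^bsub>C1\<^esub>, \<tau> ?r) \<in> Z2_ext K G (\<phi> t)" "(\<one>\<^bsub>C1\<^esub>, \<tau> ?r') \<in> Z2_ext K G (\<phi> t)"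
      using \<tau> r by (simp_all add: Z2c_ext_def)
    have one: "\<one>\<^bsub>C1\<^esub> \<otimes>\<^bsub>C1\<^esub> \<one>\<^bsub>C1\<^esub> = \<one>\<^bsub>C1\<^esub>"
      using monoid.l_one[OF group.is_monoid[OF group_unit_fun] monoid.one_closed[OF group.is_monoid[OF group_unit_fun]]] .
    have "B2_ext K G (\<phi> t) #>\<^bsub>?E\<^esub> (\<one>\<^bsub>C1\<^esub>, \<tau> ?r'') = B2_ext K G (\<phi> t) #>\<^bsub>?E\<^esub> (\<sigma>\<^sub>0 (?r + ?r'), \<tau>\<^sub>0 (?r + ?r'))"
      using \<tau>_ext[OF r(3)] \<sigma>\<^sub>0_cong[OF cong] \<tau>\<^sub>0_cong[OF cong] by simp
    also have "(\<sigma>\<^sub>0 (?r + ?r'), \<tau>\<^sub>0 (?r + ?r')) = (\<sigma>\<^sub>0 ?r, \<tau>\<^sub>0 ?r) \<otimes>\<^bsub>?E\<^esub> (\<sigma>\<^sub>0 ?r', \<tau>\<^sub>0 ?r')"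
      by (simp add: \<sigma>\<^sub>0_add \<tau>\<^sub>0_add ext_cochains_def del: mult_product_group)
    also have "B2_ext K G (\<phi> t) #>\<^bsub>?E\<^esub> ((\<sigma>\<^sub>0 ?r, \<tau>\<^sub>0 ?r) \<otimes>\<^bsub>?E\<^esub> (\<sigma>\<^sub>0 ?r', \<tau>\<^sub>0 ?r')) =
        (B2_ext K G (\<phi> t) #>\<^bsub>?E\<^esub> (\<sigma>\<^sub>0 ?r, \<tau>\<^sub>0 ?r)) \<otimes>\<^bsub>ext.quot\<^esub> (B2_ext K G (\<phi> t) #>\<^bsub>?E\<^esub> (\<sigma>\<^sub>0 ?r', \<tau>\<^sub>0 ?r'))"
      by (rule ext.mult_quot[symmetric]) (intro explicit_cocycle r)+
    also have "\<dots> = (B2_ext K G (\<phi> t) #>\<^bsub>?E\<^esub> (\<one>\<^bsub>C1\<^esub>, \<tau> ?r)) \<otimes>\<^bsub>ext.quot\<^esub> (B2_ext K G (\<phi> t) #>\<^bsub>?E\<^esub> (\<one>\<^bsub>C1\<^esub>, \<tau> ?r'))"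
      by (simp only: \<tau>_ext[OF r(1)] \<tau>_ext[OF r(2)])
    also have "\<dots> = B2_ext K G (\<phi> t) #>\<^bsub>?E\<^esub> ((\<one>\<^bsub>C1\<^esub>, \<tau> ?r) \<otimes>\<^bsub>?E\<^esub> (\<one>\<^bsub>C1\<^esub>, \<tau> ?r'))"
      by (rule ext.mult_quot[OF Z])
    also have "(\<one>\<^bsub>C1\<^esub>, \<tau> ?r) \<otimes>\<^bsub>?E\<^esub> (\<one>\<^bsub>C1\<^esub>, \<tau> ?r') = (\<one>\<^bsub>C1\<^esub>, \<tau> ?r \<otimes>\<^bsub>C2\<^esub> \<tau> ?r')"
      by (simp only: ext_cochains_def mult_DirProd one)
    finally have "s (C \<otimes>\<^bsub>?M\<^esub> D) = B2c_ext K G (\<phi> t) #>\<^bsub>C2\<^esub> (\<tau> ?r \<otimes>\<^bsub>C2\<^esub> \<tau> ?r')"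
      unfolding s_def by (rule H2c_ext_eqI[OF \<tau>[OF r(3)] prod])
    then show "s (C \<otimes>\<^bsub>?M\<^esub> D) = s C \<otimes>\<^bsub>extc.quot\<^esub> s D"
      unfolding s_def extc.mult_quot[OF \<tau>[OF r(1)] \<tau>[OF r(2)]] .
  qed
  moreover have "Psi K G (s C) = C" if "C \<in> carrier ?M" for C
    using e[OF that] \<tau> \<tau>_class by (simp add: s_def Psi_rcoset)
  ultimately have "H2c_ext K G (\<phi> t) \<cong> ((H2c_ext K G (\<phi> t))\<lparr>carrier := kernel (H2c_ext K G (\<phi> t)) (schur K G) (Psi K G)\<rparr>)
      \<times>\<times> ((schur K G)\<lparr>carrier := Psi K G ` carrier (H2c_ext K G (\<phi> t))\<rparr>)"
    using extc.comm_group_quot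
    by (intro split_epi_iso[OF group_hom_Psi]) (simp_all only: H2c_ext_eq[symmetric] Psi_image_eq_minus M_eq)
  then show ?thesis
    unfolding Ker_Psi_group_def Im_Psi_group_def .
qed

lemma group_Ker_Psi: "group (Ker_Psi_group K G (\<phi> t))"
  and group_Im_Psi: "group (Im_Psi_group K G (\<phi> t))"
proof -
  interpret Psi: group_hom "H2c_ext K G (\<phi> t)" "schur K G" "Psi K G"
    by (rule group_hom_Psi)
  show "group (Ker_Psi_group K G (\<phi> t))" "group (Im_Psi_group K G (\<phi> t))"
    unfolding Ker_Psi_group_def Im_Psi_group_def
    by (intro subgroup.subgroup_is_group Psi.subgroup_kernel Psi.img_is_subgroup Psi.G.is_group Psi.H.is_group)+
qed

theorem abelian_extension_cohomology:
  "H2_ext K G (\<phi> t) \<cong> H2c_ext K G (\<phi> t) \<and>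
   H2c_ext K G (\<phi> t) \<cong> Ker_Psi_group K G (\<phi> t) \<times>\<times> Im_Psi_group K G (\<phi> t) \<and>
   Ker_Psi_group K G (\<phi> t) \<times>\<times> Im_Psi_group K G (\<phi> t)
     \<cong> (char_fixed_group K G L \<phi> Mod char_norms K G \<phi> t) \<times>\<times> schur_minus_group K G (\<phi> t) \<and>
   (char_fixed_group K G L \<phi> Mod char_norms K G \<phi> t) \<times>\<times> schur_minus_group K G (\<phi> t)
     \<cong> H2_grp L (char_group K G) (char_act G \<phi>) \<times>\<times> schur_minus_group K G (\<phi> t)"
proof (intro conjI)
  have M: "group (schur_minus_group K G (\<phi> t))"
    using group_Im_Psi by (simp add: Im_Psi_eq_minus)
  have tate: "group (char_fixed_group K G L \<phi> Mod char_norms K G \<phi> t)"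
    unfolding tate_eq by (rule comm_group.axioms(2)[OF char.tate.comm_group_quot])
  have "group (H2_grp L (char_group K G) (char_act G \<phi>))"
    unfolding H2_grp_def Z2_grp_group_def by (rule comm_group.axioms(2)[OF char.coh.comm_group_quot])
  then have "char_fixed_group K G L \<phi> Mod char_norms K G \<phi> t \<cong> H2_grp L (char_group K G) (char_act G \<phi>)"
    unfolding tate_eq by (rule group.iso_sym[OF _ char.H2_grp_iso_tate])
  then show "(char_fixed_group K G L \<phi> Mod char_norms K G \<phi> t) \<times>\<times> schur_minus_group K G (\<phi> t)
     \<cong> H2_grp L (char_group K G) (char_act G \<phi>) \<times>\<times> schur_minus_group K G (\<phi> t)"
    by (intro DirProd_cong_iso tate M iso_refl)
  show "Ker_Psi_group K G (\<phi> t) \<times>\<times> Im_Psi_group K G (\<phi> t)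
     \<cong> (char_fixed_group K G L \<phi> Mod char_norms K G \<phi> t) \<times>\<times> schur_minus_group K G (\<phi> t)"
    unfolding Im_Psi_eq_minus by (intro DirProd_cong_iso group_Ker_Psi M Ker_Psi_iso_tate iso_refl)
qed (rule H2_ext_iso_H2c_ext Psi_split)+

end

section \<open>Quadratic corrections for the listed matrices\<close>

text \<open>The conditions under which \<open>(\<zeta>\<^sup>r\<^sup>q, \<tau>\<^sub>r)\<close> is a cocycle for every \<open>r\<close> with \<open>r (det A + 1) = 0\<close>.\<close>

definition quadratic_correction :: "int \<Rightarrow> int \<Rightarrow> int \<Rightarrow> int \<Rightarrow> int \<Rightarrow> (int \<Rightarrow> int \<Rightarrow> int) \<Rightarrow> bool" where
  "quadratic_correction N a b c d q \<longleftrightarrow>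
     (\<forall>i i' j j'. [i = i'] (mod N) \<longrightarrow> [j = j'] (mod N) \<longrightarrow> [q i j = q i' j'] (mod N)) \<and> q 0 0 = 0 \<and>
     (\<forall>r. N dvd r * (a * d - b * c + 1) \<longrightarrow>
        (\<forall>i j k l. [r * q (i + k) (j + l) =
           r * (q i j + q k l + i * l + (a * i + c * j) * (b * k + d * l))] (mod N)) \<and>
        (\<forall>i j. [r * q (a * i + c * j) (b * i + d * j) = r * q i j] (mod N)))"

text \<open>For q = 0 the bilinear form i l + (a i + c j) (b k + d l) must vanish after
  multiplication by r. Its coefficients are a b, 1 + a d, b c and c d, and 1 + a d = (det A + 1) + b
  c.\<close>

lemma quadratic_correction_zero:
  assumes "\<And>r. N dvd r * (a * d - b * c + 1) \<Longrightarrow> N dvd r * (a * b) \<and> N dvd r * (b * c) \<and> N dvd r * (c * d)"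
  shows "quadratic_correction N a b c d (\<lambda>_ _. 0)"
proof -
  have "N dvd r * (i * l + (a * i + c * j) * (b * k + d * l))"
    if r: "N dvd r * (a * d - b * c + 1)" for r i j k l
  proof -
    have "r * (i * l + (a * i + c * j) * (b * k + d * l)) = r * (a * b) * (i * k)
        + (r * (a * d - b * c + 1) + r * (b * c)) * (i * l) + r * (b * c) * (j * k) + r * (c * d) * (j * l)"
      by (simp add: algebra_simps)
    then show ?thesis
      using r assms[OF r] by (simp only: dvd_add dvd_mult2)
  qed
  then show ?thesis
    by (auto simp: quadratic_correction_def cong_sym_eq[of 0] cong_0_iff)
qed

lemma quadratic_correction_diagonal: "quadratic_correction N a 0 0 d (\<lambda>_ _. 0)"
  by (rule quadratic_correction_zero) simp

text \<open>The polarization of i j is i l + j k, which is exactly the bilinear form attached to the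
  exchange of coordinates; no condition on r is needed.\<close>

lemma quadratic_correction_swap: "quadratic_correction N 0 1 1 0 (\<lambda>i j. i * j)"
  by (auto simp: quadratic_correction_def algebra_simps intro: cong_mult)

text \<open>These matrices have determinant -1 modulo 4, so every r is admissible and q = 0 fails.
  In both cases the bilinear form reduces to 2 i k + 2 j l modulo 4, the polarization of i^2 +
  j^2.\<close>

lemma quadratic_correction_four:
  assumes "(a, b, c, d) = (1, 2, 2, 3) \<or> (a, b, c, d) = (-1, 2, 2, 1)"
  shows "quadratic_correction 4 a b c d (\<lambda>i j. i * i + j * j)"
proof -
  have "[r * ((i + k) * (i + k) + (j + l) * (j + l)) =
      r * (i * i + j * j + (k * k + l * l) + i * l + (a * i + c * j) * (b * k + d * l))] (mod 4)" for r i j k l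
    using assms unfolding cong_iff_dvd_diff
  proof (elim disjE)
    assume "(a, b, c, d) = (1, 2, 2, 3)"
    then have "r * ((i + k) * (i + k) + (j + l) * (j + l)) -
      r * (i * i + j * j + (k * k + l * l) + i * l + (a * i + c * j) * (b * k + d * l)) =
      4 * (r * (- (i * l) - j * k - j * l))"
      by (simp add: algebra_simps)
    then show "4 dvd r * ((i + k) * (i + k) + (j + l) * (j + l)) -
      r * (i * i + j * j + (k * k + l * l) + i * l + (a * i + c * j) * (b * k + d * l))"
      by (simp only: dvd_triv_left)
  next
    assume "(a, b, c, d) = (-1, 2, 2, 1)"
    then have "r * ((i + k) * (i + k) + (j + l) * (j + l)) -
      r * (i * i + j * j + (k * k + l * l) + i * l + (a * i + c * j) * (b * k + d * l)) =
      4 * (r * (i * k - j * k))"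
      by (simp add: algebra_simps)
    then show "4 dvd r * ((i + k) * (i + k) + (j + l) * (j + l)) -
      r * (i * i + j * j + (k * k + l * l) + i * l + (a * i + c * j) * (b * k + d * l))"
      by (simp only: dvd_triv_left)
  qed
  moreover have "[r * ((a * i + c * j) * (a * i + c * j) + (b * i + d * j) * (b * i + d * j)) =
      r * (i * i + j * j)] (mod 4)" for r i j
    using assms unfolding cong_iff_dvd_diff
  proof (elim disjE)
    assume "(a, b, c, d) = (1, 2, 2, 3)"
    then have "r * ((a * i + c * j) * (a * i + c * j) + (b * i + d * j) * (b * i + d * j)) - r * (i * i + j * j) =
      4 * (r * (i * i + 4 * (i * j) + 3 * (j * j)))"
      by (simp add: algebra_simps)
    then show "4 dvd r * ((a * i + c * j) * (a * i + c * j) + (b * i + d * j) * (b * i + d * j)) - r * (i * i + j * j)"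
      by (simp only: dvd_triv_left)
  next
    assume "(a, b, c, d) = (-1, 2, 2, 1)"
    then have "r * ((a * i + c * j) * (a * i + c * j) + (b * i + d * j) * (b * i + d * j)) - r * (i * i + j * j) =
      4 * (r * (i * i + j * j))"
      by (simp add: algebra_simps)
    then show "4 dvd r * ((a * i + c * j) * (a * i + c * j) + (b * i + d * j) * (b * i + d * j)) - r * (i * i + j * j)"
      by (simp only: dvd_triv_left)
  qed
  ultimately show ?thesis
    by (auto simp: quadratic_correction_def intro!: cong_add cong_mult)
qed

text \<open>If the determinant is \<open>1\<close> modulo \<open>4\<close>, every admissible exponent \<open>r\<close> is even and so
  absorbs the off-diagonal multiples of \<open>h = N / 2\<close>.\<close>

lemma quadratic_correction_half:
  assumes h: "even h" and det: "[a * d - b * c = 1] (mod 4)" and "h dvd b" "h dvd c"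
  shows "quadratic_correction (2 * h) a b c d (\<lambda>_ _. 0)"
proof (rule quadratic_correction_zero)
  fix r assume r: "2 * h dvd r * (a * d - b * c + 1)"
  obtain m where "a * d - b * c = 1 + 4 * m"
    using det by (metis cong_iff_lin cong_sym mult.commute)
  then have eq: "a * d - b * c + 1 = 2 * (1 + 2 * m)"
    by simp
  have "4 dvd 2 * h"
    using h by auto
  then have "4 dvd 2 * (r * (1 + 2 * m))"
    using r dvd_trans unfolding eq by (metis mult.left_commute)
  moreover have "even z" if "4 dvd 2 * z" for z :: int
    using that by presburger
  ultimately have "even (r * (1 + 2 * m))"
    by blast
  then have "2 dvd r"
    by simp
  \<comment> \<open>The factor 2 of \<open>r\<close> completes each multiple of \<open>h\<close>;
    the products a b, b c and c d all contain b or c.\<close>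
  then have "2 * h dvd r * (h * z)" for z
    by (metis dvd_mult2 mult.assoc mult_dvd_mono dvd_refl)
  then show "2 * h dvd r * (a * b) \<and> 2 * h dvd r * (b * c) \<and> 2 * h dvd r * (c * d)"
    using assms(3,4) by (auto elim!: dvdE simp: mult.assoc mult.left_commute[of a h])
qed

text \<open>Diagonal matrices and the exchange are immediate. In the triangular case the diagonal
  entry is odd, so the determinant, its square, is 1 modulo 4. For the two matrices with both
  off-diagonal entries h, the determinant differs from 1 by a multiple of h; this is 0 modulo 4 for
  n \<ge> 3, while n = 2 is treated separately.\<close>

lemma action_matrix_correction:
  assumes n: "n \<ge> 2" and A: "[[a, c], [b, d]] \<in> action_matrices n"
  shows "\<exists>q. quadratic_correction (2 ^ n) a b c d q"
proof -
  define h :: int where "h = 2 ^ (n - 1)"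
  have N: "(2 :: int) ^ n = 2 * h"
    using n by (simp add: h_def flip: power_Suc)
  have "even h"
    using n by (simp add: h_def)
  then obtain h' where h': "h = 2 * h'"
    by blast
  have half: ?thesis if "[a * d - b * c = 1] (mod 4)" "h dvd b" "h dvd c"
    using quadratic_correction_half[OF \<open>even h\<close> that] unfolding N by blast
  consider "b = 0" "c = 0" | "a = 0" "b = 1" "c = 1" "d = 0"
    | "a \<in> {1, -1, 1 + h, -1 + h}" "d = a" "b = h" "c = 0"
    | "(a, b, c, d) = (1, h, h, 1 + h) \<or> (a, b, c, d) = (-1, h, h, -1 + h)"
    using A unfolding action_matrices_def Let_def h_def[symmetric] by auto
  then show ?thesis
  proof cases
    case 1
    then show ?thesis
      using quadratic_correction_diagonal by blast
  next
    case 2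
    then show ?thesis
      using quadratic_correction_swap by blast
  next
    case 3
    have "odd a"
      using 3(1) by (auto simp: h')
    then obtain m where "a = 2 * m + 1"
      by (rule oddE)
    then have "a * a - 1 = 4 * (m * m + m)"
      by (simp add: algebra_simps)
    then have "[a * a = 1] (mod 4)"
      by (simp add: cong_iff_dvd_diff)
    then show ?thesis
      using 3 by (intro half) auto
  next
    case 4
    show ?thesis
    proof (cases "n = 2")
      case True
      then have "h = 2"
        by (simp add: h_def)
      then show ?thesis
        using quadratic_correction_four[of a b c d] 4 True by auto
    next
      case False
      then have "n - 1 = Suc (Suc (n - 3))"
        using n by simp
      then have "h = 4 * 2 ^ (n - 3)"
        by (simp add: h_def)
      then have "4 dvd h"
        by (metis dvd_triv_left)
      moreover have "a * d - b * c - 1 = h * (1 - h) \<or> a * d - b * c - 1 = h * (- 1 - h)"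
        using 4 by (auto simp: algebra_simps)
      ultimately have "[a * d - b * c = 1] (mod 4)"
        unfolding cong_iff_dvd_diff by (metis dvd_mult2)
      then show ?thesis
        using 4 by (intro half) auto
    qed
  qed
qed

section \<open>The chain of isomorphisms for the listed actions\<close>

theorem theorem4p3:
  fixes n :: nat
    and G :: "'g monoid" and x y :: 'g
    and L :: "'l monoid" and t :: 'l
    and \<phi> :: "'l \<Rightarrow> 'g \<Rightarrow> 'g"
    and a b c d :: int
    and \<sigma> :: "'g \<Rightarrow> 'k::{alg_closed_field, field_char_0}"
    and \<tau> :: "'g \<times> 'g \<Rightarrow> 'k"
    and scale :: "'k \<Rightarrow> 'h::ring_1 \<Rightarrow> 'h"
    and \<Delta> :: "'h \<Rightarrow> ('h \<times> 'h) list" and \<epsilon> :: "'h \<Rightarrow> 'k" and S :: "'h \<Rightarrow> 'h"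
  assumes n: "n \<ge> 2"
    and G: "group G" "x \<in> carrier G" "y \<in> carrier G"
      "(\<lambda>(i, j). x [^]\<^bsub>G\<^esub> i \<otimes>\<^bsub>G\<^esub> y [^]\<^bsub>G\<^esub> j)
         \<in> iso (integer_mod_group (2 ^ n) \<times>\<times> integer_mod_group (2 ^ n)) G"
    and L: "group L" "carrier L = {\<one>\<^bsub>L\<^esub>, t}" "t \<noteq> \<one>\<^bsub>L\<^esub>"
    and action: "\<phi> \<in> hom L (AutoGroup G)"
      "\<phi> t x = x [^]\<^bsub>G\<^esub> a \<otimes>\<^bsub>G\<^esub> y [^]\<^bsub>G\<^esub> b"
      "\<phi> t y = x [^]\<^bsub>G\<^esub> c \<otimes>\<^bsub>G\<^esub> y [^]\<^bsub>G\<^esub> d"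
    and matrix: "\<exists>A\<in>action_matrices n. mat_cong (2 ^ n) [[a, c], [b, d]] A"
      "\<not> mat_cong (2 ^ n) [[a, c], [b, d]] [[1, 0], [0, 1]]"
    and H: "hopf_algebra scale \<Delta> \<epsilon> S"
      "hopf_algebra.semisimple scale"
      "hopf_algebra.nontrivial scale \<Delta>"
      "vector_space.dim scale (UNIV :: 'h set) = 2 ^ (2 * n + 1)"
      "hopf_algebra.grouplikes scale \<Delta> \<cong> integer_mod_group (2 ^ n) \<times>\<times> integer_mod_group (2 ^ n)"
    and cocycle: "(\<sigma>, \<tau>) \<in> Z2_ext unit_group G (\<phi> t)"
    and bicrossed: "hopf_algebra.is_bicrossed_product scale \<Delta> G L t \<phi> \<sigma> \<tau>"
  shows "let K = (unit_group :: 'k monoid); T = \<phi> t in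
      H2_ext K G T \<cong> H2c_ext K G T \<and>
      H2c_ext K G T \<cong> Ker_Psi_group K G T \<times>\<times> Im_Psi_group K G T \<and>
      Ker_Psi_group K G T \<times>\<times> Im_Psi_group K G T
        \<cong> (char_fixed_group K G L \<phi> Mod char_norms K G \<phi> t) \<times>\<times> schur_minus_group K G T \<and>
      (char_fixed_group K G L \<phi> Mod char_norms K G \<phi> t) \<times>\<times> schur_minus_group K G T
        \<cong> H2_grp L (char_group K G) (char_act G \<phi>) \<times>\<times> schur_minus_group K G T"
proof -
  obtain A where A: "A \<in> action_matrices n" "mat_cong (2 ^ n) [[a, c], [b, d]] A"
    using matrix(1) by blast
  then obtain a' b' c' d' where A_eq: "A = [[a', c'], [b', d']]"
    and cong: "[a = a'] (mod 2 ^ n)" "[c = c'] (mod 2 ^ n)" "[b = b'] (mod 2 ^ n)" "[d = d'] (mod 2 ^ n)"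
    by (auto simp: mat_cong_def list_all2_Cons1)
  obtain q where q: "quadratic_correction (2 ^ n) a' b' c' d' q"
    using action_matrix_correction[OF n] A(1) unfolding A_eq by blast
  obtain \<zeta> :: 'k where \<zeta>: "\<zeta> \<noteq> 0" "\<And>r. \<zeta> powi r = 1 \<longleftrightarrow> 2 ^ n dvd r"
    "\<And>w. w ^ (2 ^ n) = 1 \<Longrightarrow> \<exists>r. w = \<zeta> powi r"
    using primitive_root_two_power_exists[of n] by metis
  interpret bicyclic_group G x y "2 ^ n"
    using n G power_increasing[of 1 n "2 :: nat"] by (simp add: bicyclic_group_def bicyclic_group_axioms_def)
  \<comment> \<open>Powers of x and y depend on exponents modulo 2^n only, so the given integers may
    be replaced by the entries of the listed matrix.\<close>
  have "\<phi> t x = x [^]\<^bsub>G\<^esub> a' \<otimes>\<^bsub>G\<^esub> y [^]\<^bsub>G\<^esub> b'" "\<phi> t y = x [^]\<^bsub>G\<^esub> c' \<otimes>\<^bsub>G\<^esub> y [^]\<^bsub>G\<^esub> d'"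
    using action(2,3) G.int_pow_cong[OF G(2) pow_N_eq_one[OF G(2)]] G.int_pow_cong[OF G(3) pow_N_eq_one[OF G(3)]] cong
    by simp_all
  then have "bicyclic_action L t G \<phi> x y (2 ^ n) \<zeta> a' b' c' d' q"
  proof (intro bicyclic_action.intro bicyclic_action_axioms.intro order2_action.intro order2_group.intro
      order2_group_axioms.intro order2_action_axioms.intro bicyclic_group_axioms)
  qed (use L G(1) action(1) \<zeta> q[unfolded quadratic_correction_def] in \<open>simp_all\<close>)
  then show ?thesis
    unfolding Let_def by (rule bicyclic_action.abelian_extension_cohomology)
qed

end
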